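(* Let $(\mathfrak{F},F)$ be a structure category. Let $\bar X$ and $\bar X'$ be finite stratified spaces with attached spaces which are locally finite and countable CW-complexes. Let $\bar f\colon \bar X \to \bar X'$ be a stratum-preserving map of stratified spaces and let $X'\to\bar X'$ be an $\mathfrak{F}$-stratified fibre bundle. Then the pull-back $\bar f^*X' \to \bar X$ is an $\mathfrak{F}$-stratified fibre bundle.
   Context: Structure category: a small category $\mathfrak{F}$ with a functor $F\colon\mathfrak{F}\to\mathbf{Top}$ (fibre functor) such that $F(V)$ is locally compact, second-countable and Hausdorff for each object $V$; one often writes $V$ for $F(V)$. $\mathfrak{F}$-family: a space $X$ with a map $p_X\colon X\to\bar X$ (projection to the base space) and, for every $b\in\bar X$, an object $X_b$ of $\mathfrak{F}$ and a chosen homeomorphism (chart) $\Phi_b\colon p_X^{-1}(b)\approx F(X_b)$. An $\mathfrak{F}$-map $X\to Y$ is a pair of continuous maps $f\colon X\to Y$, $\bar f\colon\bar X\to\bar Y$ with $p_Yf=\bar fp_X$ such that for every $b\in\bar X$ the composite $\Phi_{\bar f b}\circ f|_{p_X^{-1}(b)}\circ\Phi_b^{-1}\colon F(X_b)\to F(Y_{\bar fb})$ equals $F(\phi)$ for some morphism $\phi\colon X_b\to Y_{\bar f b}$ of $\mathfrak{F}$. These form the category $\mathfrak{F}$-$\mathbf{Top}$. Pull-back: for a family $Y$ and a map $\bar f\colon\bar X\to\bar Y$, $\bar f^*Y=\bar X\times_{\bar Y}Y\to\bar X$ is a family with $(\bar f^*Y)_b=Y_{\bar f b}$ and charts $p^{-1}(b)\approx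 p_Y^{-1}(\bar fb)\approx F(Y_{\bar f b})$. The restriction $Y|U$ for $U\subset\bar Y$ is the pull-back along the inclusion. $\mathfrak{F}$-bundle: a family $X$ such that each $b\in\bar X$ has a neighbourhood $U$ with $X|U$ isomorphic in $\mathfrak{F}$-$\mathbf{Top}$ to a product family $U\times F(V)\to U$ (charts given by projection), for some object $V$. Push-outs: a closed inclusion is an $\mathfrak{F}$-map $i\colon A\to Y$ such that $\bar i$ is the inclusion of a closed subspace and $A=\bar i^*Y$. Push-outs in $\mathfrak{F}$-$\mathbf{Top}$ of $X\leftarrow A\xrightarrow{i}Y$ with $i$ a closed inclusion are formed by the push-outs in $\mathbf{Top}$ of total spaces and of base spaces. $\lim$ of an increasing sequence denotes the colimit. Stratified space: a CW-pair is a pair homeomorphic to (CW-complex, subcomplex); a CW-space is a space homeomorphic to a CW-complex. A stratified space is a space $X$ with a filtration $X_0\subset X_1\subset\dots\subset\lim_{n}X_n=X$, where $X_0$ is a CW-space, and for every $i\ge1$ a given CW-pair $(M_i,A_i)$ and map $h_i\colon A_i\to X_{i-1}$ such that $X_i=X_{i-1}\cup_{h_i}M_i$ is the push-out. The pairs $(M_i,A_i)$ and the space $X_0$ are the attached spaces; the $X_i\smallsetminus X_{i-1}$ are the strata. It is finite if the number of non-empty strata is finite. It is a stratified CW-complex if all attaching maps $h_i$ are cellular; a stratified space that is not finite is always assumed to be a stratified CW-complex. A map $f\colon X\to X'$ of stratified spaces is a filtration-preserving map $f=\{f_n\}$ together with maps of pairs $g_i\colon(M_i,A_i)\to(M_i',A_i')$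 compatible with the attaching maps ($f_{i-1}h_i=h'_i\,g_i|_{A_i}$) and with $g_i\cup f_{i-1}=f_i$ for $i\ge1$. It is stratum-preserving if $f_i(X_i\smallsetminus X_{i-1})\subset X'_i\smallsetminus X'_{i-1}$ for every $i$. $\mathfrak{F}$-stratified fibre bundle: a stratified space $\bar X$ (with attached spaces $(\bar M_i,\bar A_i)$, $\bar X_0$ and attaching maps $\bar h_i$) together with an $\mathfrak{F}$-family $X\to\bar X$ such that, with $X_i=X|\bar X_i$: $X_0\to\bar X_0$ is an $\mathfrak{F}$-bundle; for $i\ge1$ there are an $\mathfrak{F}$-bundle $M_i\to\bar M_i$ with $A_i=M_i|\bar A_i$ and an $\mathfrak{F}$-map $h_i\colon A_i\to X_{i-1}$ over $\bar h_i$ such that $X_i=X_{i-1}\cup_{h_i}M_i$ is the push-out of $\mathfrak{F}$-maps; and $X=\lim_{i}X_i$. *)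

theory Defs
  imports "HOL-Analysis.Analysis"
begin

section \<open>Structure categories\<close>

text \<open>A small category together with a functor to spaces. All spaces \<open>F(V)\<close> live on one
  type \<open>'v\<close>; since the category is small this is no restriction. The function \<open>FMap \<FF> \<phi>\<close> is
  only relevant on the space of the domain of \<open>\<phi>\<close>.\<close>

record ('o, 'r, 'v) strcat =
  Ob :: "'o set"
  Ar :: "'r set"
  Dom :: "'r \<Rightarrow> 'o"
  Cod :: "'r \<Rightarrow> 'o"
  Idt :: "'o \<Rightarrow> 'r"
  Cmp :: "'r \<Rightarrow> 'r \<Rightarrow> 'r"
  FOb :: "'o \<Rightarrow> 'v topology"
  FMap :: "'r \<Rightarrow> 'v \<Rightarrow> 'v"

definition small_category :: "('o, 'r, 'v) strcat \<Rightarrow> bool" where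
  "small_category \<FF> \<longleftrightarrow>
     (\<forall>\<phi>\<in>Ar \<FF>. Dom \<FF> \<phi> \<in> Ob \<FF> \<and> Cod \<FF> \<phi> \<in> Ob \<FF>) \<and>
     (\<forall>V\<in>Ob \<FF>. Idt \<FF> V \<in> Ar \<FF> \<and> Dom \<FF> (Idt \<FF> V) = V \<and> Cod \<FF> (Idt \<FF> V) = V) \<and>
     (\<forall>\<phi>\<in>Ar \<FF>. \<forall>\<psi>\<in>Ar \<FF>. Dom \<FF> \<psi> = Cod \<FF> \<phi> \<longrightarrow>
        Cmp \<FF> \<psi> \<phi> \<in> Ar \<FF> \<and> Dom \<FF> (Cmp \<FF> \<psi> \<phi>) = Dom \<FF> \<phi> \<and> Cod \<FF> (Cmp \<FF> \<psi> \<phi>) = Cod \<FF> \<psi>) \<and>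
     (\<forall>\<phi>\<in>Ar \<FF>. Cmp \<FF> \<phi> (Idt \<FF> (Dom \<FF> \<phi>)) = \<phi> \<and> Cmp \<FF> (Idt \<FF> (Cod \<FF> \<phi>)) \<phi> = \<phi>) \<and>
     (\<forall>\<phi>\<in>Ar \<FF>. \<forall>\<psi>\<in>Ar \<FF>. \<forall>\<theta>\<in>Ar \<FF>. Dom \<FF> \<psi> = Cod \<FF> \<phi> \<longrightarrow> Dom \<FF> \<theta> = Cod \<FF> \<psi> \<longrightarrow>
        Cmp \<FF> \<theta> (Cmp \<FF> \<psi> \<phi>) = Cmp \<FF> (Cmp \<FF> \<theta> \<psi>) \<phi>)"

definition functor_to_spaces :: "('o, 'r, 'v) strcat \<Rightarrow> bool" where
  "functor_to_spaces \<FF> \<longleftrightarrow>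
     (\<forall>\<phi>\<in>Ar \<FF>. continuous_map (FOb \<FF> (Dom \<FF> \<phi>)) (FOb \<FF> (Cod \<FF> \<phi>)) (FMap \<FF> \<phi>)) \<and>
     (\<forall>V\<in>Ob \<FF>. \<forall>v\<in>topspace (FOb \<FF> V). FMap \<FF> (Idt \<FF> V) v = v) \<and>
     (\<forall>\<phi>\<in>Ar \<FF>. \<forall>\<psi>\<in>Ar \<FF>. Dom \<FF> \<psi> = Cod \<FF> \<phi> \<longrightarrow>
        (\<forall>v\<in>topspace (FOb \<FF> (Dom \<FF> \<phi>)). FMap \<FF> (Cmp \<FF> \<psi> \<phi>) v = FMap \<FF> \<psi> (FMap \<FF> \<phi> v)))"

definition structure_category :: "('o, 'r, 'v) strcat \<Rightarrow> bool" where
  "structure_category \<FF> \<longleftrightarrow>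
     small_category \<FF> \<and> functor_to_spaces \<FF> \<and>
     (\<forall>V\<in>Ob \<FF>. locally_compact_space (FOb \<FF> V) \<and> second_countable (FOb \<FF> V) \<and>
        Hausdorff_space (FOb \<FF> V))"

section \<open>Families, maps of families, bundles\<close>

record ('x, 'b, 'o, 'v) family =
  total_sp :: "'x topology"
  base_sp :: "'b topology"
  prj :: "'x \<Rightarrow> 'b"
  fib_ob :: "'b \<Rightarrow> 'o"
  chart :: "'b \<Rightarrow> 'x \<Rightarrow> 'v"

definition fibre :: "('x, 'b, 'o, 'v) family \<Rightarrow> 'b \<Rightarrow> 'x set" where
  "fibre X b = {x \<in> topspace (total_sp X). prj X x = b}"

definition is_family :: "('o, 'r, 'v) strcat \<Rightarrow> ('x, 'b, 'o, 'v) family \<Rightarrow> bool" where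
  "is_family \<FF> X \<longleftrightarrow>
     continuous_map (total_sp X) (base_sp X) (prj X) \<and>
     (\<forall>b\<in>topspace (base_sp X). fib_ob X b \<in> Ob \<FF> \<and>
        homeomorphic_map (subtopology (total_sp X) (fibre X b)) (FOb \<FF> (fib_ob X b)) (chart X b))"

definition F_map ::
  "('o, 'r, 'v) strcat \<Rightarrow> ('x, 'b, 'o, 'v) family \<Rightarrow> ('y, 'c, 'o, 'v) family
     \<Rightarrow> ('x \<Rightarrow> 'y) \<Rightarrow> ('b \<Rightarrow> 'c) \<Rightarrow> bool" where
  "F_map \<FF> X Y f fb \<longleftrightarrow>
     continuous_map (total_sp X) (total_sp Y) f \<and>
     continuous_map (base_sp X) (base_sp Y) fb \<and>
     (\<forall>x\<in>topspace (total_sp X). prj Y (f x) = fb (prj X x)) \<and>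
     (\<forall>b\<in>topspace (base_sp X). \<exists>\<phi>\<in>Ar \<FF>.
        Dom \<FF> \<phi> = fib_ob X b \<and> Cod \<FF> \<phi> = fib_ob Y (fb b) \<and>
        (\<forall>x\<in>fibre X b. chart Y (fb b) (f x) = FMap \<FF> \<phi> (chart X b x)))"

definition F_iso ::
  "('o, 'r, 'v) strcat \<Rightarrow> ('x, 'b, 'o, 'v) family \<Rightarrow> ('y, 'c, 'o, 'v) family
     \<Rightarrow> ('x \<Rightarrow> 'y) \<Rightarrow> ('b \<Rightarrow> 'c) \<Rightarrow> bool" where
  "F_iso \<FF> X Y f fb \<longleftrightarrow>
     F_map \<FF> X Y f fb \<and>
     (\<exists>g gb. F_map \<FF> Y X g gb \<and>
        (\<forall>x\<in>topspace (total_sp X). g (f x) = x) \<and> (\<forall>y\<in>topspace (total_sp Y). f (g y) = y) \<and>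
        (\<forall>b\<in>topspace (base_sp X). gb (fb b) = b) \<and> (\<forall>c\<in>topspace (base_sp Y). fb (gb c) = c))"

definition pullback ::
  "'b topology \<Rightarrow> ('b \<Rightarrow> 'c) \<Rightarrow> ('y, 'c, 'o, 'v) family \<Rightarrow> ('b \<times> 'y, 'b, 'o, 'v) family" where
  "pullback B fb Y =
     \<lparr> total_sp = subtopology (prod_topology B (total_sp Y)) {(b, y). fb b = prj Y y},
       base_sp = B,
       prj = fst,
       fib_ob = (\<lambda>b. fib_ob Y (fb b)),
       chart = (\<lambda>b (b', y). chart Y (fb b) y) \<rparr>"

text \<open>The restriction to a subset of the base is realised on the subspace \<open>p\<^sup>-\<^sup>1(U)\<close> of the total
  space; \<open>restrict_family_iso_pullback\<close> below identifies it with the pull-back along the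
  inclusion.\<close>

definition restrict_family ::
  "('x, 'b, 'o, 'v) family \<Rightarrow> 'b set \<Rightarrow> ('x, 'b, 'o, 'v) family" where
  "restrict_family X U =
     X \<lparr> total_sp := subtopology (total_sp X) {x \<in> topspace (total_sp X). prj X x \<in> U},
         base_sp := subtopology (base_sp X) U \<rparr>"

definition product_family ::
  "('o, 'r, 'v) strcat \<Rightarrow> 'b topology \<Rightarrow> 'o \<Rightarrow> ('b \<times> 'v, 'b, 'o, 'v) family" where
  "product_family \<FF> B V =
     \<lparr> total_sp = prod_topology B (FOb \<FF> V), base_sp = B, prj = fst,
       fib_ob = (\<lambda>b. V), chart = (\<lambda>b. snd) \<rparr>"

definition F_bundle :: "('o, 'r, 'v) strcat \<Rightarrow> ('x, 'b, 'o, 'v) family \<Rightarrow> bool" where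
  "F_bundle \<FF> X \<longleftrightarrow>
     is_family \<FF> X \<and>
     (\<forall>b\<in>topspace (base_sp X). \<exists>U. openin (base_sp X) U \<and> b \<in> U \<and>
        (\<exists>V\<in>Ob \<FF>. \<exists>f fb.
           F_iso \<FF> (restrict_family X U) (product_family \<FF> (subtopology (base_sp X) U) V) f fb))"

section \<open>Push-outs\<close>

text \<open>The adjunction space \<open>X \<union>\<^sub>h M\<close>, for \<open>A \<subseteq> M\<close> and \<open>h : A \<rightarrow> X\<close>: its points are those of \<open>X\<close>
  and of \<open>M - A\<close>, with the quotient topology from the disjoint union of \<open>X\<close> and \<open>M\<close>.\<close>

definition adj_map :: "'m set \<Rightarrow> ('m \<Rightarrow> 'x) \<Rightarrow> 'm \<Rightarrow> 'x + 'm" where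
  "adj_map A h m = (if m \<in> A then Inl (h m) else Inr m)"

definition adjunction_space ::
  "'x topology \<Rightarrow> 'm topology \<Rightarrow> 'm set \<Rightarrow> ('m \<Rightarrow> 'x) \<Rightarrow> ('x + 'm) topology" where
  "adjunction_space X M A h =
     topology (\<lambda>U. U \<subseteq> Inl ` topspace X \<union> Inr ` (topspace M - A) \<and>
       openin X {x \<in> topspace X. Inl x \<in> U} \<and> openin M {m \<in> topspace M. adj_map A h m \<in> U})"

text \<open>\<open>P\<close>, with \<open>jX : X \<rightarrow> P\<close> and \<open>jM : M \<rightarrow> P\<close>, is the push-out of \<open>X \<leftarrow> A \<rightarrow> M\<close>.\<close>

definition is_pushout ::
  "'x topology \<Rightarrow> 'm topology \<Rightarrow> 'm set \<Rightarrow> ('m \<Rightarrow> 'x) \<Rightarrow> 'p topology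
     \<Rightarrow> ('x \<Rightarrow> 'p) \<Rightarrow> ('m \<Rightarrow> 'p) \<Rightarrow> bool" where
  "is_pushout X M A h P jX jM \<longleftrightarrow>
     (\<forall>m\<in>topspace M \<inter> A. jX (h m) = jM m) \<and>
     homeomorphic_map (adjunction_space X M A h) P (case_sum jX jM)"

text \<open>The same for families: \<open>A\<close> is a subset of the base of \<open>M\<close>, and \<open>(h, hb)\<close> is an
  \<open>\<FF>\<close>-map from the restriction of \<open>M\<close> to \<open>A\<close> into \<open>X\<close>.\<close>

definition adjunction_family ::
  "('x, 'b, 'o, 'v) family \<Rightarrow> ('e, 'm, 'o, 'v) family \<Rightarrow> 'm set \<Rightarrow> ('e \<Rightarrow> 'x) \<Rightarrow> ('m \<Rightarrow> 'b)
     \<Rightarrow> ('x + 'e, 'b + 'm, 'o, 'v) family" where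
  "adjunction_family X M A h hb =
     \<lparr> total_sp = adjunction_space (total_sp X) (total_sp M)
                    {e \<in> topspace (total_sp M). prj M e \<in> A} h,
       base_sp = adjunction_space (base_sp X) (base_sp M) A hb,
       prj = map_sum (prj X) (prj M),
       fib_ob = case_sum (fib_ob X) (fib_ob M),
       chart = case_sum (\<lambda>b z. chart X b (projl z)) (\<lambda>m z. chart M m (projr z)) \<rparr>"

definition is_pushout_family ::
  "('o, 'r, 'v) strcat \<Rightarrow> ('x, 'b, 'o, 'v) family \<Rightarrow> ('e, 'm, 'o, 'v) family \<Rightarrow> 'm set
     \<Rightarrow> ('e \<Rightarrow> 'x) \<Rightarrow> ('m \<Rightarrow> 'b) \<Rightarrow> ('p, 'c, 'o, 'v) family
     \<Rightarrow> ('x \<Rightarrow> 'p) \<Rightarrow> ('b \<Rightarrow> 'c) \<Rightarrow> ('e \<Rightarrow> 'p) \<Rightarrow> ('m \<Rightarrow> 'c) \<Rightarrow> bool" where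
  "is_pushout_family \<FF> X M A h hb P jX jXb jM jMb \<longleftrightarrow>
     (\<forall>e\<in>topspace (total_sp M). prj M e \<in> A \<longrightarrow> jX (h e) = jM e) \<and>
     (\<forall>m\<in>topspace (base_sp M) \<inter> A. jXb (hb m) = jMb m) \<and>
     F_iso \<FF> (adjunction_family X M A h hb) P (case_sum jX jM) (case_sum jXb jMb)"

text \<open>\<open>X\<close> is the colimit of the increasing sequence of its subspaces \<open>S n\<close>.\<close>

definition is_filtered_colimit :: "'a topology \<Rightarrow> (nat \<Rightarrow> 'a set) \<Rightarrow> bool" where
  "is_filtered_colimit X S \<longleftrightarrow>
     (\<forall>n. S n \<subseteq> S (Suc n)) \<and> (\<Union>n. S n) = topspace X \<and>
     (\<forall>U\<subseteq>topspace X. (\<forall>n. openin (subtopology X (S n)) (U \<inter> S n)) \<longrightarrow> openin X U)"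

section \<open>CW-complexes\<close>

definition disc :: "nat \<Rightarrow> (nat \<Rightarrow> real) topology" where
  "disc n = subtopology (Euclidean_space n) {x. (\<Sum>i<n. (x i)\<^sup>2) \<le> 1}"

definition open_disc :: "nat \<Rightarrow> (nat \<Rightarrow> real) set" where
  "open_disc n = {x \<in> topspace (disc n). (\<Sum>i<n. (x i)\<^sup>2) < 1}"

definition disc_boundary :: "nat \<Rightarrow> (nat \<Rightarrow> real) set" where
  "disc_boundary n = {x \<in> topspace (disc n). (\<Sum>i<n. (x i)\<^sup>2) = 1}"

text \<open>Whitehead's definition: a Hausdorff space partitioned into open cells \<open>e\<close> of dimension
  \<open>d e\<close> with characteristic maps \<open>\<Phi> e\<close>, closure-finite and with the weak topology.\<close>

definition CW_structure ::
  "'a topology \<Rightarrow> 'a set set \<Rightarrow> ('a set \<Rightarrow> nat) \<Rightarrow> ('a set \<Rightarrow> (nat \<Rightarrow> real) \<Rightarrow> 'a) \<Rightarrow> bool" where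
  "CW_structure X E d \<Phi> \<longleftrightarrow>
     Hausdorff_space X \<and> pairwise disjnt E \<and> \<Union>E = topspace X \<and>
     (\<forall>e\<in>E. continuous_map (disc (d e)) X (\<Phi> e) \<and>
        homeomorphic_map (subtopology (disc (d e)) (open_disc (d e))) (subtopology X e) (\<Phi> e) \<and>
        (\<exists>E'. finite E' \<and> E' \<subseteq> {e'\<in>E. d e' < d e} \<and> \<Phi> e ` disc_boundary (d e) \<subseteq> \<Union>E')) \<and>
     (\<forall>C\<subseteq>topspace X. (\<forall>e\<in>E. closedin X (C \<inter> X closure_of e)) \<longrightarrow> closedin X C)"

definition subcomplex :: "'a topology \<Rightarrow> 'a set set \<Rightarrow> 'a set \<Rightarrow> bool" where
  "subcomplex X E A \<longleftrightarrow> (\<exists>E'\<subseteq>E. A = \<Union>E' \<and> (\<forall>e\<in>E'. X closure_of e \<subseteq> A))"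

definition CW_space :: "'a topology \<Rightarrow> bool" where
  "CW_space X \<longleftrightarrow> (\<exists>E d \<Phi>. CW_structure X E d \<Phi>)"

definition CW_pair :: "'a topology \<Rightarrow> 'a set \<Rightarrow> bool" where
  "CW_pair X A \<longleftrightarrow> (\<exists>E d \<Phi>. CW_structure X E d \<Phi> \<and> subcomplex X E A)"

definition locally_finite_countable_CW_space :: "'a topology \<Rightarrow> bool" where
  "locally_finite_countable_CW_space X \<longleftrightarrow>
     (\<exists>E d \<Phi>. CW_structure X E d \<Phi> \<and> countable E \<and> locally_finite_in X E)"

definition locally_finite_countable_CW_pair :: "'a topology \<Rightarrow> 'a set \<Rightarrow> bool" where
  "locally_finite_countable_CW_pair X A \<longleftrightarrow>
     (\<exists>E d \<Phi>. CW_structure X E d \<Phi> \<and> subcomplex X E A \<and> countable E \<and> locally_finite_in X E)"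

definition skeleton :: "'a set set \<Rightarrow> ('a set \<Rightarrow> nat) \<Rightarrow> nat \<Rightarrow> 'a set" where
  "skeleton E d n = \<Union>{e\<in>E. d e \<le> n}"

section \<open>Stratified spaces\<close>

text \<open>The filtration is given by subspaces \<open>str_fil X i\<close> of \<open>str_sp X\<close>. For \<open>i \<ge> 1\<close>,
  \<open>(att_sp X i, att_sub X i)\<close> is the attached pair, \<open>att_map X i\<close> the attaching map, and
  \<open>chr_map X i\<close> the structure map of the push-out from the attached space to the \<open>i\<close>-th
  filtration step. The values of these four fields at \<open>0\<close> are irrelevant.\<close>

record ('a, 'm) stratified =
  str_sp :: "'a topology"
  str_fil :: "nat \<Rightarrow> 'a set"
  att_sp :: "nat \<Rightarrow> 'm topology"
  att_sub :: "nat \<Rightarrow> 'm set"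
  att_map :: "nat \<Rightarrow> 'm \<Rightarrow> 'a"
  chr_map :: "nat \<Rightarrow> 'm \<Rightarrow> 'a"

abbreviation step_sp :: "('a, 'm) stratified \<Rightarrow> nat \<Rightarrow> 'a topology" where
  "step_sp X i \<equiv> subtopology (str_sp X) (str_fil X i)"

definition finite_strata :: "('a, 'm) stratified \<Rightarrow> bool" where
  "finite_strata X \<longleftrightarrow> finite {i. str_fil X (Suc i) - str_fil X i \<noteq> {}}"

text \<open>Cellularity refers to cell structures on the attached spaces; the \<open>n\<close>-skeleton of the
  \<open>i\<close>-th step then consists of the images of the \<open>n\<close>-skeleta of the spaces attached so far.\<close>

definition cellular_attaching :: "('a, 'm) stratified \<Rightarrow> bool" where
  "cellular_attaching X \<longleftrightarrow>
     (\<exists>E0 d0 \<Phi>0 E d \<Phi>. CW_structure (step_sp X 0) E0 d0 \<Phi>0 \<and>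
        (\<forall>i\<ge>1. CW_structure (att_sp X i) (E i) (d i) (\<Phi> i) \<and>
           subcomplex (att_sp X i) (E i) (att_sub X i)) \<and>
        (\<forall>i n. att_map X (Suc i) ` (att_sub X (Suc i) \<inter> skeleton (E (Suc i)) (d (Suc i)) n)
           \<subseteq> skeleton E0 d0 n \<union> (\<Union>j\<in>{1..i}. chr_map X j ` skeleton (E j) (d j) n)))"

definition stratified_space :: "('a, 'm) stratified \<Rightarrow> bool" where
  "stratified_space X \<longleftrightarrow>
     is_filtered_colimit (str_sp X) (str_fil X) \<and>
     CW_space (step_sp X 0) \<and>
     (\<forall>i. CW_pair (att_sp X (Suc i)) (att_sub X (Suc i)) \<and>
        continuous_map (subtopology (att_sp X (Suc i)) (att_sub X (Suc i))) (step_sp X i)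
          (att_map X (Suc i)) \<and>
        is_pushout (step_sp X i) (att_sp X (Suc i)) (att_sub X (Suc i)) (att_map X (Suc i))
          (step_sp X (Suc i)) id (chr_map X (Suc i))) \<and>
     (finite_strata X \<or> cellular_attaching X)"

definition finite_stratified_space :: "('a, 'm) stratified \<Rightarrow> bool" where
  "finite_stratified_space X \<longleftrightarrow> stratified_space X \<and> finite_strata X"

definition attached_spaces_locally_finite_countable :: "('a, 'm) stratified \<Rightarrow> bool" where
  "attached_spaces_locally_finite_countable X \<longleftrightarrow>
     locally_finite_countable_CW_space (step_sp X 0) \<and>
     (\<forall>i\<ge>1. locally_finite_countable_CW_pair (att_sp X i) (att_sub X i))"

definition stratified_map ::
  "('a, 'm) stratified \<Rightarrow> ('b, 'n) stratified \<Rightarrow> ('a \<Rightarrow> 'b) \<Rightarrow> (nat \<Rightarrow> 'm \<Rightarrow> 'n) \<Rightarrow> bool" where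
  "stratified_map X X' f g \<longleftrightarrow>
     continuous_map (str_sp X) (str_sp X') f \<and>
     (\<forall>i. f ` str_fil X i \<subseteq> str_fil X' i) \<and>
     (\<forall>i\<ge>1. continuous_map (att_sp X i) (att_sp X' i) (g i) \<and>
        g i ` att_sub X i \<subseteq> att_sub X' i \<and>
        (\<forall>m\<in>att_sub X i. f (att_map X i m) = att_map X' i (g i m)) \<and>
        (\<forall>m\<in>topspace (att_sp X i). f (chr_map X i m) = chr_map X' i (g i m)))"

definition stratum_preserving ::
  "('a, 'm) stratified \<Rightarrow> ('b, 'n) stratified \<Rightarrow> ('a \<Rightarrow> 'b) \<Rightarrow> bool" where
  "stratum_preserving X X' f \<longleftrightarrow>
     (\<forall>i. f ` (str_fil X (Suc i) - str_fil X i) \<subseteq> str_fil X' (Suc i) - str_fil X' i)"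

section \<open>Stratified fibre bundles\<close>

text \<open>The total spaces of the bundles \<open>M\<close> over the attached spaces are taken on the type
  \<open>'m \<times> 'v\<close>. By \<open>family_iso_on_product_type\<close> below every family over a base of type \<open>'m\<close> is
  isomorphic, over the identity, to one on that type, so this is no restriction.\<close>

definition stratified_fibre_bundle ::
  "('o, 'r, 'v) strcat \<Rightarrow> ('b, 'm) stratified \<Rightarrow> ('x, 'b, 'o, 'v) family \<Rightarrow> bool" where
  "stratified_fibre_bundle \<FF> B X \<longleftrightarrow>
     stratified_space B \<and> is_family \<FF> X \<and> base_sp X = str_sp B \<and>
     F_bundle \<FF> (restrict_family X (str_fil B 0)) \<and>
     (\<forall>i. \<exists>(M :: ('m \<times> 'v, 'm, 'o, 'v) family) h k.
        F_bundle \<FF> M \<and> base_sp M = att_sp B (Suc i) \<and>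
        F_map \<FF> (restrict_family M (att_sub B (Suc i))) (restrict_family X (str_fil B i))
          h (att_map B (Suc i)) \<and>
        is_pushout_family \<FF> (restrict_family X (str_fil B i)) M (att_sub B (Suc i))
          h (att_map B (Suc i))
          (restrict_family X (str_fil B (Suc i))) id id k (chr_map B (Suc i))) \<and>
     is_filtered_colimit (total_sp X) (\<lambda>i. {x \<in> topspace (total_sp X). prj X x \<in> str_fil B i})"

section \<open>Adequacy of the encodings\<close>

lemma istopology_adjunction_space:
  "istopology (\<lambda>U. U \<subseteq> Inl ` topspace X \<union> Inr ` (topspace M - A) \<and>
       openin X {x \<in> topspace X. Inl x \<in> U} \<and> openin M {m \<in> topspace M. adj_map A h m \<in> U})"
  (is "istopology ?P")
  unfolding istopology_def
proof (intro conjI allI impI)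
  fix S T assume S: "?P S" and T: "?P T"
  have 1: "{x \<in> topspace X. Inl x \<in> S \<inter> T}
      = {x \<in> topspace X. Inl x \<in> S} \<inter> {x \<in> topspace X. Inl x \<in> T}" by blast
  have 2: "{m \<in> topspace M. adj_map A h m \<in> S \<inter> T}
      = {m \<in> topspace M. adj_map A h m \<in> S} \<inter> {m \<in> topspace M. adj_map A h m \<in> T}" by blast
  show "S \<inter> T \<subseteq> Inl ` topspace X \<union> Inr ` (topspace M - A)" using S by blast
  show "openin X {x \<in> topspace X. Inl x \<in> S \<inter> T}"
    unfolding 1 using S T by (intro openin_Int) auto
  show "openin M {m \<in> topspace M. adj_map A h m \<in> S \<inter> T}"
    unfolding 2 using S T by (intro openin_Int) auto
next
  fix \<K> assume K: "\<forall>K\<in>\<K>. ?P K"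
  have 1: "{x \<in> topspace X. Inl x \<in> \<Union>\<K>} = (\<Union>K\<in>\<K>. {x \<in> topspace X. Inl x \<in> K})" by blast
  have 2: "{m \<in> topspace M. adj_map A h m \<in> \<Union>\<K>}
      = (\<Union>K\<in>\<K>. {m \<in> topspace M. adj_map A h m \<in> K})" by blast
  show "\<Union>\<K> \<subseteq> Inl ` topspace X \<union> Inr ` (topspace M - A)" using K by blast
  show "openin X {x \<in> topspace X. Inl x \<in> \<Union>\<K>}"
    unfolding 1 using K by (intro openin_Union) auto
  show "openin M {m \<in> topspace M. adj_map A h m \<in> \<Union>\<K>}"
    unfolding 2 using K by (intro openin_Union) auto
qed

lemma openin_adjunction_space:
  "openin (adjunction_space X M A h) U \<longleftrightarrow>
     U \<subseteq> Inl ` topspace X \<union> Inr ` (topspace M - A) \<and>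
     openin X {x \<in> topspace X. Inl x \<in> U} \<and> openin M {m \<in> topspace M. adj_map A h m \<in> U}"
  unfolding adjunction_space_def topology_inverse'[OF istopology_adjunction_space] ..

lemma topspace_adjunction_space:
  assumes "h ` (topspace M \<inter> A) \<subseteq> topspace X"
  shows "topspace (adjunction_space X M A h) = Inl ` topspace X \<union> Inr ` (topspace M - A)"
proof -
  let ?T = "Inl ` topspace X \<union> Inr ` (topspace M - A)"
  have "{x \<in> topspace X. Inl x \<in> ?T} = topspace X" by blast
  moreover have "{m \<in> topspace M. adj_map A h m \<in> ?T} = topspace M"
    using assms by (auto simp: adj_map_def)
  ultimately have "openin (adjunction_space X M A h) ?T"
    unfolding openin_adjunction_space by simp
  then have "?T \<subseteq> topspace (adjunction_space X M A h)" by (rule openin_subset)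
  moreover have "topspace (adjunction_space X M A h) \<subseteq> ?T"
    using openin_topspace[of "adjunction_space X M A h"]
    by (rule openin_adjunction_space[THEN iffD1, THEN conjunct1])
  ultimately show ?thesis by (rule subset_antisym[rotated])
qed

text \<open>The adjunction space has the universal property of the push-out in spaces.\<close>

lemma adjunction_space_universal:
  assumes h: "h ` (topspace M \<inter> A) \<subseteq> topspace X"
    and f: "continuous_map X Z f" and g: "continuous_map M Z g"
    and fg: "\<forall>m\<in>topspace M \<inter> A. f (h m) = g m"
  shows "continuous_map (adjunction_space X M A h) Z (case_sum f g)"
  unfolding continuous_map_def
proof (intro conjI allI impI)
  show "case_sum f g \<in> topspace (adjunction_space X M A h) \<rightarrow> topspace Z"
    using f g unfolding topspace_adjunction_space[OF h]
    by (auto simp: continuous_map_def Pi_iff)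
  fix U assume U: "openin Z U"
  let ?P = "{z \<in> topspace (adjunction_space X M A h). case_sum f g z \<in> U}"
  have "{x \<in> topspace X. Inl x \<in> ?P} = {x \<in> topspace X. f x \<in> U}"
    unfolding topspace_adjunction_space[OF h] by auto
  moreover have "{m \<in> topspace M. adj_map A h m \<in> ?P} = {m \<in> topspace M. g m \<in> U}"
    unfolding topspace_adjunction_space[OF h] using h fg
    by (auto simp: adj_map_def split: if_splits)
  moreover have "?P \<subseteq> Inl ` topspace X \<union> Inr ` (topspace M - A)"
    unfolding topspace_adjunction_space[OF h] by auto
  ultimately show "openin (adjunction_space X M A h) ?P"
    unfolding openin_adjunction_space
    using f g U by (simp add: openin_continuous_map_preimage)
qed

lemma identity_morphism:
  assumes C: "structure_category \<FF>" and X: "is_family \<FF> X" and b: "b \<in> topspace (base_sp X)"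
  obtains \<phi> where "\<phi> \<in> Ar \<FF>" "Dom \<FF> \<phi> = fib_ob X b" "Cod \<FF> \<phi> = fib_ob X b"
    "\<And>v. v \<in> topspace (FOb \<FF> (fib_ob X b)) \<Longrightarrow> FMap \<FF> \<phi> v = v"
proof -
  have V: "fib_ob X b \<in> Ob \<FF>" using X b by (simp add: is_family_def)
  have "Idt \<FF> (fib_ob X b) \<in> Ar \<FF>" "Dom \<FF> (Idt \<FF> (fib_ob X b)) = fib_ob X b"
    "Cod \<FF> (Idt \<FF> (fib_ob X b)) = fib_ob X b"
    using C V unfolding structure_category_def small_category_def by blast+
  moreover have "FMap \<FF> (Idt \<FF> (fib_ob X b)) v = v" if "v \<in> topspace (FOb \<FF> (fib_ob X b))" for v
    using C V that unfolding structure_category_def functor_to_spaces_def by blast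
  ultimately show ?thesis by (rule that)
qed

lemma prj_in_base:
  assumes "is_family \<FF> X" "x \<in> topspace (total_sp X)"
  shows "prj X x \<in> topspace (base_sp X)"
proof -
  have "prj X ` topspace (total_sp X) \<subseteq> topspace (base_sp X)"
    using assms(1) continuous_map_image_subset_topspace unfolding is_family_def by blast
  then show ?thesis using assms(2) by blast
qed

lemma chart_in_fibre_space:
  assumes "is_family \<FF> X" "x \<in> topspace (total_sp X)"
  shows "chart X (prj X x) x \<in> topspace (FOb \<FF> (fib_ob X (prj X x)))"
proof -
  have "homeomorphic_map (subtopology (total_sp X) (fibre X (prj X x)))
      (FOb \<FF> (fib_ob X (prj X x))) (chart X (prj X x))"
    using assms(1) prj_in_base[OF assms] unfolding is_family_def by blast
  then have "chart X (prj X x) ` (topspace (total_sp X) \<inter> fibre X (prj X x))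
      = topspace (FOb \<FF> (fib_ob X (prj X x)))"
    by (metis homeomorphic_imp_surjective_map topspace_subtopology)
  moreover have "x \<in> topspace (total_sp X) \<inter> fibre X (prj X x)"
    using assms(2) by (simp add: fibre_def)
  ultimately show ?thesis by blast
qed

lemma restrict_family_iso_pullback:
  assumes C: "structure_category \<FF>" and X: "is_family \<FF> X"
  shows "F_iso \<FF> (restrict_family X U) (pullback (subtopology (base_sp X) U) id X)
           (\<lambda>x. (prj X x, x)) id"
proof -
  let ?R = "restrict_family X U" and ?P = "pullback (subtopology (base_sp X) U) id X"
  have p: "continuous_map (total_sp X) (base_sp X) (prj X)"
    using X by (simp add: is_family_def)
  have c1: "continuous_map (total_sp ?R) (total_sp ?P) (\<lambda>x. (prj X x, x))"
    using p by (auto simp: restrict_family_def pullback_def continuous_map_in_subtopology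
        continuous_map_pairwise o_def continuous_map_from_subtopology)
  have c2: "continuous_map (total_sp ?P) (total_sp ?R) snd"
    by (auto simp: restrict_family_def pullback_def continuous_map_in_subtopology
        continuous_map_from_subtopology continuous_map_snd)
  have f1: "F_map \<FF> ?R ?P (\<lambda>x. (prj X x, x)) id"
    unfolding F_map_def
  proof (intro conjI ballI c1)
    show "continuous_map (base_sp ?R) (base_sp ?P) id"
      by (simp add: restrict_family_def pullback_def)
    show "prj ?P (prj X x, x) = id (prj ?R x)" for x
      by (simp add: restrict_family_def pullback_def)
    fix b assume "b \<in> topspace (base_sp ?R)"
    then have "b \<in> topspace (base_sp X)" by (simp add: restrict_family_def)
    then obtain \<phi> where \<phi>: "\<phi> \<in> Ar \<FF>" "Dom \<FF> \<phi> = fib_ob X b" "Cod \<FF> \<phi> = fib_ob X b"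
      "\<And>v. v \<in> topspace (FOb \<FF> (fib_ob X b)) \<Longrightarrow> FMap \<FF> \<phi> v = v"
      using identity_morphism[OF C X] by blast
    have "chart X b x = FMap \<FF> \<phi> (chart X b x)" if "x \<in> fibre ?R b" for x
      using that chart_in_fibre_space[OF X, of x] \<phi>(4)
      by (auto simp: restrict_family_def fibre_def)
    then show "\<exists>\<phi>\<in>Ar \<FF>. Dom \<FF> \<phi> = fib_ob ?R b \<and> Cod \<FF> \<phi> = fib_ob ?P (id b) \<and>
        (\<forall>x\<in>fibre ?R b. chart ?P (id b) (prj X x, x) = FMap \<FF> \<phi> (chart ?R b x))"
      using \<phi>(1-3) by (intro bexI[of _ \<phi>]) (simp_all add: restrict_family_def pullback_def)
  qed
  have f2: "F_map \<FF> ?P ?R snd id"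
    unfolding F_map_def
  proof (intro conjI ballI c2)
    show "continuous_map (base_sp ?P) (base_sp ?R) id"
      by (simp add: restrict_family_def pullback_def)
    show "prj ?R (snd x) = id (prj ?P x)" if "x \<in> topspace (total_sp ?P)" for x
      using that by (auto simp: restrict_family_def pullback_def)
    fix b assume "b \<in> topspace (base_sp ?P)"
    then have "b \<in> topspace (base_sp X)" by (simp add: pullback_def)
    then obtain \<phi> where \<phi>: "\<phi> \<in> Ar \<FF>" "Dom \<FF> \<phi> = fib_ob X b" "Cod \<FF> \<phi> = fib_ob X b"
      "\<And>v. v \<in> topspace (FOb \<FF> (fib_ob X b)) \<Longrightarrow> FMap \<FF> \<phi> v = v"
      using identity_morphism[OF C X] by blast
    have "chart X b (snd x) = FMap \<FF> \<phi> (chart X b (snd x))" if "x \<in> fibre ?P b" for x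
      using that chart_in_fibre_space[OF X, of "snd x"] \<phi>(4)
      by (auto simp: pullback_def fibre_def)
    then show "\<exists>\<phi>\<in>Ar \<FF>. Dom \<FF> \<phi> = fib_ob ?P b \<and> Cod \<FF> \<phi> = fib_ob ?R (id b) \<and>
        (\<forall>x\<in>fibre ?P b. chart ?R (id b) (snd x) = FMap \<FF> \<phi> (chart ?P b x))"
      using \<phi>(1-3) by (intro bexI[of _ \<phi>]) (auto simp: restrict_family_def pullback_def)
  qed
  show ?thesis
    unfolding F_iso_def
    by (intro conjI f1 exI[of _ snd] exI[of _ id] f2)
       (auto simp: restrict_family_def pullback_def)
qed

lemma family_iso_on_product_type:
  fixes X :: "('x, 'b, 'o, 'v) family"
  assumes C: "structure_category \<FF>" and X: "is_family \<FF> X"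
  obtains Y :: "('b \<times> 'v, 'b, 'o, 'v) family" and f
  where "is_family \<FF> Y" "base_sp Y = base_sp X" "F_iso \<FF> X Y f id"
proof -
  let ?T = "total_sp X"
  define f where "f x = (prj X x, chart X (prj X x) x)" for x
  have p: "continuous_map ?T (base_sp X) (prj X)"
    using X by (simp add: is_family_def)
  note pb = prj_in_base[OF X]
  have hom: "homeomorphic_map (subtopology ?T (fibre X b)) (FOb \<FF> (fib_ob X b)) (chart X b)"
    if "b \<in> topspace (base_sp X)" for b
    using X that by (simp add: is_family_def)
  have inj: "inj_on f (topspace ?T)"
  proof (rule inj_onI)
    fix x y assume xy: "x \<in> topspace ?T" "y \<in> topspace ?T" "f x = f y"
    then have "prj X x = prj X y" "chart X (prj X x) x = chart X (prj X x) y"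
      by (auto simp: f_def)
    moreover have "inj_on (chart X (prj X x)) (topspace ?T \<inter> fibre X (prj X x))"
      using hom[OF pb[OF xy(1)]] by (simp add: homeomorphic_map_def)
    ultimately show "x = y" using xy by (auto simp: fibre_def inj_on_def)
  qed
  define g where "g = inv_into (topspace ?T) f"
  have gf: "g (f x) = x" if "x \<in> topspace ?T" for x
    using inj that by (simp add: g_def)
  define S where "S = f ` topspace ?T"
  have fg: "f (g z) = z" "g z \<in> topspace ?T" if "z \<in> S" for z
    using that gf by (auto simp: S_def)
  define T where "T = pullback_topology S g ?T"
  have tT: "topspace T = S"
    unfolding T_def topspace_pullback_topology using fg by auto
  have cg: "continuous_map T ?T g"
    using continuous_map_pullback[OF continuous_map_id, of S g ?T] by (simp add: T_def)
  have cf: "continuous_map ?T T f"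
    unfolding T_def
  proof (rule continuous_map_pullback')
    show "continuous_map ?T ?T (g \<circ> f)"
      by (rule continuous_map_eq[OF continuous_map_id]) (simp add: gf)
    show "topspace ?T \<subseteq> f -` S" by (auto simp: S_def)
  qed
  define Y :: "('b \<times> 'v, 'b, 'o, 'v) family" where
    "Y = \<lparr> total_sp = T, base_sp = base_sp X, prj = fst, fib_ob = fib_ob X, chart = (\<lambda>b. snd) \<rparr>"
  have pg: "prj X (g z) = fst z" if "z \<in> S" for z
    using fg[OF that] by (metis f_def fst_conv)
  have homf: "homeomorphic_maps ?T T f g"
    using cf cg gf fg tT by (auto simp: homeomorphic_maps_def)
  have famY: "is_family \<FF> Y"
    unfolding is_family_def
  proof (intro conjI ballI)
    have "continuous_map T (base_sp X) (prj X \<circ> g)"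
      using cg p by (rule continuous_map_compose)
    then have "continuous_map T (base_sp X) fst"
      by (rule continuous_map_eq) (simp add: tT pg)
    then show "continuous_map (total_sp Y) (base_sp Y) (prj Y)" by (simp add: Y_def)
    fix b assume b: "b \<in> topspace (base_sp Y)"
    then have b': "b \<in> topspace (base_sp X)" by (simp add: Y_def)
    then show "fib_ob Y b \<in> Ob \<FF>" using X by (simp add: is_family_def Y_def)
    have "homeomorphic_map T ?T g"
      using homf homeomorphic_map_maps homeomorphic_maps_sym by blast
    moreover have "g ` (topspace T \<inter> fibre Y b) = topspace ?T \<inter> fibre X b"
    proof (intro equalityI subsetI)
      fix x assume "x \<in> g ` (topspace T \<inter> fibre Y b)"
      then show "x \<in> topspace ?T \<inter> fibre X b"
        using fg pg by (auto simp: fibre_def Y_def tT)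
    next
      fix x assume x: "x \<in> topspace ?T \<inter> fibre X b"
      then have "f x \<in> topspace T \<inter> fibre Y b"
        by (auto simp: fibre_def Y_def tT S_def f_def)
      then show "x \<in> g ` (topspace T \<inter> fibre Y b)" using gf x by (metis IntD1 imageI)
    qed
    ultimately have "homeomorphic_map (subtopology T (fibre Y b)) (subtopology ?T (fibre X b)) g"
      by (rule homeomorphic_map_subtopologies)
    then have "homeomorphic_map (subtopology T (fibre Y b)) (FOb \<FF> (fib_ob X b)) (chart X b \<circ> g)"
      using hom[OF b'] by (rule homeomorphic_map_compose)
    moreover have "(chart X b \<circ> g) z = snd z" if "z \<in> topspace (subtopology T (fibre Y b))" for z
    proof -
      from that have z: "z \<in> S" "fst z = b" by (auto simp: tT fibre_def Y_def)
      then show ?thesis using fg(1)[OF z(1)] pg[OF z(1)] by (metis comp_apply f_def snd_conv)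
    qed
    ultimately have "homeomorphic_map (subtopology T (fibre Y b)) (FOb \<FF> (fib_ob X b)) snd"
      by (rule homeomorphic_map_eq)
    then show "homeomorphic_map (subtopology (total_sp Y) (fibre Y b))
        (FOb \<FF> (fib_ob Y b)) (chart Y b)"
      by (metis Y_def family.select_convs(1,4,5))
  qed
  have f1: "F_map \<FF> X Y f id"
    unfolding F_map_def
  proof (intro conjI ballI)
    show "continuous_map (total_sp X) (total_sp Y) f" using cf by (simp add: Y_def)
    show "continuous_map (base_sp X) (base_sp Y) id" by (simp add: Y_def)
    show "prj Y (f x) = id (prj X x)" for x by (simp add: Y_def f_def)
    fix b assume "b \<in> topspace (base_sp X)"
    then obtain \<phi> where \<phi>: "\<phi> \<in> Ar \<FF>" "Dom \<FF> \<phi> = fib_ob X b" "Cod \<FF> \<phi> = fib_ob X b"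
      "\<And>v. v \<in> topspace (FOb \<FF> (fib_ob X b)) \<Longrightarrow> FMap \<FF> \<phi> v = v"
      using identity_morphism[OF C X] by blast
    have "snd (f x) = FMap \<FF> \<phi> (chart X b x)" if "x \<in> fibre X b" for x
      using that chart_in_fibre_space[OF X, of x] \<phi>(4) by (auto simp: fibre_def f_def)
    then show "\<exists>\<phi>\<in>Ar \<FF>. Dom \<FF> \<phi> = fib_ob X b \<and> Cod \<FF> \<phi> = fib_ob Y (id b) \<and>
        (\<forall>x\<in>fibre X b. chart Y (id b) (f x) = FMap \<FF> \<phi> (chart X b x))"
      using \<phi>(1-3) by (intro bexI[of _ \<phi>]) (simp_all add: Y_def)
  qed
  have f2: "F_map \<FF> Y X g id"
    unfolding F_map_def
  proof (intro conjI ballI)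
    show "continuous_map (total_sp Y) (total_sp X) g" using cg by (simp add: Y_def)
    show "continuous_map (base_sp Y) (base_sp X) id" by (simp add: Y_def)
    show "prj X (g x) = id (prj Y x)" if "x \<in> topspace (total_sp Y)" for x
      using that pg by (simp add: Y_def tT)
    fix b assume b: "b \<in> topspace (base_sp Y)"
    then have "b \<in> topspace (base_sp X)" by (simp add: Y_def)
    then obtain \<phi> where \<phi>: "\<phi> \<in> Ar \<FF>" "Dom \<FF> \<phi> = fib_ob X b" "Cod \<FF> \<phi> = fib_ob X b"
      "\<And>v. v \<in> topspace (FOb \<FF> (fib_ob X b)) \<Longrightarrow> FMap \<FF> \<phi> v = v"
      using identity_morphism[OF C X] by blast
    have "chart X b (g z) = FMap \<FF> \<phi> (snd z)" if "z \<in> fibre Y b" for z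
    proof -
      from that have z: "z \<in> S" "fst z = b" by (auto simp: tT fibre_def Y_def)
      then have "chart X b (g z) = snd z"
        using fg(1)[OF z(1)] pg[OF z(1)] by (metis f_def snd_conv)
      moreover have "chart X b (g z) \<in> topspace (FOb \<FF> (fib_ob X b))"
        using chart_in_fibre_space[OF X fg(2)[OF z(1)]] pg[OF z(1)] z by simp
      ultimately show ?thesis using \<phi>(4) by metis
    qed
    then show "\<exists>\<phi>\<in>Ar \<FF>. Dom \<FF> \<phi> = fib_ob Y b \<and> Cod \<FF> \<phi> = fib_ob X (id b) \<and>
        (\<forall>x\<in>fibre Y b. chart X (id b) (g x) = FMap \<FF> \<phi> (chart Y b x))"
      using \<phi>(1-3) by (intro bexI[of _ \<phi>]) (simp_all add: Y_def)
  qed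
  have "F_iso \<FF> X Y f id"
    unfolding F_iso_def
    by (intro conjI f1 exI[of _ g] exI[of _ id] f2) (auto simp: gf fg Y_def tT)
  with famY show ?thesis by (intro that[of Y f]) (simp_all add: Y_def)
qed

end

theory Submission
  imports Defs
begin

text \<open>The bundle over the \<open>i\<close>-th attached space is the pull-back of the given one, and
  what has to be shown is that the adjunction space of total spaces carries the topology of the
  pull-back, a subspace of a product. Locally finite countable CW-complexes, and bundles over them,
  are locally compact, Lindelof and Hausdorff; finitely many adjunctions turn them into normal
  spaces that carry the weak topology of an increasing sequence of compact sets. For Hausdorff
  spaces of this kind closedness in a product can be tested on boxes of such compact sets, and
  there it follows from compactness, since stratum preservation makes the pulled back push-out
  map bijective.\<close>

section \<open>Spaces with a countable exhaustion by compact sets\<close>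

text \<open>The obstacle is that products do not commute with quotient maps among all spaces, so
  pulling back need not preserve a push-out. Hausdorff k-omega spaces are the substitute, since they
  survive adjunction and products of two factors; countability is what lets a neighbourhood be grown
  box by box along a sequence. Stratum preservation enters through two facts: \<open>g\<close> pulls
  \<open>A'\<close> back to exactly \<open>A\<close>, and a point of the pull-back over the new
  stratum has its second coordinate in the new part of the total space, hence comes from the
  attached bundle. An isomorphism of families also needs morphisms of the category for the inverse
  map, which is not given by a formula on an adjunction; they are carried along as
  \<open>fibre_coarrow\<close>. Finiteness of \<open>B\<close> serves the last clause: the
  filtration stabilises, so the colimit condition can be read off at one step.\<close>

definition k_omega :: "'a topology \<Rightarrow> (nat \<Rightarrow> 'a set) \<Rightarrow> bool" where
  "k_omega X K \<longleftrightarrow>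
     (\<forall>n. compactin X (K n)) \<and> (\<forall>n. K n \<subseteq> K (Suc n)) \<and> (\<Union>n. K n) = topspace X \<and>
     (\<forall>C\<subseteq>topspace X. (\<forall>n. closedin X (C \<inter> K n)) \<longrightarrow> closedin X C)"

lemma k_omegaD:
  assumes "k_omega X K"
  shows "compactin X (K n)" "K n \<subseteq> topspace X" "mono K" "(\<Union>n. K n) = topspace X"
    "C \<subseteq> topspace X \<Longrightarrow> (\<And>n. closedin X (C \<inter> K n)) \<Longrightarrow> closedin X C"
  using assms unfolding k_omega_def by (auto simp: mono_iff_le_Suc)

text \<open>Lindelof selects countably many open sets with compact hulls \<open>N U\<close>, and
  \<open>K n\<close> unites the first hulls of an enumeration. Each \<open>?e j - C\<close> is open
  because it sees \<open>C\<close> only inside the hull of \<open>?e j\<close>, and these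
  differences fill the complement of \<open>C\<close>.\<close>

lemma locally_compact_Lindelof_imp_k_omega:
  assumes H: "Hausdorff_space X" and lc: "locally_compact_space X" and L: "Lindelof_space X"
  obtains K where "k_omega X K"
proof -
  let ?\<U> = "{U. openin X U \<and> (\<exists>K. compactin X K \<and> U \<subseteq> K)}"
  have U: "\<Union>?\<U> = topspace X"
  proof (intro equalityI subsetI)
    fix x assume "x \<in> \<Union>?\<U>"
    then show "x \<in> topspace X" using openin_subset by fastforce
  next
    fix x assume "x \<in> topspace X"
    then show "x \<in> \<Union>?\<U>"
      using lc unfolding locally_compact_space_def by blast
  qed
  have "\<exists>\<V>. countable \<V> \<and> \<V> \<subseteq> ?\<U> \<and> \<Union>\<V> = topspace X"
    by (rule Lindelof_spaceD[OF L _ U]) simp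
  then obtain \<V> where V: "countable \<V>" "\<V> \<subseteq> ?\<U>" "\<Union>\<V> = topspace X"
    by (elim exE conjE)
  \<comment> \<open>The empty set is added so that \<open>from_nat_into\<close> enumerates a
    non-empty family even when the space is empty.\<close>
  have "\<forall>U\<in>insert {} \<V>. \<exists>K. compactin X K \<and> U \<subseteq> K" using V(2) compactin_empty by blast
  then obtain N where N: "\<And>U. U \<in> insert {} \<V> \<Longrightarrow> compactin X (N U) \<and> U \<subseteq> N U"
    by metis
  let ?e = "from_nat_into (insert {} \<V>)"
  have e: "?e n \<in> insert {} \<V>" for n by (meson from_nat_into insert_not_empty)
  have re: "range ?e = insert {} \<V>" using V(1) by (simp add: range_from_nat_into)
  define K where "K n = (\<Union>j\<le>n. N (?e j))" for n
  have cN: "closedin X (N (?e j))" for j using N[OF e] H compactin_imp_closedin by blast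
  have "k_omega X K"
    unfolding k_omega_def
  proof (intro conjI allI impI)
    show "compactin X (K n)" for n
      unfolding K_def using N[OF e] by (intro compactin_Union) auto
    show "K n \<subseteq> K (Suc n)" for n unfolding K_def by (intro UN_mono) auto
    show "(\<Union>n. K n) = topspace X"
    proof (intro equalityI subsetI)
      fix x assume "x \<in> (\<Union>n. K n)"
      then show "x \<in> topspace X" unfolding K_def using N[OF e] compactin_subset_topspace by blast
    next
      fix x assume "x \<in> topspace X"
      then obtain j where "x \<in> ?e j" using V(3) re by (metis UN_iff Un_iff Union_insert sup_bot_left)
      then show "x \<in> (\<Union>n. K n)" unfolding K_def using N[OF e] by blast
    qed
    fix C assume C: "C \<subseteq> topspace X" "\<forall>n. closedin X (C \<inter> K n)"
    have "closedin X (C \<inter> N (?e j))" for j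
    proof -
      have "C \<inter> N (?e j) = (C \<inter> K j) \<inter> N (?e j)" unfolding K_def by blast
      then show ?thesis using C(2) cN by (metis closedin_Int)
    qed
    then have o: "openin X (?e j - C)" for j
    proof -
      have "?e j - C = ?e j - (C \<inter> N (?e j))" using N[OF e, of j] by blast
      moreover have "openin X (?e j)" using e[of j] V(2) by auto
      ultimately show ?thesis using \<open>\<And>j. closedin X (C \<inter> N (?e j))\<close> by (metis openin_diff)
    qed
    have "topspace X - C = (\<Union>j. ?e j - C)"
      using V(3) re by blast
    moreover have "openin X (\<Union>j. ?e j - C)" using o by blast
    ultimately show "closedin X C" using C(1) by (simp add: closedin_def)
  qed
  then show ?thesis by (rule that)
qed

text \<open>To separate a point from \<open>C\<close> one grows compact boxes missing \<open>C\<close> along the exhaustion;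
  each step is Wallace's theorem followed by shrinking in normal spaces.\<close>

lemma k_omega_prod_topology:
  assumes X: "k_omega X K" "normal_space X" "Hausdorff_space X"
    and Y: "k_omega Y L" "normal_space Y" "Hausdorff_space Y"
  shows "k_omega (prod_topology X Y) (\<lambda>n. K n \<times> L n)"
  unfolding k_omega_def
proof (intro conjI allI impI)
  note XD = k_omegaD[OF X(1)] and YD = k_omegaD[OF Y(1)]
  show "compactin (prod_topology X Y) (K n \<times> L n)" for n
    by (simp add: compactin_Times XD YD)
  show "K n \<times> L n \<subseteq> K (Suc n) \<times> L (Suc n)" for n
    using XD(3) YD(3) by (auto simp: mono_iff_le_Suc)
  show "(\<Union>n. K n \<times> L n) = topspace (prod_topology X Y)"
  proof (intro equalityI subsetI)
    fix z assume "z \<in> (\<Union>n. K n \<times> L n)"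
    then show "z \<in> topspace (prod_topology X Y)" using XD(2) YD(2) by auto
  next
    fix z assume "z \<in> topspace (prod_topology X Y)"
    then have "fst z \<in> (\<Union>n. K n)" "snd z \<in> (\<Union>n. L n)" unfolding XD(4) YD(4) by auto
    then obtain i j where "fst z \<in> K i" "snd z \<in> L j" by blast
    then have "z \<in> K (max i j) \<times> L (max i j)"
      using monoD[OF XD(3), of i "max i j"] monoD[OF YD(3), of j "max i j"]
      by (auto simp: mem_Times_iff)
    then show "z \<in> (\<Union>n. K n \<times> L n)" by blast
  qed
  fix C assume C: "C \<subseteq> topspace (prod_topology X Y)"
    "\<forall>n. closedin (prod_topology X Y) (C \<inter> K n \<times> L n)"
  \<comment> \<open>One step of growth. The open sets \<open>U\<close> and \<open>V\<close> are
    recorded because the compact boxes are not open: at level \<open>m\<close> the new box contains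
    the traces of open sets around the old one, and this makes the union over all steps
    open.\<close>
  have step: "\<exists>A' B' U V. compactin X A' \<and> compactin Y B' \<and> A' \<subseteq> K m \<and> B' \<subseteq> L m \<and>
      A' \<times> B' \<inter> C = {} \<and> openin X U \<and> openin Y V \<and> A \<subseteq> U \<and> B \<subseteq> V \<and> U \<inter> K m \<subseteq> A' \<and> V \<inter> L m \<subseteq> B'"
    if A: "compactin X A" "compactin Y B" "A \<times> B \<inter> C = {}" for A B m
  proof -
    let ?W = "topspace (prod_topology X Y) - C \<inter> K m \<times> L m"
    have "openin (prod_topology X Y) ?W" using C(2) by blast
    moreover have "A \<times> B \<subseteq> ?W"
      using A compactin_subset_topspace[OF A(1)] compactin_subset_topspace[OF A(2)] by auto
    ultimately obtain U V where UV: "openin X U" "openin Y V" "A \<subseteq> U" "B \<subseteq> V" "U \<times> V \<subseteq> ?W"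
      using Wallace_theorem_prod_topology[OF A(1,2)] by metis
    have "closedin X A" "closedin Y B"
      using A X(3) Y(3) compactin_imp_closedin by blast+
    then obtain U' V' where U': "openin X U'" "A \<subseteq> U'" "X closure_of U' \<subseteq> U"
      and V': "openin Y V'" "B \<subseteq> V'" "Y closure_of V' \<subseteq> V"
      using X(2) Y(2) UV unfolding normal_space_alt by metis
    \<comment> \<open>Taking closures makes the new sets closed, hence compact inside
      \<open>K m\<close> and \<open>L m\<close>, while they stay in \<open>U\<close> and
      \<open>V\<close>, whose product misses \<open>C\<close> at level \<open>m\<close>.\<close>
    define A' B' where AB: "A' = X closure_of U' \<inter> K m" "B' = Y closure_of V' \<inter> L m"
    have "compactin X A'" "compactin Y B'"
      unfolding AB by (intro closed_Int_compactin closedin_closure_of XD(1) YD(1))+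
    moreover have "U' \<inter> K m \<subseteq> A'" "V' \<inter> L m \<subseteq> B'"
      unfolding AB using closure_of_subset[OF openin_subset[OF U'(1)]]
        closure_of_subset[OF openin_subset[OF V'(1)]] by blast+
    moreover have "A' \<times> B' \<inter> C = {}"
    proof -
      have "A' \<subseteq> U" "B' \<subseteq> V" "A' \<subseteq> K m" "B' \<subseteq> L m"
        unfolding AB using U'(3) V'(3) by blast+
      then have "A' \<times> B' \<subseteq> U \<times> V" "A' \<times> B' \<subseteq> K m \<times> L m" by (simp_all add: Sigma_mono)
      then show ?thesis using UV(5) by blast
    qed
    moreover have "A' \<subseteq> K m" "B' \<subseteq> L m" unfolding AB by blast+
    ultimately show ?thesis using U'(1,2) V'(1,2) by metis
  qed
  have "\<exists>U V. openin X U \<and> openin Y V \<and> x \<in> U \<and> y \<in> V \<and> U \<times> V \<subseteq> topspace (prod_topology X Y) - C"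
    if xy: "x \<in> topspace X" "y \<in> topspace Y" "(x, y) \<notin> C" for x y
  proof -
    obtain i where i: "x \<in> K i" "y \<in> L i"
    proof -
      from xy have "x \<in> (\<Union>n. K n)" "y \<in> (\<Union>n. L n)" unfolding XD(4) YD(4) by auto
      then obtain i j where "x \<in> K i" "y \<in> L j" by blast
      then have "x \<in> K (max i j)" "y \<in> L (max i j)"
        using monoD[OF XD(3), of i "max i j"] monoD[OF YD(3), of j "max i j"] by auto
      then show ?thesis by (rule that)
    qed
    \<comment> \<open>A pair \<open>p\<close> is the current box. The offset \<open>i\<close> is a
      level that already contains both coordinates, so the one-point box is a legal start;
      \<open>?Q\<close> links consecutive boxes by the open sets of \<open>step\<close>.\<close>
    let ?P = "\<lambda>n p. compactin X (fst p) \<and> compactin Y (snd p) \<and> fst p \<times> snd p \<inter> C = {} \<and>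
      x \<in> fst p \<and> y \<in> snd p \<and> fst p \<subseteq> K (i + n) \<and> snd p \<subseteq> L (i + n)"
    let ?Q = "\<lambda>n p p'. \<exists>U V. openin X U \<and> openin Y V \<and> fst p \<subseteq> U \<and> snd p \<subseteq> V \<and>
      U \<inter> K (i + Suc n) \<subseteq> fst p' \<and> V \<inter> L (i + Suc n) \<subseteq> snd p'"
    have "\<exists>F. \<forall>n. ?P n (F n) \<and> ?Q n (F n) (F (Suc n))"
    proof (rule dependent_nat_choice)
      show "\<exists>p. ?P 0 p" using i xy by (intro exI[of _ "({x}, {y})"]) auto
      fix p n assume p: "?P n p"
      obtain A' B' U V where s: "compactin X A'" "compactin Y B'" "A' \<subseteq> K (i + Suc n)"
        "B' \<subseteq> L (i + Suc n)" "A' \<times> B' \<inter> C = {}" "openin X U" "openin Y V" "fst p \<subseteq> U" "snd p \<subseteq> V"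
        "U \<inter> K (i + Suc n) \<subseteq> A'" "V \<inter> L (i + Suc n) \<subseteq> B'"
        using step[of "fst p" "snd p" "i + Suc n"] p by blast
      have "x \<in> K (i + Suc n)" "y \<in> L (i + Suc n)"
        using i monoD[OF XD(3), of i "i + Suc n"] monoD[OF YD(3), of i "i + Suc n"] by auto
      moreover have "x \<in> U" "y \<in> V" using s(8,9) p by blast+
      ultimately have "x \<in> A'" "y \<in> B'" using s(10,11) by blast+
      then have "?P (Suc n) (A', B')" using s(1-5) by simp
      moreover have "?Q n p (A', B')" unfolding fst_conv snd_conv
        by (intro exI[of _ U] exI[of _ V] conjI s)
      ultimately show "\<exists>p'. ?P (Suc n) p' \<and> ?Q n p p'" by blast
    qed
    then obtain F where F0: "\<forall>n. ?P n (F n) \<and> ?Q n (F n) (F (Suc n))" ..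
    have F: "?P n (F n)" "?Q n (F n) (F (Suc n))" for n
      using F0[rule_format, of n] by (rule conjunct1, rule conjunct2)
    have incX: "\<exists>U. openin X U \<and> fst (F n) \<subseteq> U \<and> U \<inter> K (i + Suc n) \<subseteq> fst (F (Suc n))"
      and incY: "\<exists>V. openin Y V \<and> snd (F n) \<subseteq> V \<and> V \<inter> L (i + Suc n) \<subseteq> snd (F (Suc n))" for n
      using F(2)[of n] by meson+
    have incA: "fst (F n) \<subseteq> fst (F (Suc n))" and incB: "snd (F n) \<subseteq> snd (F (Suc n))" for n
    proof -
      have "K (i + n) \<subseteq> K (i + Suc n)" "L (i + n) \<subseteq> L (i + Suc n)"
        by (auto intro!: monoD[OF XD(3)] monoD[OF YD(3)])
      then show "fst (F n) \<subseteq> fst (F (Suc n))" "snd (F n) \<subseteq> snd (F (Suc n))"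
        using F(1)[of n] incX[of n] incY[of n] by (meson IntI in_mono subsetI)+
    qed
    have mA: "fst (F n) \<subseteq> fst (F m)" if "n \<le> m" for n m
      using that incA by (rule lift_Suc_mono_le[rotated])
    have mB: "snd (F n) \<subseteq> snd (F m)" if "n \<le> m" for n m
      using that incB by (rule lift_Suc_mono_le[rotated])
    \<comment> \<open>Used for both factors. On \<open>J m\<close> the union of the
      \<open>A n\<close> has the same trace as the union of the open \<open>O' n\<close> with
      \<open>n \<ge> m\<close>: one inclusion is \<open>A n \<subseteq> O' n\<close>, the other
      holds because \<open>J m\<close> lies in \<open>J (i + Suc n)\<close>, where
      \<open>O' n\<close> is contained in \<open>A (Suc n)\<close>. So the complement is closed on
      every \<open>J m\<close>.\<close>
    have grow: "openin Z (\<Union>n. A n)"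
      if Z: "k_omega Z J" "Hausdorff_space Z" and A: "\<And>n. A n \<subseteq> topspace Z"
        "\<And>n m. n \<le> m \<Longrightarrow> A n \<subseteq> A m"
        "\<And>n. \<exists>U. openin Z U \<and> A n \<subseteq> U \<and> U \<inter> J (i + Suc n) \<subseteq> A (Suc n)"
      for Z :: "'z topology" and J A
    proof -
      obtain O' where O': "\<And>n. openin Z (O' n) \<and> A n \<subseteq> O' n \<and> O' n \<inter> J (i + Suc n) \<subseteq> A (Suc n)"
        using A(3) by metis
      have "closedin Z ((topspace Z - (\<Union>n. A n)) \<inter> J m)" for m
      proof -
        have "(\<Union>n. A n) \<inter> J m = (\<Union>n\<in>{m..}. O' n) \<inter> J m"
        proof (intro equalityI subsetI)
          fix z assume "z \<in> (\<Union>n. A n) \<inter> J m"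
          then obtain n where "z \<in> A n" "z \<in> J m" by blast
          then have "z \<in> A (max n m)" using A(2)[of n "max n m"] by auto
          then show "z \<in> (\<Union>n\<in>{m..}. O' n) \<inter> J m"
            using O'[of "max n m"] \<open>z \<in> J m\<close> by fastforce
        next
          fix z assume "z \<in> (\<Union>n\<in>{m..}. O' n) \<inter> J m"
          then obtain n where "n \<ge> m" "z \<in> O' n" "z \<in> J m" by blast
          then have "z \<in> J (i + Suc n)" using monoD[OF k_omegaD(3)[OF Z(1)], of m "i + Suc n"] by auto
          then show "z \<in> (\<Union>n. A n) \<inter> J m" using O'[of n] \<open>z \<in> O' n\<close> \<open>z \<in> J m\<close> by blast
        qed
        moreover have "(topspace Z - (\<Union>n. A n)) \<inter> J m = J m - (\<Union>n. A n) \<inter> J m"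
          using k_omegaD(2)[OF Z(1), of m] by blast
        ultimately have eq: "(topspace Z - (\<Union>n. A n)) \<inter> J m = J m - (\<Union>n\<in>{m..}. O' n)"
          by (simp only: Diff_Int_distrib2 Diff_Int) simp
        have "openin Z (O' n)" for n using O'[of n] by (elim conjE)
        then have "openin Z (\<Union>n\<in>{m..}. O' n)"
          by (intro openin_Union) auto
        with compactin_imp_closedin[OF Z(2) k_omegaD(1)[OF Z(1)]] show ?thesis
          unfolding eq by (rule closedin_diff)
      qed
      then have "closedin Z (topspace Z - (\<Union>n. A n))"
        by (rule k_omegaD(5)[OF Z(1) Diff_subset])
      then show ?thesis using A(1) by (simp add: openin_closedin_eq UN_least)
    qed
    have "openin X (\<Union>n. fst (F n))"
      by (rule grow[OF X(1,3) _ mA incX]) (use F(1) compactin_subset_topspace in metis)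
    moreover have "openin Y (\<Union>n. snd (F n))"
      by (rule grow[OF Y(1,3) _ mB incY]) (use F(1) compactin_subset_topspace in metis)
    moreover have "(\<Union>n. fst (F n)) \<times> (\<Union>n. snd (F n)) \<inter> C = {}"
    proof -
      have False if ab: "a \<in> fst (F n)" "b \<in> snd (F m)" "(a, b) \<in> C" for a b n m
      proof -
        have "a \<in> fst (F (max n m))" "b \<in> snd (F (max n m))"
          using ab mA[of n "max n m"] mB[of m "max n m"] by auto
        moreover have "fst (F (max n m)) \<times> snd (F (max n m)) \<inter> C = {}"
          using F(1)[of "max n m"] by (elim conjE)
        ultimately show False using ab(3) by blast
      qed
      then show ?thesis by blast
    qed
    moreover from calculation(1,2) have "(\<Union>n. fst (F n)) \<times> (\<Union>n. snd (F n)) \<subseteq> topspace (prod_topology X Y)"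
      using openin_subset by (metis Sigma_mono topspace_prod_topology)
    moreover have "x \<in> (\<Union>n. fst (F n))" "y \<in> (\<Union>n. snd (F n))"
      using F(1)[of 0] by (elim conjE, blast)+
    ultimately show ?thesis
      by (intro exI[of _ "\<Union>n. fst (F n)"] exI[of _ "\<Union>n. snd (F n)"]) blast
  qed
  then have "openin (prod_topology X Y) (topspace (prod_topology X Y) - C)"
    unfolding openin_prod_topology_alt by auto
  then show "closedin (prod_topology X Y) C" using C(1) by (simp add: closedin_def)
qed

section \<open>Adjunction spaces\<close>

lemma closedin_adjunction_space:
  assumes h: "h ` (topspace M \<inter> A) \<subseteq> topspace X"
  shows "closedin (adjunction_space X M A h) C \<longleftrightarrow>
     C \<subseteq> Inl ` topspace X \<union> Inr ` (topspace M - A) \<and>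
     closedin X {x \<in> topspace X. Inl x \<in> C} \<and> closedin M {m \<in> topspace M. adj_map A h m \<in> C}"
proof -
  let ?T = "Inl ` topspace X \<union> Inr ` (topspace M - A)"
  have "{x \<in> topspace X. Inl x \<in> ?T - C} = topspace X - {x \<in> topspace X. Inl x \<in> C}" by auto
  moreover have "{m \<in> topspace M. adj_map A h m \<in> ?T - C}
      = topspace M - {m \<in> topspace M. adj_map A h m \<in> C}"
    using h by (auto simp: adj_map_def split: if_splits)
  ultimately show ?thesis
    unfolding closedin_def topspace_adjunction_space[OF h] openin_adjunction_space
    by (simp add: Diff_subset subset_eq)
qed

lemma continuous_map_Inl_adjunction_space:
  assumes h: "h ` (topspace M \<inter> A) \<subseteq> topspace X"
  shows "continuous_map X (adjunction_space X M A h) Inl"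
  unfolding continuous_map_def topspace_adjunction_space[OF h] openin_adjunction_space by auto

lemma continuous_map_adj_map:
  assumes h: "h ` (topspace M \<inter> A) \<subseteq> topspace X"
  shows "continuous_map M (adjunction_space X M A h) (adj_map A h)"
  unfolding continuous_map_def topspace_adjunction_space[OF h] openin_adjunction_space
  using h by (auto simp: adj_map_def image_subset_iff)

lemma attaching_image:
  assumes "continuous_map (subtopology M A) X h"
  shows "h ` (topspace M \<inter> A) \<subseteq> topspace X"
  using continuous_map_image_subset_topspace[OF assms] by simp

text \<open>Via Urysohn functions instead of open sets: separate the traces of \<open>C\<close> and
  \<open>D\<close> on \<open>X\<close>, prescribe the resulting values on \<open>A\<close> and the
  constants 0 and 1 on the preimages of \<open>C\<close> and \<open>D\<close> in \<open>M\<close>,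
  extend by Tietze, and glue by the universal property.\<close>

lemma normal_space_adjunction_space:
  assumes h: "continuous_map (subtopology M A) X h" and A: "closedin M A"
    and nX: "normal_space X" and nM: "normal_space M"
  shows "normal_space (adjunction_space X M A h)"
proof -
  note hA = attaching_image[OF h]
  have "\<exists>f. continuous_map (adjunction_space X M A h) euclideanreal f \<and> f ` C \<subseteq> {0} \<and> f ` D \<subseteq> {1}"
    if C: "closedin (adjunction_space X M A h) C" and D: "closedin (adjunction_space X M A h) D"
      and CD: "disjnt C D" for C D
  proof -
    let ?q = "adj_map A h"
    define C' D' where C'_def: "C' = {m \<in> topspace M. ?q m \<in> C}"
      and D'_def: "D' = {m \<in> topspace M. ?q m \<in> D}"
    have cC: "closedin X {x \<in> topspace X. Inl x \<in> C}" "closedin M C'"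
      and cD: "closedin X {x \<in> topspace X. Inl x \<in> D}" "closedin M D'"
      using C D unfolding closedin_adjunction_space[OF hA] C'_def D'_def by simp_all
    have "disjnt {x \<in> topspace X. Inl x \<in> C} {x \<in> topspace X. Inl x \<in> D}"
      using CD by (auto simp: disjnt_iff)
    then obtain \<phi> where \<phi>: "continuous_map X euclideanreal \<phi>"
      "\<phi> ` {x \<in> topspace X. Inl x \<in> C} \<subseteq> {0}" "\<phi> ` {x \<in> topspace X. Inl x \<in> D} \<subseteq> {1}"
      by (rule Urysohn_lemma_alt[OF nX cC(1) cD(1), of 0 1])
    have \<phi>0: "\<phi> x = 0" if "x \<in> topspace X" "Inl x \<in> C" for x using \<phi>(2) that by blast
    have \<phi>1: "\<phi> x = 1" if "x \<in> topspace X" "Inl x \<in> D" for x using \<phi>(3) that by blast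
    \<comment> \<open>Three closed pieces, indexed 0, 1, 2, for the pasting lemma. They agree on
      overlaps: a point of \<open>A\<close> in \<open>C'\<close> is glued to a point of
      \<open>C\<close> in \<open>X\<close>, where \<open>\<phi>\<close> vanishes, and likewise for
      \<open>D'\<close> with the value 1.\<close>
    let ?S = "A \<union> C' \<union> D'"
    let ?f = "\<lambda>i::nat. if i = 0 then \<phi> \<circ> h else if i = 1 then (\<lambda>_. 0) else (\<lambda>_. 1)"
    let ?T = "\<lambda>i::nat. if i = 0 then A else if i = 1 then C' else D'"
    \<comment> \<open>Only the values on \<open>?S\<close> matter. There the default 1 is reached
      exactly on \<open>D'\<close> outside \<open>A\<close>.\<close>
    define g where "g m = (if m \<in> A then \<phi> (h m) else if m \<in> C' then 0 else 1)" for m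
    have A': "A \<subseteq> topspace M" using A closedin_subset by blast
    have on_A: "h m \<in> topspace X" "?q m = Inl (h m)" if "m \<in> A" for m
      using that hA A' by (auto simp: adj_map_def)
    have "continuous_map (subtopology M ?S) euclideanreal g"
    proof (rule pasting_lemma_closed[where I = "{0, 1, 2::nat}" and T = ?T and f = ?f])
      fix i :: nat assume i: "i \<in> {0, 1, 2}"
      have sub: "?T i \<subseteq> ?S" by auto
      show "closedin (subtopology M ?S) (?T i)"
        by (rule closedin_subset_topspace[OF _ sub]) (use A cC(2) cD(2) in simp)
      have eq: "subtopology (subtopology M ?S) (?T i) = subtopology M (?T i)"
        using sub by (metis subtopology_subtopology inf.absorb_iff2)
      show "continuous_map (subtopology (subtopology M ?S) (?T i)) euclideanreal (?f i)"
        unfolding eq using continuous_map_compose[OF h \<phi>(1)] by simp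
    next
      fix i j x
      assume "i \<in> {0, 1, 2::nat}" "j \<in> {0, 1, 2::nat}"
        "x \<in> topspace (subtopology M ?S) \<inter> ?T i \<inter> ?T j"
      moreover have "\<not> (x \<in> C' \<and> x \<in> D')" using CD by (auto simp: C'_def D'_def disjnt_iff)
      moreover have "\<phi> (h x) = 0" if "x \<in> A" "x \<in> C'" using that on_A[of x] \<phi>0 by (simp add: C'_def)
      moreover have "\<phi> (h x) = 1" if "x \<in> A" "x \<in> D'" using that on_A[of x] \<phi>1 by (simp add: D'_def)
      ultimately show "?f i x = ?f j x" by auto
    next
      fix x assume x: "x \<in> topspace (subtopology M ?S)"
      consider "x \<in> A" | "x \<notin> A" "x \<in> C'" | "x \<notin> A" "x \<notin> C'" "x \<in> D'" using x by auto
      then show "\<exists>j. j \<in> {0, 1, 2::nat} \<and> x \<in> ?T j \<and> g x = ?f j x"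
        by cases (force simp: g_def)+
    qed simp
    moreover have "closedin M ?S" using A cC(2) cD(2) by blast
    ultimately obtain \<psi> where \<psi>: "continuous_map M euclideanreal \<psi>" "\<And>m. m \<in> ?S \<Longrightarrow> \<psi> m = g m"
      using Tietze_extension_realinterval[OF nM, of ?S UNIV g] by auto
    have c: "continuous_map (adjunction_space X M A h) euclideanreal (case_sum \<phi> \<psi>)"
      using \<psi>(2) by (intro adjunction_space_universal hA \<phi> \<psi>) (auto simp: g_def)
    have "case_sum \<phi> \<psi> z = 0" if z: "z \<in> C" for z
    proof (cases z)
      case (Inl x)
      then show ?thesis using C z \<phi>0 unfolding closedin_adjunction_space[OF hA] by auto
    next
      case (Inr m)
      then have "m \<in> topspace M" "m \<notin> A" using C z unfolding closedin_adjunction_space[OF hA] by auto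
      then have "m \<in> C'" using z Inr by (simp add: C'_def adj_map_def)
      then show ?thesis using Inr \<psi>(2)[of m] \<open>m \<notin> A\<close> by (simp add: g_def)
    qed
    moreover have "case_sum \<phi> \<psi> z = 1" if z: "z \<in> D" for z
    proof (cases z)
      case (Inl x)
      then show ?thesis using D z \<phi>1 unfolding closedin_adjunction_space[OF hA] by auto
    next
      case (Inr m)
      then have "m \<in> topspace M" "m \<notin> A" using D z unfolding closedin_adjunction_space[OF hA] by auto
      then have "m \<in> D'" "m \<notin> C'" using z Inr CD by (auto simp: C'_def D'_def adj_map_def disjnt_iff)
      then show ?thesis using Inr \<psi>(2)[of m] \<open>m \<notin> A\<close> by (simp add: g_def)
    qed
    ultimately show ?thesis using c by (intro exI[of _ "case_sum \<phi> \<psi>"]) blast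
  qed
  then show ?thesis
    unfolding normal_space_iff_Urysohn_gen_alt[OF zero_neq_one[where 'a = real]] by blast
qed

text \<open>Together with normality this yields the Hausdorff property. The preimage in
  \<open>M\<close> of a point of \<open>X\<close> is a fibre of \<open>h\<close>, closed in
  \<open>A\<close> and therefore in \<open>M\<close>.\<close>

lemma t1_space_adjunction_space:
  assumes h: "continuous_map (subtopology M A) X h" and A: "closedin M A"
    and X: "t1_space X" and M: "t1_space M"
  shows "t1_space (adjunction_space X M A h)"
proof -
  note hA = attaching_image[OF h]
  have "closedin (adjunction_space X M A h) {Inl x}" if x: "x \<in> topspace X" for x
  proof -
    have "closedin (subtopology M A) {m \<in> topspace (subtopology M A). h m \<in> {x}}"
      using h X x by (intro closedin_continuous_map_preimage) (auto simp: t1_space_closedin_singleton)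
    then have "closedin M {m \<in> topspace (subtopology M A). h m \<in> {x}}"
      using A by (rule closedin_trans_full)
    moreover have "{m \<in> topspace (subtopology M A). h m \<in> {x}}
        = {m \<in> topspace M. adj_map A h m \<in> {Inl x}}"
      by (auto simp: adj_map_def)
    moreover have "{y \<in> topspace X. Inl y \<in> {Inl x}} = {x}" using x by auto
    ultimately show ?thesis
      unfolding closedin_adjunction_space[OF hA] using X x by (simp add: t1_space_closedin_singleton)
  qed
  moreover have "closedin (adjunction_space X M A h) {Inr m}" if m: "m \<in> topspace M" "m \<notin> A" for m
  proof -
    have "{n \<in> topspace M. adj_map A h n \<in> {Inr m}} = {m}" using m by (auto simp: adj_map_def)
    then show ?thesis
      unfolding closedin_adjunction_space[OF hA] using M m by (simp add: t1_space_closedin_singleton)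
  qed
  ultimately show ?thesis
    unfolding t1_space_closedin_singleton topspace_adjunction_space[OF hA] by blast
qed

section \<open>Push-outs in which \<open>X\<close> is literally a set of points of
  \<open>Z\<close>\<close>

context
  fixes X :: "'p topology" and M :: "'m topology" and A h Z k
  assumes po: "is_pushout X M A h Z id k" and hA: "h ` (topspace M \<inter> A) \<subseteq> topspace X"
begin

lemma pushout_homeo: "homeomorphic_map (adjunction_space X M A h) Z (case_sum id k)"
  using po by (simp add: is_pushout_def)

lemma pushout_glue: "m \<in> topspace M \<Longrightarrow> m \<in> A \<Longrightarrow> k m = h m"
  using po by (simp add: is_pushout_def)

lemma pushout_topspace: "topspace Z = topspace X \<union> k ` topspace M"
proof -
  have "topspace Z = case_sum id k ` (Inl ` topspace X \<union> Inr ` (topspace M - A))"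
    using homeomorphic_imp_surjective_map[OF pushout_homeo]
    by (simp add: topspace_adjunction_space[OF hA])
  also have "\<dots> = topspace X \<union> k ` (topspace M - A)" by (simp add: image_Un image_image)
  also have "\<dots> = topspace X \<union> k ` topspace M" using pushout_glue hA by auto
  finally show ?thesis .
qed

lemma pushout_continuous_inclusion: "continuous_map X Z id"
proof -
  have "continuous_map X Z (case_sum id k \<circ> Inl)"
    using continuous_map_Inl_adjunction_space[OF hA] homeomorphic_imp_continuous_map[OF pushout_homeo]
    by (rule continuous_map_compose)
  then show ?thesis by (simp add: o_def id_def)
qed

lemma pushout_continuous_chr: "continuous_map M Z k"
proof -
  have "continuous_map M Z (case_sum id k \<circ> adj_map A h)"
    using continuous_map_adj_map[OF hA] homeomorphic_imp_continuous_map[OF pushout_homeo]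
    by (rule continuous_map_compose)
  then show ?thesis
    by (rule continuous_map_eq) (auto simp: adj_map_def pushout_glue)
qed

text \<open>In the second claim \<open>n\<close> may be any point of \<open>M\<close>: if it were in
  \<open>A\<close>, then \<open>k n\<close> would lie in \<open>X\<close>, contrary to the first
  claim.\<close>

lemma pushout_inj:
  assumes "m \<in> topspace M" "m \<notin> A"
  shows "k m \<notin> topspace X" "n \<in> topspace M \<Longrightarrow> k n = k m \<Longrightarrow> n = m"
proof -
  have inj: "inj_on (case_sum id k) (Inl ` topspace X \<union> Inr ` (topspace M - A))"
    using homeomorphic_imp_injective_map[OF pushout_homeo]
    by (simp add: topspace_adjunction_space[OF hA])
  show 1: "k m \<notin> topspace X"
    using inj_onD[OF inj, of "Inl (k m)" "Inr m"] assms by auto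
  assume n: "n \<in> topspace M" "k n = k m"
  then have "n \<notin> A" using 1 pushout_glue hA by auto
  then show "n = m" using inj_onD[OF inj, of "Inr n" "Inr m"] assms n by auto
qed

text \<open>The quotient topology of the disjoint union, read inside \<open>Z\<close> by
  transporting \<open>C\<close> to its preimage \<open>U\<close> in the adjunction space.\<close>

lemma pushout_closedin:
  "closedin Z C \<longleftrightarrow> C \<subseteq> topspace Z \<and> closedin X (topspace X \<inter> C) \<and> closedin M {m \<in> topspace M. k m \<in> C}"
proof (cases "C \<subseteq> topspace Z")
  case True
  define U where "U = {z \<in> Inl ` topspace X \<union> Inr ` (topspace M - A). case_sum id k z \<in> C}"
  have "case_sum id k ` topspace (adjunction_space X M A h) = topspace Z"
    using homeomorphic_imp_surjective_map[OF pushout_homeo] .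
  then have sur: "topspace Z = case_sum id k ` (Inl ` topspace X \<union> Inr ` (topspace M - A))"
    by (simp only: topspace_adjunction_space[OF hA])
  have "case_sum id k ` U = C"
  proof (intro equalityI subsetI)
    fix c assume "c \<in> C"
    with True sur obtain u where "u \<in> Inl ` topspace X \<union> Inr ` (topspace M - A)" "c = case_sum id k u"
      by (metis (no_types, lifting) imageE subsetD)
    with \<open>c \<in> C\<close> show "c \<in> case_sum id k ` U" by (simp add: U_def image_iff) metis
  next
    fix c assume "c \<in> case_sum id k ` U"
    then show "c \<in> C" by (auto simp: U_def)
  qed
  moreover have "U \<subseteq> topspace (adjunction_space X M A h)"
    unfolding U_def topspace_adjunction_space[OF hA] by blast
  ultimately have "closedin Z C \<longleftrightarrow> closedin (adjunction_space X M A h) U"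
    using homeomorphic_map_closedness[OF pushout_homeo] by blast
  moreover have "{x \<in> topspace X. Inl x \<in> U} = topspace X \<inter> C" by (auto simp: U_def)
  moreover have "{m \<in> topspace M. adj_map A h m \<in> U} = {m \<in> topspace M. k m \<in> C}"
    using hA by (auto simp: U_def adj_map_def pushout_glue split: if_splits)
  ultimately show ?thesis using True unfolding closedin_adjunction_space[OF hA] U_def by auto
next
  case False
  then show ?thesis using closedin_subset by blast
qed

text \<open>The preimage of \<open>X\<close> under \<open>k\<close> is exactly \<open>A\<close>:
  points off \<open>A\<close> leave \<open>X\<close>, points of \<open>A\<close> are glued into
  it.\<close>

lemma pushout_closedin_base: "closedin M A \<Longrightarrow> closedin Z (topspace X)"
proof -
  assume A: "closedin M A"
  then have "A \<subseteq> topspace M" by (rule closedin_subset)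
  then have "{m \<in> topspace M. k m \<in> topspace X} = A"
    using pushout_inj(1) pushout_glue hA by (auto simp: subset_iff image_subset_iff)
  then show ?thesis unfolding pushout_closedin using A by (simp add: pushout_topspace)
qed

text \<open>Disjoint neighbourhoods of points are awkward to build in a quotient; normality and T1
  pass to the adjunction separately and together imply Hausdorff.\<close>

lemma pushout_normal_t1:
  assumes "continuous_map (subtopology M A) X h" "closedin M A"
    and "normal_space X" "Hausdorff_space X" "normal_space M" "Hausdorff_space M"
  shows "normal_space Z" "Hausdorff_space Z"
proof -
  have hs: "adjunction_space X M A h homeomorphic_space Z"
    using pushout_homeo by (rule homeomorphic_map_imp_homeomorphic_space)
  have "t1_space (adjunction_space X M A h)"
    by (rule t1_space_adjunction_space) (use assms Hausdorff_imp_t1_space in auto)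
  then have t1: "t1_space Z" using homeomorphic_t1_space[OF hs] by simp
  show n: "normal_space Z"
    using normal_space_adjunction_space[OF assms(1,2,3,5)] homeomorphic_normal_space[OF hs] by simp
  show "Hausdorff_space Z" using n t1 by (rule normal_t1_imp_Hausdorff_space)
qed

lemma pushout_k_omega:
  assumes K: "k_omega X K" "Hausdorff_space X" and L: "k_omega M L" "Hausdorff_space M"
    and Z: "Hausdorff_space Z"
  shows "k_omega Z (\<lambda>n. K n \<union> k ` L n)"
  unfolding k_omega_def
proof (intro conjI allI impI)
  note KD = k_omegaD[OF K(1)] and LD = k_omegaD[OF L(1)]
  have cK: "closedin X (K n)" and cL: "closedin M (L n)" for n
    using KD(1) LD(1) K(2) L(2) compactin_imp_closedin by blast+
  show "compactin Z (K n \<union> k ` L n)" for n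
    using image_compactin[OF KD(1) pushout_continuous_inclusion]
      image_compactin[OF LD(1) pushout_continuous_chr] by (simp add: compactin_Un)
  show "K n \<union> k ` L n \<subseteq> K (Suc n) \<union> k ` L (Suc n)" for n
    using monoD[OF KD(3), of n "Suc n"] monoD[OF LD(3), of n "Suc n"] by auto
  show "(\<Union>n. K n \<union> k ` L n) = topspace Z"
    unfolding pushout_topspace KD(4)[symmetric] LD(4)[symmetric] by auto
  fix C assume C: "C \<subseteq> topspace Z" "\<forall>n. closedin Z (C \<inter> (K n \<union> k ` L n))"
  have "closedin X ((topspace X \<inter> C) \<inter> K n)" for n
  proof -
    have "closedin X (topspace X \<inter> (C \<inter> (K n \<union> k ` L n)))"
      using C(2)[rule_format, of n] unfolding pushout_closedin by blast
    then have "closedin X (topspace X \<inter> (C \<inter> (K n \<union> k ` L n)) \<inter> K n)"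
      using cK by (rule closedin_Int)
    moreover have "topspace X \<inter> (C \<inter> (K n \<union> k ` L n)) \<inter> K n = (topspace X \<inter> C) \<inter> K n" by blast
    ultimately show ?thesis by simp
  qed
  then have 1: "closedin X (topspace X \<inter> C)" by (rule KD(5)[OF Int_lower1])
  have "closedin M ({m \<in> topspace M. k m \<in> C} \<inter> L n)" for n
  proof -
    have "closedin M {m \<in> topspace M. k m \<in> C \<inter> (K n \<union> k ` L n)}"
      using C(2)[rule_format, of n] unfolding pushout_closedin by blast
    then have "closedin M ({m \<in> topspace M. k m \<in> C \<inter> (K n \<union> k ` L n)} \<inter> L n)"
      using cL by (rule closedin_Int)
    moreover have "{m \<in> topspace M. k m \<in> C \<inter> (K n \<union> k ` L n)} \<inter> L n = {m \<in> topspace M. k m \<in> C} \<inter> L n"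
      by blast
    ultimately show ?thesis by simp
  qed
  then have "closedin M {m \<in> topspace M. k m \<in> C}" by (rule LD(5)[OF Collect_subset])
  then show "closedin Z C" unfolding pushout_closedin using C(1) 1 by blast
qed

end

section \<open>Locally finite countable CW-complexes\<close>

text \<open>The class for attached spaces and for bundles over them. It passes to total spaces of
  bundles but not to adjunctions, where local compactness can fail; for the filtration steps
  \<open>k_omega_normal_space\<close> takes over.\<close>

definition lch_Lindelof_space :: "'a topology \<Rightarrow> bool" where
  "lch_Lindelof_space X \<longleftrightarrow> locally_compact_space X \<and> Hausdorff_space X \<and> Lindelof_space X"

lemma lch_Lindelof_space_imp_normal: "lch_Lindelof_space X \<Longrightarrow> normal_space X"
  by (simp add: lch_Lindelof_space_def regular_Lindelof_imp_normal_space
      locally_compact_Hausdorff_imp_regular_space)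

text \<open>Inside the space of all real sequences the disc is a closed subset of the cube of
  sequences with entries in [-1, 1], which is compact by Tychonoff.\<close>

lemma compact_space_disc: "compact_space (disc n)"
proof -
  let ?D = "{x :: nat \<Rightarrow> real. (\<forall>i\<ge>n. x i = 0) \<and> (\<Sum>i<n. (x i)\<^sup>2) \<le> 1}"
  have "disc n = subtopology euclidean ?D"
    by (simp add: disc_def Euclidean_space_def subtopology_subtopology euclidean_product_topology
        Collect_conj_eq)
  moreover have "compactin euclidean ?D"
  proof (rule closed_compactin)
    show "compactin (euclidean :: (nat \<Rightarrow> real) topology) (PiE UNIV (\<lambda>_. {-1..1}))"
      unfolding euclidean_product_topology[symmetric] compactin_PiE by simp
    show "?D \<subseteq> PiE UNIV (\<lambda>_. {-1..1})"
    proof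
      fix x assume x: "x \<in> ?D"
      have "\<bar>x i\<bar> \<le> 1" for i
      proof (cases "i < n")
        case True
        then have "(x i)\<^sup>2 \<le> (\<Sum>i<n. (x i)\<^sup>2)" by (intro member_le_sum) auto
        with x have "(x i)\<^sup>2 \<le> 1" by simp
        then show ?thesis by (simp add: abs_square_le_1)
      qed (use x in auto)
      then show "x \<in> PiE UNIV (\<lambda>_. {-1..1})" by (auto simp: abs_le_iff minus_le_iff)
    qed
    have "closed ?D"
      by (intro closed_Collect_conj closed_Collect_all closed_Collect_imp closed_Collect_eq
          closed_Collect_le continuous_intros) (auto intro!: continuous_intros)
    then show "closedin euclidean ?D" by simp
  qed
  ultimately show ?thesis by (simp add: compactin_subspace)
qed

text \<open>The image of the closed disc under the characteristic map is compact, so closed in the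
  Hausdorff space, and it contains the cell; hence it contains the closure of the cell.\<close>

lemma CW_structure_cell:
  assumes X: "CW_structure X E d \<Phi>" and e: "e \<in> E"
  shows "e \<subseteq> topspace X" "compactin X (X closure_of e)"
proof -
  show eX: "e \<subseteq> topspace X" using X e unfolding CW_structure_def by blast
  have H: "Hausdorff_space X" and c: "continuous_map (disc (d e)) X (\<Phi> e)"
    and h: "homeomorphic_map (subtopology (disc (d e)) (open_disc (d e))) (subtopology X e) (\<Phi> e)"
    using X e unfolding CW_structure_def by blast+
  have "compactin X (\<Phi> e ` topspace (disc (d e)))"
    using compact_space_disc c unfolding compact_space_def by (rule image_compactin)
  moreover have "X closure_of e \<subseteq> \<Phi> e ` topspace (disc (d e))"
  proof (rule closure_of_minimal)
    have "topspace (subtopology X e) = e" using eX by auto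
    then show "e \<subseteq> \<Phi> e ` topspace (disc (d e))"
      using homeomorphic_imp_surjective_map[OF h] by auto
    show "closedin X (\<Phi> e ` topspace (disc (d e)))"
      using H calculation by (rule compactin_imp_closedin)
  qed
  ultimately show "compactin X (X closure_of e)"
    using closed_compactin closedin_closure_of by blast
qed

text \<open>A neighbourhood meeting only finitely many cells lies in the union of their compact
  closures, which gives local compactness. Countably many compact closures cover the space, which
  gives Lindelof.\<close>

lemma locally_finite_countable_CW_lch_Lindelof:
  assumes "locally_finite_countable_CW_space X"
  shows "lch_Lindelof_space X"
proof -
  obtain E d \<Phi> where X: "CW_structure X E d \<Phi>" and E: "countable E" and lf: "locally_finite_in X E"
    using assms unfolding locally_finite_countable_CW_space_def by blast
  note cell = CW_structure_cell[OF X]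
  have cl: "e \<subseteq> X closure_of e" if "e \<in> E" for e using cell(1)[OF that] by (rule closure_of_subset)
  have UE: "\<Union>E = topspace X" using X unfolding CW_structure_def by blast
  have "locally_compact_space X"
    unfolding locally_compact_space_def
  proof
    fix x assume "x \<in> topspace X"
    then obtain V where V: "openin X V" "x \<in> V" "finite {U \<in> E. U \<inter> V \<noteq> {}}"
      using lf unfolding locally_finite_in_def by blast
    let ?K = "\<Union>((closure_of) X ` {U \<in> E. U \<inter> V \<noteq> {}})"
    have "compactin X ?K" using V(3) cell(2) by (intro compactin_Union) auto
    moreover have "V \<subseteq> ?K"
    proof
      fix y assume y: "y \<in> V"
      then have "y \<in> \<Union>E" using V(1) UE openin_subset by blast
      then obtain e where "e \<in> E" "y \<in> e" by blast
      then show "y \<in> ?K" using y cl[of e] by blast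
    qed
    ultimately show "\<exists>U K. openin X U \<and> compactin X K \<and> x \<in> U \<and> U \<subseteq> K" using V(1,2) by blast
  qed
  moreover have "Lindelof_space X"
  proof -
    have "Lindelof_space (subtopology X (\<Union>((closure_of) X ` E)))"
      using E cell(2) compact_imp_Lindelof_space
      by (intro Lindelof_space_Union) (auto simp: compactin_subspace)
    moreover have "\<Union>((closure_of) X ` E) = topspace X"
    proof (rule subset_antisym)
      show "\<Union>((closure_of) X ` E) \<subseteq> topspace X"
        by (intro UN_least closure_of_subset_topspace)
      show "topspace X \<subseteq> \<Union>((closure_of) X ` E)"
        unfolding UE[symmetric] using cl by blast
    qed
    ultimately show ?thesis by simp
  qed
  moreover have "Hausdorff_space X" using X unfolding CW_structure_def by blast
  ultimately show ?thesis by (simp add: lch_Lindelof_space_def)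
qed

text \<open>A subcomplex equals the union of the closures of its cells, and a locally finite union
  of closures is closed.\<close>

lemma locally_finite_countable_CW_pairD:
  assumes "locally_finite_countable_CW_pair X A"
  shows "locally_finite_countable_CW_space X" "closedin X A"
proof -
  obtain E d \<Phi> where X: "CW_structure X E d \<Phi>" and E: "countable E" and lf: "locally_finite_in X E"
    and A: "subcomplex X E A"
    using assms unfolding locally_finite_countable_CW_pair_def by blast
  then show "locally_finite_countable_CW_space X"
    unfolding locally_finite_countable_CW_space_def by blast
  obtain E' where E': "E' \<subseteq> E" "A = \<Union>E'" "\<And>e. e \<in> E' \<Longrightarrow> X closure_of e \<subseteq> A"
    using A unfolding subcomplex_def by blast
  have "closedin X (\<Union>((closure_of) X ` E'))"
    using lf E'(1) by (intro closedin_Union_locally_finite_closure) (rule locally_finite_in_subset)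
  moreover have "\<Union>((closure_of) X ` E') = A"
  proof (intro subset_antisym)
    show "\<Union>((closure_of) X ` E') \<subseteq> A" using E'(3) by blast
    have "e \<subseteq> X closure_of e" if "e \<in> E'" for e
      by (rule closure_of_subset[OF CW_structure_cell(1)[OF X subsetD[OF E'(1) that]]])
    then show "A \<subseteq> \<Union>((closure_of) X ` E')" using E'(2) by blast
  qed
  ultimately show "closedin X A" by simp
qed

section \<open>Families and bundles\<close>

lemma continuous_map_in_topspace:
  "continuous_map X Y f \<Longrightarrow> x \<in> topspace X \<Longrightarrow> f x \<in> topspace Y"
  using continuous_map_image_subset_topspace by blast

text \<open>The chart condition of \<open>F_map\<close> at a single pair of fibres, isolated so that
  it can be carried between families whose points have different types.\<close>

definition fibre_arrow ::
  "('o, 'r, 'v) strcat \<Rightarrow> ('x, 'b, 'o, 'v) family \<Rightarrow> 'b \<Rightarrow> ('y, 'c, 'o, 'v) family \<Rightarrow> 'c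
     \<Rightarrow> ('x \<Rightarrow> 'y) \<Rightarrow> bool" where
  "fibre_arrow \<FF> X b Y c f \<longleftrightarrow>
     (\<exists>\<phi>\<in>Ar \<FF>. Dom \<FF> \<phi> = fib_ob X b \<and> Cod \<FF> \<phi> = fib_ob Y c \<and>
        (\<forall>x\<in>fibre X b. chart Y c (f x) = FMap \<FF> \<phi> (chart X b x)))"

lemma F_map_iff:
  "F_map \<FF> X Y f fb \<longleftrightarrow>
     continuous_map (total_sp X) (total_sp Y) f \<and> continuous_map (base_sp X) (base_sp Y) fb \<and>
     (\<forall>x\<in>topspace (total_sp X). prj Y (f x) = fb (prj X x)) \<and>
     (\<forall>b\<in>topspace (base_sp X). fibre_arrow \<FF> X b Y (fb b) f)"
  by (simp add: F_map_def fibre_arrow_def)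

lemma F_mapD:
  assumes "F_map \<FF> X Y f fb"
  shows "continuous_map (total_sp X) (total_sp Y) f" "continuous_map (base_sp X) (base_sp Y) fb"
    "x \<in> topspace (total_sp X) \<Longrightarrow> prj Y (f x) = fb (prj X x)"
    "b \<in> topspace (base_sp X) \<Longrightarrow> fibre_arrow \<FF> X b Y (fb b) f"
    "x \<in> topspace (total_sp X) \<Longrightarrow> f x \<in> topspace (total_sp Y)"
    "b \<in> topspace (base_sp X) \<Longrightarrow> fb b \<in> topspace (base_sp Y)"
  using assms continuous_map_image_subset_topspace unfolding F_map_iff by blast+

text \<open>The same morphism serves both sides as soon as every point of the new fibre has a
  counterpart with equal chart values. Restrictions, pull-backs and adjunctions only rename points,
  so their chart conditions are obtained this way.\<close>

lemma fibre_arrow_change: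
  assumes "fibre_arrow \<FF> X b Y c f" "fib_ob X' b' = fib_ob X b" "fib_ob Y' c' = fib_ob Y c"
    and "\<And>x'. x' \<in> fibre X' b' \<Longrightarrow> \<exists>x\<in>fibre X b. chart X' b' x' = chart X b x \<and>
           chart Y' c' (f' x') = chart Y c (f x)"
  shows "fibre_arrow \<FF> X' b' Y' c' f'"
proof -
  obtain \<phi> where \<phi>: "\<phi> \<in> Ar \<FF>" "Dom \<FF> \<phi> = fib_ob X b" "Cod \<FF> \<phi> = fib_ob Y c"
    "\<And>x. x \<in> fibre X b \<Longrightarrow> chart Y c (f x) = FMap \<FF> \<phi> (chart X b x)"
    using assms(1) unfolding fibre_arrow_def by auto
  have "chart Y' c' (f' x') = FMap \<FF> \<phi> (chart X' b' x')" if "x' \<in> fibre X' b'" for x'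
    using assms(4)[OF that] \<phi>(4) by auto
  then show ?thesis
    unfolding fibre_arrow_def using \<phi>(1-3) assms(2,3) by (intro bexI[of _ \<phi>]) auto
qed

lemma fibre_arrow_cong:
  assumes "fibre_arrow \<FF> X b Y c f" "\<And>x. x \<in> fibre X b \<Longrightarrow> f' x = f x" "c' = c"
  shows "fibre_arrow \<FF> X b Y c' f'"
  using assms by (intro fibre_arrow_change[OF assms(1)]) auto

text \<open>The functor law holds only on points of the fibre space, so it matters that charts of a
  family take their values there.\<close>

lemma fibre_arrow_compose:
  assumes C: "structure_category \<FF>" and X: "is_family \<FF> X"
    and f: "fibre_arrow \<FF> X b Y c f" and g: "fibre_arrow \<FF> Y c Z d g"
    and fib: "\<And>x. x \<in> fibre X b \<Longrightarrow> f x \<in> fibre Y c"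
  shows "fibre_arrow \<FF> X b Z d (\<lambda>x. g (f x))"
proof -
  obtain \<phi> where \<phi>: "\<phi> \<in> Ar \<FF>" "Dom \<FF> \<phi> = fib_ob X b" "Cod \<FF> \<phi> = fib_ob Y c"
    "\<And>x. x \<in> fibre X b \<Longrightarrow> chart Y c (f x) = FMap \<FF> \<phi> (chart X b x)"
    using f unfolding fibre_arrow_def by auto
  obtain \<psi> where \<psi>: "\<psi> \<in> Ar \<FF>" "Dom \<FF> \<psi> = fib_ob Y c" "Cod \<FF> \<psi> = fib_ob Z d"
    "\<And>y. y \<in> fibre Y c \<Longrightarrow> chart Z d (g y) = FMap \<FF> \<psi> (chart Y c y)"
    using g unfolding fibre_arrow_def by auto
  have small: "small_category \<FF>" and funct: "functor_to_spaces \<FF>"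
    using C by (auto simp: structure_category_def)
  have 1: "Cmp \<FF> \<psi> \<phi> \<in> Ar \<FF> \<and> Dom \<FF> (Cmp \<FF> \<psi> \<phi>) = fib_ob X b \<and> Cod \<FF> (Cmp \<FF> \<psi> \<phi>) = fib_ob Z d"
    using small \<phi>(1-3) \<psi>(1-3) unfolding small_category_def by metis
  have 2: "FMap \<FF> (Cmp \<FF> \<psi> \<phi>) v = FMap \<FF> \<psi> (FMap \<FF> \<phi> v)"
    if "v \<in> topspace (FOb \<FF> (fib_ob X b))" for v
    using funct \<phi>(1-3) \<psi>(1-3) that unfolding functor_to_spaces_def by metis
  have "chart Z d (g (f x)) = FMap \<FF> (Cmp \<FF> \<psi> \<phi>) (chart X b x)" if x: "x \<in> fibre X b" for x
  proof -
    have "chart X b x \<in> topspace (FOb \<FF> (fib_ob X b))"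
      using x chart_in_fibre_space[OF X, of x] by (auto simp: fibre_def)
    then show ?thesis using \<psi>(4)[OF fib[OF x]] \<phi>(4)[OF x] 2 by simp
  qed
  then show ?thesis unfolding fibre_arrow_def using 1 by (intro bexI[of _ "Cmp \<FF> \<psi> \<phi>"]) auto
qed

lemma F_map_compose:
  assumes C: "structure_category \<FF>" and X: "is_family \<FF> X"
    and f: "F_map \<FF> X Y f fb" and g: "F_map \<FF> Y Z g gb"
  shows "F_map \<FF> X Z (\<lambda>x. g (f x)) (\<lambda>b. gb (fb b))"
  unfolding F_map_iff
proof (intro conjI ballI)
  note fD = F_mapD[OF f] and gD = F_mapD[OF g]
  show "continuous_map (total_sp X) (total_sp Z) (\<lambda>x. g (f x))"
    using continuous_map_compose[OF fD(1) gD(1)] by (simp add: o_def)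
  show "continuous_map (base_sp X) (base_sp Z) (\<lambda>b. gb (fb b))"
    using continuous_map_compose[OF fD(2) gD(2)] by (simp add: o_def)
  show "prj Z (g (f x)) = gb (fb (prj X x))" if "x \<in> topspace (total_sp X)" for x
    using fD(3,5) gD(3) that by simp
  show "fibre_arrow \<FF> X b Z (gb (fb b)) (\<lambda>x. g (f x))" if b: "b \<in> topspace (base_sp X)" for b
    by (rule fibre_arrow_compose[OF C X fD(4)[OF b] gD(4)[OF fD(6)[OF b]]])
      (auto simp: fibre_def fD)
qed

lemma F_map_cong:
  assumes f: "F_map \<FF> X Y f fb" and X: "is_family \<FF> X"
    and "\<And>x. x \<in> topspace (total_sp X) \<Longrightarrow> f' x = f x" "\<And>b. b \<in> topspace (base_sp X) \<Longrightarrow> fb' b = fb b"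
  shows "F_map \<FF> X Y f' fb'"
  unfolding F_map_iff
proof (intro conjI ballI)
  note fD = F_mapD[OF f]
  show "continuous_map (total_sp X) (total_sp Y) f'" "continuous_map (base_sp X) (base_sp Y) fb'"
    using fD(1,2) assms(3,4) by (auto intro: continuous_map_eq)
  show "prj Y (f' x) = fb' (prj X x)" if "x \<in> topspace (total_sp X)" for x
    using that fD(3) assms(3,4) prj_in_base[OF X] by simp
  show "fibre_arrow \<FF> X b Y (fb' b) f'" if "b \<in> topspace (base_sp X)" for b
    by (rule fibre_arrow_cong[OF fD(4)[OF that]]) (auto simp: assms(3,4) that fibre_def)
qed

text \<open>Morphisms for the inverse are asked for over points \<open>fb b\<close> only; these
  exhaust the base of \<open>Y\<close> because \<open>fb\<close> is onto. The source enters through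
  its projection alone, so that adjunction families can be treated without first showing them to be
  families.\<close>

lemma F_isoI:
  assumes X: "\<And>x. x \<in> topspace (total_sp X) \<Longrightarrow> prj X x \<in> topspace (base_sp X)" and f: "F_map \<FF> X Y f fb"
    and g: "homeomorphic_maps (total_sp X) (total_sp Y) f g"
    and gb: "homeomorphic_maps (base_sp X) (base_sp Y) fb gb"
    and Y: "\<And>y. y \<in> topspace (total_sp Y) \<Longrightarrow> prj Y y \<in> topspace (base_sp Y)"
    and arr: "\<And>b. b \<in> topspace (base_sp X) \<Longrightarrow> fibre_arrow \<FF> Y (fb b) X b g"
  shows "F_iso \<FF> X Y f fb"
proof -
  have gf: "g (f x) = x" if "x \<in> topspace (total_sp X)" for x
    using g that by (simp add: homeomorphic_maps_def)
  have fg: "f (g y) = y" "g y \<in> topspace (total_sp X)" if "y \<in> topspace (total_sp Y)" for y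
    using g that by (auto simp: homeomorphic_maps_def intro: continuous_map_in_topspace)
  have gfb: "gb (fb b) = b" if "b \<in> topspace (base_sp X)" for b
    using gb that by (simp add: homeomorphic_maps_def)
  have fgb: "fb (gb c) = c" "gb c \<in> topspace (base_sp X)" if "c \<in> topspace (base_sp Y)" for c
    using gb that by (auto simp: homeomorphic_maps_def intro: continuous_map_in_topspace)
  have "F_map \<FF> Y X g gb"
    unfolding F_map_iff
  proof (intro conjI ballI)
    show "continuous_map (total_sp Y) (total_sp X) g" "continuous_map (base_sp Y) (base_sp X) gb"
      using g gb by (auto simp: homeomorphic_maps_def)
    show "prj X (g y) = gb (prj Y y)" if y: "y \<in> topspace (total_sp Y)" for y
      using F_mapD(3)[OF f fg(2)[OF y]] fg[OF y] gfb X by simp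
    show "fibre_arrow \<FF> Y c X (gb c) g" if c: "c \<in> topspace (base_sp Y)" for c
      using arr[OF fgb(2)[OF c]] fgb(1)[OF c] by simp
  qed
  then show ?thesis unfolding F_iso_def using f gf fg gfb fgb by blast
qed

lemma F_isoE:
  assumes "F_iso \<FF> X Y f fb"
  obtains g gb where "F_map \<FF> X Y f fb" "F_map \<FF> Y X g gb"
    "homeomorphic_maps (total_sp X) (total_sp Y) f g"
    "homeomorphic_maps (base_sp X) (base_sp Y) fb gb"
proof -
  obtain g gb where g: "F_map \<FF> X Y f fb" "F_map \<FF> Y X g gb"
    "\<forall>x\<in>topspace (total_sp X). g (f x) = x" "\<forall>y\<in>topspace (total_sp Y). f (g y) = y"
    "\<forall>b\<in>topspace (base_sp X). gb (fb b) = b" "\<forall>c\<in>topspace (base_sp Y). fb (gb c) = c"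
    using assms unfolding F_iso_def by (elim conjE exE)
  show ?thesis
    by (rule that[OF g(1,2)]) (use g F_mapD(1,2)[OF g(1)] F_mapD(1,2)[OF g(2)] in
        \<open>auto simp: homeomorphic_maps_def\<close>)
qed

lemma F_iso_compose:
  assumes C: "structure_category \<FF>" and X: "is_family \<FF> X" and Z: "is_family \<FF> Z"
    and f: "F_iso \<FF> X Y f fb" and g: "F_iso \<FF> Y Z g gb"
  shows "F_iso \<FF> X Z (\<lambda>x. g (f x)) (\<lambda>b. gb (fb b))"
proof -
  obtain f' fb' where f': "F_map \<FF> X Y f fb" "F_map \<FF> Y X f' fb'"
    "homeomorphic_maps (total_sp X) (total_sp Y) f f'" "homeomorphic_maps (base_sp X) (base_sp Y) fb fb'"
    using F_isoE[OF f] .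
  obtain g' gb' where g': "F_map \<FF> Y Z g gb" "F_map \<FF> Z Y g' gb'"
    "homeomorphic_maps (total_sp Y) (total_sp Z) g g'" "homeomorphic_maps (base_sp Y) (base_sp Z) gb gb'"
    using F_isoE[OF g] .
  have hb: "homeomorphic_maps (base_sp X) (base_sp Z) (gb \<circ> fb) (fb' \<circ> gb')"
    by (rule homeomorphic_maps_compose[OF conjI[OF f'(4) g'(4)]])
  note inv = F_map_compose[OF C Z g'(2) f'(2)]
  show ?thesis
  proof (rule F_isoI[OF prj_in_base[OF X] F_map_compose[OF C X f'(1) g'(1)]])
    show "homeomorphic_maps (total_sp X) (total_sp Z) (\<lambda>x. g (f x)) (\<lambda>z. f' (g' z))"
      using homeomorphic_maps_compose[OF conjI[OF f'(3) g'(3)]] by (simp add: o_def)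
    show "homeomorphic_maps (base_sp X) (base_sp Z) (\<lambda>x. gb (fb x)) (\<lambda>z. fb' (gb' z))"
      using hb by (simp add: o_def)
    show "prj Z y \<in> topspace (base_sp Z)" if "y \<in> topspace (total_sp Z)" for y
      using prj_in_base[OF Z that] .
    fix b assume b: "b \<in> topspace (base_sp X)"
    have "gb (fb b) \<in> topspace (base_sp Z)" "fb' (gb' (gb (fb b))) = b"
      using hb b by (auto simp: homeomorphic_maps_def dest: continuous_map_in_topspace)
    then show "fibre_arrow \<FF> Z (gb (fb b)) X b (\<lambda>z. f' (g' z))"
      using F_mapD(4)[OF inv] by metis
  qed
qed

section \<open>Restricted, product and pulled back families\<close>

lemma restrict_family_simps [simp]:
  "total_sp (restrict_family X U) = subtopology (total_sp X) {x \<in> topspace (total_sp X). prj X x \<in> U}"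
  "base_sp (restrict_family X U) = subtopology (base_sp X) U"
  "prj (restrict_family X U) = prj X" "fib_ob (restrict_family X U) = fib_ob X"
  "chart (restrict_family X U) = chart X"
  by (simp_all add: restrict_family_def)

lemma pullback_simps [simp]:
  "total_sp (pullback B fb Y) = subtopology (prod_topology B (total_sp Y)) {(b, y). fb b = prj Y y}"
  "base_sp (pullback B fb Y) = B" "prj (pullback B fb Y) = fst"
  "fib_ob (pullback B fb Y) b = fib_ob Y (fb b)"
  "chart (pullback B fb Y) b z = chart Y (fb b) (snd z)"
  by (simp_all add: pullback_def case_prod_beta)

lemma product_family_simps [simp]:
  "total_sp (product_family \<FF> B V) = prod_topology B (FOb \<FF> V)"
  "base_sp (product_family \<FF> B V) = B" "prj (product_family \<FF> B V) = fst"
  "fib_ob (product_family \<FF> B V) b = V" "chart (product_family \<FF> B V) b = snd"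
  by (simp_all add: product_family_def)

lemma fibre_restrict_family:
  "b \<in> U \<Longrightarrow> fibre (restrict_family X U) b = fibre X b"
  by (auto simp: fibre_def)

lemma is_family_restrict_family:
  assumes X: "is_family \<FF> X"
  shows "is_family \<FF> (restrict_family X U)"
  unfolding is_family_def
proof (intro conjI ballI)
  have "continuous_map (total_sp X) (base_sp X) (prj X)" using X by (simp add: is_family_def)
  then show "continuous_map (total_sp (restrict_family X U)) (base_sp (restrict_family X U))
      (prj (restrict_family X U))"
    by (auto simp: continuous_map_in_subtopology continuous_map_from_subtopology)
  fix b assume "b \<in> topspace (base_sp (restrict_family X U))"
  then have b: "b \<in> topspace (base_sp X)" "b \<in> U" by auto
  then show "fib_ob (restrict_family X U) b \<in> Ob \<FF>" using X by (simp add: is_family_def)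
  have "{x \<in> topspace (total_sp X). prj X x \<in> U} \<inter> fibre X b = fibre X b"
    using b by (auto simp: fibre_def)
  then show "homeomorphic_map (subtopology (total_sp (restrict_family X U)) (fibre (restrict_family X U) b))
      (FOb \<FF> (fib_ob (restrict_family X U) b)) (chart (restrict_family X U) b)"
    using X b by (simp add: is_family_def fibre_restrict_family subtopology_subtopology)
qed

lemma F_map_restrict_family:
  assumes f: "F_map \<FF> X Y f fb" and U: "\<And>b. b \<in> topspace (base_sp X) \<Longrightarrow> b \<in> U \<Longrightarrow> fb b \<in> W"
    and X: "is_family \<FF> X"
  shows "F_map \<FF> (restrict_family X U) (restrict_family Y W) f fb"
  unfolding F_map_iff
proof (intro conjI ballI)
  note fD = F_mapD[OF f]
  show "continuous_map (total_sp (restrict_family X U)) (total_sp (restrict_family Y W)) f"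
    using fD(1,3,5) U prj_in_base[OF X]
    by (auto simp: continuous_map_in_subtopology continuous_map_from_subtopology)
  show "continuous_map (base_sp (restrict_family X U)) (base_sp (restrict_family Y W)) fb"
    using fD(2) U by (auto simp: continuous_map_in_subtopology continuous_map_from_subtopology)
  show "prj (restrict_family Y W) (f x) = fb (prj (restrict_family X U) x)"
    if "x \<in> topspace (total_sp (restrict_family X U))" for x
    using that fD(3) by simp
  show "fibre_arrow \<FF> (restrict_family X U) b (restrict_family Y W) (fb b) f"
    if "b \<in> topspace (base_sp (restrict_family X U))" for b
  proof (rule fibre_arrow_change[OF fD(4)])
    show "b \<in> topspace (base_sp X)" using that by simp
    show "\<exists>x\<in>fibre X b. chart (restrict_family X U) b x' = chart X b x \<and>
        chart (restrict_family Y W) (fb b) (f x') = chart Y (fb b) (f x)"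
      if "x' \<in> fibre (restrict_family X U) b" for x'
      using that by (intro bexI[of _ x']) (auto simp: fibre_def)
  qed simp_all
qed

lemma is_family_product_family:
  assumes V: "V \<in> Ob \<FF>"
  shows "is_family \<FF> (product_family \<FF> B V)"
  unfolding is_family_def
proof (intro conjI ballI)
  show "continuous_map (total_sp (product_family \<FF> B V)) (base_sp (product_family \<FF> B V))
      (prj (product_family \<FF> B V))" by (simp add: continuous_map_fst)
  fix b assume "b \<in> topspace (base_sp (product_family \<FF> B V))"
  then have b: "b \<in> topspace B" by simp
  show "fib_ob (product_family \<FF> B V) b \<in> Ob \<FF>" using V by simp
  have "homeomorphic_maps (subtopology (prod_topology B (FOb \<FF> V)) (fibre (product_family \<FF> B V) b))
      (FOb \<FF> V) snd (\<lambda>v. (b, v))"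
    using b by (auto simp: homeomorphic_maps_def continuous_map_in_subtopology fibre_def
        continuous_map_pairedI continuous_map_from_subtopology continuous_map_snd)
  then show "homeomorphic_map
      (subtopology (total_sp (product_family \<FF> B V)) (fibre (product_family \<FF> B V) b))
      (FOb \<FF> (fib_ob (product_family \<FF> B V) b)) (chart (product_family \<FF> B V) b)"
    using homeomorphic_map_maps by fastforce
qed

lemma is_family_pullback:
  assumes Y: "is_family \<FF> Y" and fb: "continuous_map B (base_sp Y) fb"
  shows "is_family \<FF> (pullback B fb Y)"
  unfolding is_family_def
proof (intro conjI ballI)
  let ?P = "pullback B fb Y"
  show "continuous_map (total_sp ?P) (base_sp ?P) (prj ?P)"
    by (simp add: continuous_map_from_subtopology continuous_map_fst)
  fix b assume "b \<in> topspace (base_sp ?P)"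
  then have b: "b \<in> topspace B" by simp
  then have b': "fb b \<in> topspace (base_sp Y)"
    using fb continuous_map_image_subset_topspace by blast
  then show "fib_ob ?P b \<in> Ob \<FF>" using Y by (simp add: is_family_def)
  have "homeomorphic_maps (subtopology (total_sp ?P) (fibre ?P b))
      (subtopology (total_sp Y) (fibre Y (fb b))) snd (\<lambda>y. (b, y))"
    using b by (auto simp: homeomorphic_maps_def continuous_map_in_subtopology fibre_def
        continuous_map_pairedI continuous_map_from_subtopology continuous_map_snd)
  then have "homeomorphic_map (subtopology (total_sp ?P) (fibre ?P b))
      (subtopology (total_sp Y) (fibre Y (fb b))) snd"
    using homeomorphic_map_maps by blast
  moreover have "homeomorphic_map (subtopology (total_sp Y) (fibre Y (fb b))) (FOb \<FF> (fib_ob Y (fb b)))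
      (chart Y (fb b))"
    using Y b' by (simp add: is_family_def)
  ultimately have "homeomorphic_map (subtopology (total_sp ?P) (fibre ?P b)) (FOb \<FF> (fib_ob Y (fb b)))
      (chart Y (fb b) \<circ> snd)"
    by (rule homeomorphic_map_compose)
  moreover have "chart ?P b = chart Y (fb b) \<circ> snd" by (simp add: fun_eq_iff)
  ultimately show "homeomorphic_map (subtopology (total_sp ?P) (fibre ?P b))
      (FOb \<FF> (fib_ob ?P b)) (chart ?P b)" by simp
qed

text \<open>Functoriality of the fibre product for a commuting square of bases. Over
  \<open>t\<close> the morphism is the one that \<open>h\<close> uses over \<open>g t\<close>, since
  the charts of a pull-back ignore the first coordinate.\<close>

lemma F_map_pullback:
  assumes h: "F_map \<FF> Y Y' h hb" and a: "continuous_map T T' a" and g: "continuous_map T (base_sp Y) g"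
    and comm: "\<And>t. t \<in> topspace T \<Longrightarrow> f (a t) = hb (g t)"
  shows "F_map \<FF> (pullback T g Y) (pullback T' f Y') (\<lambda>(t, y). (a t, h y)) a"
  unfolding F_map_iff
proof (intro conjI ballI)
  note hD = F_mapD[OF h]
  let ?P = "pullback T g Y" and ?P' = "pullback T' f Y'"
  have "continuous_map (prod_topology T (total_sp Y)) (prod_topology T' (total_sp Y')) (\<lambda>(t, y). (a t, h y))"
    unfolding case_prod_beta using a hD(1) by (simp add: continuous_map_paired continuous_map_compose[unfolded o_def, OF continuous_map_fst]
        continuous_map_compose[unfolded o_def, OF continuous_map_snd])
  moreover have "f (a t) = prj Y' (h y)" if "t \<in> topspace T" "y \<in> topspace (total_sp Y)" "g t = prj Y y" for t y
    using that hD(3) comm by simp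
  ultimately show "continuous_map (total_sp ?P) (total_sp ?P') (\<lambda>(t, y). (a t, h y))"
    by (auto simp: continuous_map_in_subtopology continuous_map_from_subtopology)
  show "continuous_map (base_sp ?P) (base_sp ?P') a" using a by simp
  show "prj ?P' ((\<lambda>(t, y). (a t, h y)) x) = a (prj ?P x)" for x by (simp add: case_prod_beta)
  fix t assume "t \<in> topspace (base_sp ?P)"
  then have t: "t \<in> topspace T" by simp
  then have gt: "g t \<in> topspace (base_sp Y)" using g continuous_map_image_subset_topspace by blast
  show "fibre_arrow \<FF> ?P t ?P' (a t) (\<lambda>(t, y). (a t, h y))"
  proof (rule fibre_arrow_change[OF hD(4)[OF gt]])
    show "\<exists>x\<in>fibre Y (g t). chart ?P t x' = chart Y (g t) x \<and>
        chart ?P' (a t) ((\<lambda>(t, y). (a t, h y)) x') = chart Y' (hb (g t)) (h x)"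
      if "x' \<in> fibre ?P t" for x'
      using that t by (intro bexI[of _ "snd x'"]) (auto simp: fibre_def comm)
  qed (simp_all add: comm t)
qed

text \<open>An equality and not just an isomorphism, so later goals can be rewritten with it: both
  total spaces are subspaces of one product on the same points, and \<open>fb b = prj Y y\<close>
  forces the second coordinate to lie over \<open>S'\<close>.\<close>

lemma restrict_family_pullback:
  assumes S: "\<And>b. b \<in> topspace B \<Longrightarrow> b \<in> S \<Longrightarrow> fb b \<in> S'"
  shows "restrict_family (pullback B fb Y) S = pullback (subtopology B S) fb (restrict_family Y S')"
proof -
  let ?E = "{(b, y). fb b = prj Y y}" and ?T = "prod_topology B (total_sp Y)"
  let ?E1 = "?E \<inter> {z \<in> topspace (subtopology ?T ?E). fst z \<in> S}"
  let ?E2 = "S \<times> {y \<in> topspace (total_sp Y). prj Y y \<in> S'} \<inter> ?E"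
  have e1: "total_sp (restrict_family (pullback B fb Y) S) = subtopology ?T ?E1"
    by (simp add: subtopology_subtopology)
  have e2: "total_sp (pullback (subtopology B S) fb (restrict_family Y S')) = subtopology ?T ?E2"
    by (simp add: subtopology_subtopology subtopology_Times[symmetric])
  have "topspace ?T \<inter> ?E1 = topspace ?T \<inter> ?E2"
    using S by (auto; metis)
  then have "subtopology ?T (topspace ?T \<inter> ?E1) = subtopology ?T (topspace ?T \<inter> ?E2)"
    by (rule arg_cong)
  then have "subtopology ?T ?E1 = subtopology ?T ?E2"
    unfolding subtopology_restrict .
  then have "total_sp (restrict_family (pullback B fb Y) S)
      = total_sp (pullback (subtopology B S) fb (restrict_family Y S'))"
    unfolding e1 e2 .
  then show ?thesis by (rule family.equality) (simp_all add: fun_eq_iff)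
qed

text \<open>A trivialisation may cover a self-homeomorphism \<open>ub\<close> of the base other than
  the identity. The pulled back one therefore keeps \<open>t\<close> and takes only the fibre
  coordinate of \<open>u y\<close>, and its inverse feeds \<open>w\<close> with the point
  \<open>ub (g t)\<close> instead of \<open>g t\<close>.\<close>

lemma F_iso_pullback_trivial:
  assumes C: "structure_category \<FF>" and R: "is_family \<FF> R"
    and u: "F_iso \<FF> R (product_family \<FF> (base_sp R) V) u ub" and g: "continuous_map T (base_sp R) g"
  shows "F_iso \<FF> (pullback T g R) (product_family \<FF> T V) (\<lambda>(t, y). (t, snd (u y))) id"
proof -
  let ?Q = "product_family \<FF> (base_sp R) V" and ?P = "pullback T g R"
  obtain w wb where w: "F_map \<FF> R ?Q u ub" "F_map \<FF> ?Q R w wb"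
    "homeomorphic_maps (total_sp R) (total_sp ?Q) u w" "homeomorphic_maps (base_sp R) (base_sp ?Q) ub wb"
    using F_isoE[OF u] .
  note uD = F_mapD[OF w(1)] and wD = F_mapD[OF w(2)]
  have gT: "g t \<in> topspace (base_sp R)" if "t \<in> topspace T" for t
    using g that continuous_map_image_subset_topspace by blast
  have wub: "wb (ub b) = b" "ub b \<in> topspace (base_sp R)" if "b \<in> topspace (base_sp R)" for b
    using w(4) uD(6) that by (auto simp: homeomorphic_maps_def)
  have wu: "w (u y) = y" "fst (u y) = ub (prj R y)" if "y \<in> topspace (total_sp R)" for y
    using w(3) uD(3) that by (auto simp: homeomorphic_maps_def)
  have uw: "u (w z) = z" if "z \<in> topspace (total_sp ?Q)" for z
    using w(3) that unfolding homeomorphic_maps_def by blast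
  let ?u = "\<lambda>(t, y). (t, snd (u y))" and ?w = "\<lambda>(t, v). (t, w (ub (g t), v))"
  have c1: "continuous_map (total_sp ?P) (prod_topology T (FOb \<FF> V)) ?u"
  proof -
    have "continuous_map (prod_topology T (total_sp R)) (FOb \<FF> V) (snd \<circ> (u \<circ> snd))"
      using uD(1) by (intro continuous_map_compose[OF continuous_map_compose[OF continuous_map_snd]])
        (auto simp: continuous_map_snd)
    then have "continuous_map (prod_topology T (total_sp R)) (prod_topology T (FOb \<FF> V)) ?u"
      unfolding case_prod_beta by (simp add: continuous_map_paired continuous_map_fst o_def)
    then show ?thesis by (simp add: continuous_map_from_subtopology)
  qed
  have c2: "continuous_map (prod_topology T (FOb \<FF> V)) (total_sp ?P) ?w"
  proof -
    have "continuous_map (prod_topology T (FOb \<FF> V)) (base_sp R) (ub \<circ> (g \<circ> fst))"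
      using uD(2) g by (intro continuous_map_compose[OF continuous_map_compose[OF continuous_map_fst]]) auto
    then have "continuous_map (prod_topology T (FOb \<FF> V)) (total_sp ?Q) (\<lambda>z. (ub (g (fst z)), snd z))"
      by (simp add: continuous_map_paired continuous_map_snd o_def)
    then have "continuous_map (prod_topology T (FOb \<FF> V)) (total_sp R) (w \<circ> (\<lambda>z. (ub (g (fst z)), snd z)))"
      using wD(1) by (rule continuous_map_compose)
    then have "continuous_map (prod_topology T (FOb \<FF> V)) (prod_topology T (total_sp R)) ?w"
      unfolding case_prod_beta by (simp add: continuous_map_paired continuous_map_fst o_def)
    moreover have "g t = prj R (w (ub (g t), v))" if "t \<in> topspace T" "v \<in> topspace (FOb \<FF> V)" for t v
      using wD(3)[of "(ub (g t), v)"] wub[OF gT[OF that(1)]] that by simp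
    ultimately show ?thesis by (auto simp: continuous_map_in_subtopology)
  qed
  have "F_map \<FF> ?P (product_family \<FF> T V) ?u id"
    unfolding F_map_iff
  proof (intro conjI ballI)
    show "continuous_map (total_sp ?P) (total_sp (product_family \<FF> T V)) ?u" using c1 by simp
    show "prj (product_family \<FF> T V) (?u x) = id (prj ?P x)" for x by (simp add: case_prod_beta)
    fix t assume "t \<in> topspace (base_sp ?P)"
    then have t: "t \<in> topspace T" by simp
    show "fibre_arrow \<FF> ?P t (product_family \<FF> T V) (id t) ?u"
    proof (rule fibre_arrow_change[OF uD(4)[OF gT[OF t]]])
      show "\<exists>x\<in>fibre R (g t). chart ?P t x' = chart R (g t) x \<and>
          chart (product_family \<FF> T V) (id t) (?u x') = chart ?Q (ub (g t)) (u x)"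
        if "x' \<in> fibre ?P t" for x'
        using that by (intro bexI[of _ "snd x'"]) (auto simp: fibre_def)
    qed simp_all
  qed simp
  moreover have "homeomorphic_maps (total_sp ?P) (total_sp (product_family \<FF> T V)) ?u ?w"
  proof -
    have "w (ub (g t), snd (u y)) = y" if "t \<in> topspace T" "y \<in> topspace (total_sp R)" "g t = prj R y" for t y
      using that wu[OF that(2)] by (metis prod.collapse)
    moreover have "snd (u (w (ub (g t), v))) = v" if "t \<in> topspace T" "v \<in> topspace (FOb \<FF> V)" for t v
      using uw[of "(ub (g t), v)"] that wub(2)[OF gT] by simp
    ultimately show ?thesis using c1 c2 by (auto simp: homeomorphic_maps_def)
  qed
  moreover have "homeomorphic_maps (base_sp ?P) (base_sp (product_family \<FF> T V)) id id"
    by (simp add: homeomorphic_maps_def)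
  moreover have "fibre_arrow \<FF> (product_family \<FF> T V) (id t) ?P t ?w" if "t \<in> topspace (base_sp ?P)" for t
  proof -
    have t: "t \<in> topspace T" using that by simp
    note b = wub[OF gT[OF t]]
    show ?thesis
    proof (rule fibre_arrow_change[OF wD(4), of "ub (g t)"])
      show "ub (g t) \<in> topspace (base_sp ?Q)" using b by simp
      show "\<exists>x\<in>fibre ?Q (ub (g t)). chart (product_family \<FF> T V) (id t) x' = chart ?Q (ub (g t)) x \<and>
          chart ?P t (?w x') = chart R (wb (ub (g t))) (w x)"
        if "x' \<in> fibre (product_family \<FF> T V) (id t)" for x'
        using that b by (intro bexI[of _ "(ub (g t), snd x')"]) (auto simp: fibre_def)
    qed (use b in simp_all)
  qed
  ultimately show ?thesis
    by (intro F_isoI[OF prj_in_base[OF is_family_pullback[OF R g]]]) auto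
qed

section \<open>Bundles: pull-back, replacement of the total space, topology of the total
  space\<close>

lemma F_bundle_pullback:
  assumes C: "structure_category \<FF>" and Y: "F_bundle \<FF> Y" and g: "continuous_map B (base_sp Y) g"
  shows "F_bundle \<FF> (pullback B g Y)"
  unfolding F_bundle_def
proof (intro conjI ballI)
  have famY: "is_family \<FF> Y" using Y by (simp add: F_bundle_def)
  then show "is_family \<FF> (pullback B g Y)" using g by (rule is_family_pullback)
  fix b assume "b \<in> topspace (base_sp (pullback B g Y))"
  then have b: "b \<in> topspace B" by simp
  then have "g b \<in> topspace (base_sp Y)" using g continuous_map_image_subset_topspace by blast
  then obtain U V u ub where U: "openin (base_sp Y) U" "g b \<in> U" and V: "V \<in> Ob \<FF>"
    and u: "F_iso \<FF> (restrict_family Y U) (product_family \<FF> (subtopology (base_sp Y) U) V) u ub"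
    using Y unfolding F_bundle_def by blast
  define W where "W = {t \<in> topspace B. g t \<in> U}"
  have "openin B W" unfolding W_def using g U(1) by (rule openin_continuous_map_preimage)
  moreover have "F_iso \<FF> (restrict_family (pullback B g Y) W)
      (product_family \<FF> (subtopology B W) V) (\<lambda>(t, y). (t, snd (u y))) id"
  proof -
    have eq: "restrict_family (pullback B g Y) W = pullback (subtopology B W) g (restrict_family Y U)"
      by (rule restrict_family_pullback) (simp add: W_def)
    have "continuous_map (subtopology B W) (base_sp (restrict_family Y U)) g"
      using g by (auto simp: continuous_map_in_subtopology continuous_map_from_subtopology W_def)
    then show ?thesis unfolding eq
      using u by (intro F_iso_pullback_trivial[OF C is_family_restrict_family[OF famY]]) auto
  qed
  ultimately show "\<exists>U. openin (base_sp (pullback B g Y)) U \<and> b \<in> U \<and>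
      (\<exists>V\<in>Ob \<FF>. \<exists>f fb. F_iso \<FF> (restrict_family (pullback B g Y) U)
        (product_family \<FF> (subtopology (base_sp (pullback B g Y)) U) V) f fb)"
    using b U(2) V unfolding pullback_simps by (intro exI[of _ W]) (auto simp: W_def)
qed

text \<open>Lets a pulled back bundle be replaced by an isomorphic family whose points have the type
  that stratified bundles prescribe.\<close>

lemma F_bundle_iso:
  assumes C: "structure_category \<FF>" and X: "is_family \<FF> X" and Y: "F_bundle \<FF> Y"
    and base: "base_sp X = base_sp Y" and u: "F_iso \<FF> X Y u id"
  shows "F_bundle \<FF> X"
  unfolding F_bundle_def
proof (intro conjI ballI X)
  have famY: "is_family \<FF> Y" using Y by (simp add: F_bundle_def)
  fix b assume "b \<in> topspace (base_sp X)"
  then obtain U V v vb where U: "openin (base_sp Y) U" "b \<in> U" and V: "V \<in> Ob \<FF>"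
    and v: "F_iso \<FF> (restrict_family Y U) (product_family \<FF> (subtopology (base_sp Y) U) V) v vb"
    using Y base unfolding F_bundle_def by metis
  obtain w wb where w: "F_map \<FF> X Y u id" "F_map \<FF> Y X w wb"
    "homeomorphic_maps (total_sp X) (total_sp Y) u w" "homeomorphic_maps (base_sp X) (base_sp Y) id wb"
    using F_isoE[OF u] .
  have wb: "wb c = c" if "c \<in> topspace (base_sp Y)" for c
    using w(4) that by (simp add: homeomorphic_maps_def)
  have 1: "F_map \<FF> (restrict_family X U) (restrict_family Y U) u id"
    by (rule F_map_restrict_family[OF w(1) _ X]) simp
  have 2: "F_map \<FF> (restrict_family Y U) (restrict_family X U) w wb"
    by (rule F_map_restrict_family[OF w(2) _ famY]) (simp add: wb)
  have "F_iso \<FF> (restrict_family X U) (restrict_family Y U) u id"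
    unfolding F_iso_def
    by (intro conjI 1 exI[of _ w] exI[of _ wb] 2)
      (use w(3) wb base in \<open>auto simp: homeomorphic_maps_def\<close>)
  then have "F_iso \<FF> (restrict_family X U) (product_family \<FF> (subtopology (base_sp X) U) V)
      (\<lambda>x. v (u x)) (\<lambda>b. vb (id b))"
    using v unfolding base
    by (rule F_iso_compose[OF C is_family_restrict_family[OF X] is_family_product_family[OF V]])
  then show "\<exists>U. openin (base_sp X) U \<and> b \<in> U \<and> (\<exists>V\<in>Ob \<FF>. \<exists>f fb.
      F_iso \<FF> (restrict_family X U) (product_family \<FF> (subtopology (base_sp X) U) V) f fb)"
    using U V base by metis
qed

text \<open>Here the topological conditions on the fibre spaces are used. Local compactness is read
  off in a trivialisation. Points over different base points are separated from below, points of one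
  fibre inside a trivialisation. For Lindelof the total space is covered by countably many compact
  sets.\<close>

lemma F_bundle_total_lch_Lindelof:
  assumes C: "structure_category \<FF>" and X: "F_bundle \<FF> X" and B: "lch_Lindelof_space (base_sp X)"
  shows "lch_Lindelof_space (total_sp X)"
proof -
  let ?T = "total_sp X" and ?B = "base_sp X"
  have fam: "is_family \<FF> X" using X by (simp add: F_bundle_def)
  have p: "continuous_map ?T ?B (prj X)" using fam by (simp add: is_family_def)
  have lcB: "locally_compact_space ?B" and hB: "Hausdorff_space ?B" and LB: "Lindelof_space ?B"
    using B by (simp_all add: lch_Lindelof_space_def)
  have loc: "\<exists>U V u w ub. openin ?B U \<and> b \<in> U \<and> V \<in> Ob \<FF> \<and>
      homeomorphic_maps (subtopology ?T {x \<in> topspace ?T. prj X x \<in> U})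
        (prod_topology (subtopology ?B U) (FOb \<FF> V)) u w \<and>
      continuous_map (subtopology ?B U) (subtopology ?B U) ub \<and>
      (\<forall>x\<in>topspace ?T. prj X x \<in> U \<longrightarrow> fst (u x) = ub (prj X x))"
    if "b \<in> topspace ?B" for b
  proof -
    obtain U V u ub where U: "openin ?B U" "b \<in> U" and V: "V \<in> Ob \<FF>"
      and u: "F_iso \<FF> (restrict_family X U) (product_family \<FF> (subtopology ?B U) V) u ub"
      using X \<open>b \<in> topspace ?B\<close> unfolding F_bundle_def by blast
    obtain w wb where w: "F_map \<FF> (restrict_family X U) (product_family \<FF> (subtopology ?B U) V) u ub"
      "homeomorphic_maps (total_sp (restrict_family X U))
        (total_sp (product_family \<FF> (subtopology ?B U) V)) u w"
      by (rule F_isoE[OF u])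
    show ?thesis
      using U V w(2) F_mapD(2,3)[OF w(1)]
      by (intro exI[of _ U] exI[of _ V] exI[of _ u] exI[of _ w] exI[of _ ub]) auto
  qed
  have V: "locally_compact_space (FOb \<FF> V)" "Hausdorff_space (FOb \<FF> V)" "Lindelof_space (FOb \<FF> V)"
    if "V \<in> Ob \<FF>" for V
    using C that by (auto simp: structure_category_def second_countable_imp_Lindelof_space)
  \<comment> \<open>The neighbourhood contains the whole fibre through \<open>x\<close>, so it also
    contains any second point that has to be separated from \<open>x\<close> in that fibre.\<close>
  have nbhd: "\<exists>W. openin ?T W \<and> x \<in> W \<and> {y \<in> topspace ?T. prj X y = prj X x} \<subseteq> W \<and>
      locally_compact_space (subtopology ?T W) \<and> Hausdorff_space (subtopology ?T W)"
    if x: "x \<in> topspace ?T" for x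
  proof -
    obtain U V u w where U: "openin ?B U" "prj X x \<in> U" "V \<in> Ob \<FF>"
      and u: "homeomorphic_maps (subtopology ?T {x \<in> topspace ?T. prj X x \<in> U})
        (prod_topology (subtopology ?B U) (FOb \<FF> V)) u w"
      using loc[OF prj_in_base[OF fam x]] by (elim exE conjE) (rule that)
    let ?W = "{x \<in> topspace ?T. prj X x \<in> U}"
    have hs: "subtopology ?T ?W homeomorphic_space prod_topology (subtopology ?B U) (FOb \<FF> V)"
      using u unfolding homeomorphic_space_def by blast
    have "locally_compact_space (subtopology ?B U)"
      using hB lcB U(1) locally_compact_space_open_subset by blast
    then have "locally_compact_space (subtopology ?T ?W)"
      using V(1)[OF U(3)] by (simp add: homeomorphic_locally_compact_space[OF hs] locally_compact_space_prod_topology)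
    moreover have "Hausdorff_space (subtopology ?T ?W)"
      using V(2)[OF U(3)] hB
      by (simp add: homeomorphic_Hausdorff_space[OF hs] Hausdorff_space_prod_topology Hausdorff_space_subtopology)
    moreover have "openin ?T ?W" using p U(1) by (rule openin_continuous_map_preimage)
    ultimately show ?thesis using x U(2) by (intro exI[of _ ?W]) auto
  qed
  have "Hausdorff_space ?T"
    unfolding Hausdorff_space_def
  proof (intro allI impI, elim conjE)
    fix x y assume xy: "x \<in> topspace ?T" "y \<in> topspace ?T" "x \<noteq> y"
    show "\<exists>U V. openin ?T U \<and> openin ?T V \<and> x \<in> U \<and> y \<in> V \<and> disjnt U V"
    proof (cases "prj X x = prj X y")
      case False
      then obtain U V where UV: "openin ?B U" "openin ?B V" "prj X x \<in> U" "prj X y \<in> V" "disjnt U V"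
        using hB prj_in_base[OF fam xy(1)] prj_in_base[OF fam xy(2)] unfolding Hausdorff_space_def by metis
      then show ?thesis
        using xy openin_continuous_map_preimage[OF p UV(1)] openin_continuous_map_preimage[OF p UV(2)]
        by (intro exI[of _ "{z \<in> topspace ?T. prj X z \<in> U}"] exI[of _ "{z \<in> topspace ?T. prj X z \<in> V}"])
          (auto simp: disjnt_iff)
    next
      case True
      obtain W where W: "openin ?T W" "x \<in> W" "{z \<in> topspace ?T. prj X z = prj X x} \<subseteq> W"
        "Hausdorff_space (subtopology ?T W)"
        using nbhd[OF xy(1)] by (elim exE conjE) (rule that)
      have "x \<in> topspace (subtopology ?T W)" "y \<in> topspace (subtopology ?T W)" using W(2,3) xy True by auto
      then obtain U V where UV: "openin (subtopology ?T W) U" "openin (subtopology ?T W) V"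
        "x \<in> U" "y \<in> V" "disjnt U V"
        using W(4) xy(3) unfolding Hausdorff_space_def by metis
      then show ?thesis using openin_trans_full[OF _ W(1)] by metis
    qed
  qed
  moreover have "locally_compact_space ?T"
    unfolding locally_compact_space_def
  proof
    fix x assume x: "x \<in> topspace ?T"
    obtain W where W: "openin ?T W" "x \<in> W" "locally_compact_space (subtopology ?T W)"
      using nbhd[OF x] by (elim exE conjE) (rule that)
    have "x \<in> topspace (subtopology ?T W)" using W(2) x by simp
    then obtain U K where "openin (subtopology ?T W) U" "compactin (subtopology ?T W) K" "x \<in> U" "U \<subseteq> K"
      using W(3) unfolding locally_compact_space_def by metis
    then show "\<exists>U K. openin ?T U \<and> compactin ?T K \<and> x \<in> U \<and> U \<subseteq> K"
      using openin_trans_full[OF _ W(1)] by (metis compactin_subtopology)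
  qed
  moreover have "Lindelof_space ?T"
  proof -
    \<comment> \<open>The compact sets are images of boxes: a compact hull \<open>N\<close> of
      \<open>W\<close> in the base, moved by \<open>ub\<close>, times the members of a compact
      exhaustion \<open>L\<close> of the fibre space.\<close>
    have cover: "\<exists>W \<K>. openin ?B W \<and> b \<in> W \<and> countable \<K> \<and> (\<forall>K\<in>\<K>. compactin ?T K) \<and>
        {x \<in> topspace ?T. prj X x \<in> W} \<subseteq> \<Union>\<K>" if b: "b \<in> topspace ?B" for b
    proof -
      obtain U V u w ub where U: "openin ?B U" "b \<in> U" "V \<in> Ob \<FF>"
        and u: "homeomorphic_maps (subtopology ?T {x \<in> topspace ?T. prj X x \<in> U})
          (prod_topology (subtopology ?B U) (FOb \<FF> V)) u w"
        and ub: "continuous_map (subtopology ?B U) (subtopology ?B U) ub"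
          "\<forall>x\<in>topspace ?T. prj X x \<in> U \<longrightarrow> fst (u x) = ub (prj X x)"
        using loc[OF b] by (elim exE conjE) (rule that)
      have "locally_compact_space (subtopology ?B U)" "b \<in> topspace (subtopology ?B U)"
        using hB lcB U(1,2) b locally_compact_space_open_subset by auto
      then obtain W N where W: "openin (subtopology ?B U) W" "compactin (subtopology ?B U) N" "b \<in> W" "W \<subseteq> N"
        unfolding locally_compact_space_def by metis
      obtain L where L: "k_omega (FOb \<FF> V) L"
        using locally_compact_Lindelof_imp_k_omega[OF V(2,1,3)[OF U(3)]] .
      note LD = k_omegaD[OF L]
      have cw: "continuous_map (prod_topology (subtopology ?B U) (FOb \<FF> V)) ?T w"
        using u by (auto simp: homeomorphic_maps_def continuous_map_in_subtopology)
      have "compactin ?T (w ` (ub ` N \<times> L n))" for n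
      proof (rule image_compactin[OF _ cw])
        show "compactin (prod_topology (subtopology ?B U) (FOb \<FF> V)) (ub ` N \<times> L n)"
          using image_compactin[OF W(2) ub(1)] LD(1) by (simp only: compactin_Times) simp
      qed
      moreover have "{x \<in> topspace ?T. prj X x \<in> W} \<subseteq> (\<Union>n. w ` (ub ` N \<times> L n))"
      proof
        fix x assume "x \<in> {x \<in> topspace ?T. prj X x \<in> W}"
        then have x: "x \<in> topspace ?T" "prj X x \<in> W" by auto
        have xU: "prj X x \<in> U" using x(2) openin_subset[OF W(1)] by auto
        have "u x \<in> topspace (prod_topology (subtopology ?B U) (FOb \<FF> V))"
          by (rule continuous_map_in_topspace[of "subtopology ?T {x \<in> topspace ?T. prj X x \<in> U}"])
            (use u x xU in \<open>auto simp: homeomorphic_maps_def\<close>)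
        then have "snd (u x) \<in> (\<Union>n. L n)" unfolding LD(4) by auto
        then obtain n where "snd (u x) \<in> L n" by blast
        moreover have "fst (u x) \<in> ub ` N" using ub(2) x xU W(4) by auto
        moreover have "x = w (u x)" using u x xU by (auto simp: homeomorphic_maps_def)
        ultimately show "x \<in> (\<Union>n. w ` (ub ` N \<times> L n))"
          by (intro UN_I[of n] image_eqI[of _ _ "u x"]) (auto simp: mem_Times_iff)
      qed
      moreover have "openin ?B W" using W(1) U(1) by (rule openin_trans_full)
      ultimately show ?thesis using W(3)
        by (intro exI[of _ W] exI[of _ "range (\<lambda>n. w ` (ub ` N \<times> L n))"]) auto
    qed
    define good where "good W \<K> \<longleftrightarrow> countable \<K> \<and> (\<forall>K\<in>\<K>. compactin ?T K) \<and>
        {x \<in> topspace ?T. prj X x \<in> W} \<subseteq> \<Union>\<K>" for W \<K>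
    let ?\<U> = "{W. openin ?B W \<and> (\<exists>\<K>. good W \<K>)}"
    have U: "\<Union>?\<U> = topspace ?B"
    proof (intro equalityI subsetI)
      fix b assume "b \<in> \<Union>?\<U>"
      then obtain W where "openin ?B W" "b \<in> W" by blast
      then show "b \<in> topspace ?B" using openin_subset by blast
    next
      fix b assume "b \<in> topspace ?B"
      then show "b \<in> \<Union>?\<U>" using cover[of b] unfolding good_def by blast
    qed
    have "\<exists>\<V>. countable \<V> \<and> \<V> \<subseteq> ?\<U> \<and> \<Union>\<V> = topspace ?B"
      by (rule Lindelof_spaceD[OF LB _ U]) simp
    then obtain \<V> where V: "countable \<V>" "\<V> \<subseteq> ?\<U>" "\<Union>\<V> = topspace ?B"
      by (elim exE conjE)
    have "\<forall>W\<in>\<V>. \<exists>\<K>. good W \<K>" using V(2) by blast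
    then obtain \<K> where "\<forall>W\<in>\<V>. good W (\<K> W)" by (rule bchoice[THEN exE])
    then have WK: "good W (\<K> W)" if "W \<in> \<V>" for W using that by (rule bspec)
    let ?\<K> = "\<Union>W\<in>\<V>. \<K> W"
    have K: "countable ?\<K>"
      by (intro countable_UN V(1)) (use WK in \<open>simp add: good_def\<close>)
    have K': "compactin ?T K" if "K \<in> ?\<K>" for K
      using that WK unfolding good_def by (elim UN_E) simp
    have "Lindelof_space (subtopology ?T (\<Union>?\<K>))"
    proof (rule Lindelof_space_Union[OF K])
      show "Lindelof_space (subtopology ?T K)" if "K \<in> ?\<K>" for K
        using K'[OF that] by (simp add: compactin_subspace compact_imp_Lindelof_space)
    qed
    moreover have "\<Union>?\<K> = topspace ?T"
    proof (intro equalityI subsetI)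
      fix x assume "x \<in> \<Union>?\<K>"
      then obtain K where KK: "K \<in> ?\<K>" "x \<in> K" by (rule UnionE)
      show "x \<in> topspace ?T" by (rule subsetD[OF compactin_subset_topspace[OF K'[OF KK(1)]] KK(2)])
    next
      fix x assume x: "x \<in> topspace ?T"
      then have "prj X x \<in> \<Union>\<V>" unfolding V(3) by (rule prj_in_base[OF fam])
      then obtain W where W: "W \<in> \<V>" "prj X x \<in> W" by blast
      then have "x \<in> \<Union>(\<K> W)" using WK[OF W(1)] x unfolding good_def by auto
      then show "x \<in> \<Union>?\<K>" using W(1) by blast
    qed
    ultimately show ?thesis by simp
  qed
  ultimately show ?thesis by (simp add: lch_Lindelof_space_def)
qed

section \<open>Push-outs of fibre products\<close>

text \<open>The comparison map from the adjunction space is a continuous bijection by the other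
  assumptions. The topological content sits in \<open>closed\<close>, which makes it a closed map
  and hence a homeomorphism.\<close>

lemma is_pushoutI:
  assumes hA: "h ` (topspace M \<inter> A) \<subseteq> topspace X"
    and id: "continuous_map X Z id" and k: "continuous_map M Z k"
    and glue: "\<And>m. m \<in> topspace M \<Longrightarrow> m \<in> A \<Longrightarrow> k m = h m"
    and sur: "\<And>z. z \<in> topspace Z \<Longrightarrow> z \<notin> topspace X \<Longrightarrow> z \<in> k ` topspace M"
    and inj: "\<And>m. m \<in> topspace M \<Longrightarrow> m \<notin> A \<Longrightarrow> k m \<notin> topspace X"
      "\<And>m n. m \<in> topspace M \<Longrightarrow> m \<notin> A \<Longrightarrow> n \<in> topspace M \<Longrightarrow> n \<notin> A \<Longrightarrow> k n = k m \<Longrightarrow> n = m"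
    and closed: "\<And>C. C \<subseteq> topspace Z \<Longrightarrow> closedin X (topspace X \<inter> C) \<Longrightarrow>
      closedin M {m \<in> topspace M. k m \<in> C} \<Longrightarrow> closedin Z C"
  shows "is_pushout X M A h Z id k"
proof -
  let ?P = "adjunction_space X M A h"
  note top = topspace_adjunction_space[OF hA]
  have c: "continuous_map ?P Z (case_sum id k)"
    by (rule adjunction_space_universal[OF hA id k]) (simp add: glue)
  have "homeomorphic_map ?P Z (case_sum id k)"
  proof (rule bijective_closed_imp_homeomorphic_map[OF c])
    show "case_sum id k ` topspace ?P = topspace Z"
    proof (intro equalityI subsetI)
      fix z assume "z \<in> case_sum id k ` topspace ?P"
      then show "z \<in> topspace Z" using continuous_map_in_topspace[OF c] by blast
    next
      fix z assume z: "z \<in> topspace Z"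
      show "z \<in> case_sum id k ` topspace ?P"
      proof (cases "z \<in> topspace X")
        case True
        then show ?thesis unfolding top by (intro image_eqI[of _ _ "Inl z"]) auto
      next
        case False
        then obtain m where m: "m \<in> topspace M" "z = k m" using sur[OF z] by blast
        then have "m \<notin> A" using False glue hA by auto
        then show ?thesis unfolding top using m by (intro image_eqI[of _ _ "Inr m"]) auto
      qed
    qed
    show "inj_on (case_sum id k) (topspace ?P)"
      unfolding top by (rule inj_onI) (auto dest: inj)
    show "closed_map ?P Z (case_sum id k)"
      unfolding closed_map_def
    proof (intro allI impI)
      fix D assume D: "closedin ?P D"
      let ?C = "case_sum id k ` D"
      have Dt: "D \<subseteq> Inl ` topspace X \<union> Inr ` (topspace M - A)"
        and DX: "closedin X {x \<in> topspace X. Inl x \<in> D}"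
        and DM: "closedin M {m \<in> topspace M. adj_map A h m \<in> D}"
        using D unfolding closedin_adjunction_space[OF hA] by auto
      have injP: "u \<in> D" if "case_sum id k u \<in> ?C" "u \<in> Inl ` topspace X \<union> Inr ` (topspace M - A)" for u
        using that Dt \<open>inj_on (case_sum id k) (topspace ?P)\<close> unfolding top by (auto dest: inj_onD)
      show "closedin Z ?C"
      proof (rule closed)
        show "?C \<subseteq> topspace Z" using Dt continuous_map_in_topspace[OF c] unfolding top by blast
        have "topspace X \<inter> ?C = {x \<in> topspace X. Inl x \<in> D}"
        proof (intro equalityI subsetI)
          fix x assume "x \<in> topspace X \<inter> ?C"
          then show "x \<in> {x \<in> topspace X. Inl x \<in> D}" using injP[of "Inl x"] by auto
        next
          fix x assume "x \<in> {x \<in> topspace X. Inl x \<in> D}"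
          then show "x \<in> topspace X \<inter> ?C" by (auto intro: image_eqI[of _ _ "Inl x"])
        qed
        then show "closedin X (topspace X \<inter> ?C)" using DX by simp
        have q: "case_sum id k (adj_map A h m) = k m" if "m \<in> topspace M" for m
          using that by (simp add: adj_map_def glue)
        have qt: "adj_map A h m \<in> Inl ` topspace X \<union> Inr ` (topspace M - A)" if "m \<in> topspace M" for m
          using that hA by (auto simp: adj_map_def)
        have "{m \<in> topspace M. k m \<in> ?C} = {m \<in> topspace M. adj_map A h m \<in> D}"
        proof (intro equalityI subsetI)
          fix m assume m: "m \<in> {m \<in> topspace M. k m \<in> ?C}"
          then show "m \<in> {m \<in> topspace M. adj_map A h m \<in> D}"
            using injP[of "adj_map A h m"] q[of m] qt[of m] by simp
        next
          fix m assume m: "m \<in> {m \<in> topspace M. adj_map A h m \<in> D}"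
          then show "m \<in> {m \<in> topspace M. k m \<in> ?C}"
            using q[of m] by (auto intro: image_eqI[of _ _ "adj_map A h m"])
        qed
        then show "closedin M {m \<in> topspace M. k m \<in> ?C}" using DM by simp
      qed
    qed
  qed
  then show ?thesis by (simp add: is_pushout_def glue)
qed

text \<open>Allows the attached total space to be exchanged for a homeomorphic copy on another
  type.\<close>

lemma is_pushout_precompose:
  assumes po: "is_pushout X M A h Z id k" and hA: "h ` (topspace M \<inter> A) \<subseteq> topspace X"
    and w: "homeomorphic_map N M w"
  shows "is_pushout X N {n \<in> topspace N. w n \<in> A} (\<lambda>n. h (w n)) Z id (\<lambda>n. k (w n))"
proof (rule is_pushoutI)
  note PO = pushout_continuous_inclusion[OF po hA] pushout_continuous_chr[OF po hA]
  have cw: "continuous_map N M w" using w by (rule homeomorphic_imp_continuous_map)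
  have im: "w ` topspace N = topspace M" using w by (rule homeomorphic_imp_surjective_map)
  have wN: "w n \<in> topspace M" if "n \<in> topspace N" for n using im that by blast
  show "(\<lambda>n. h (w n)) ` (topspace N \<inter> {n \<in> topspace N. w n \<in> A}) \<subseteq> topspace X"
    using hA wN by auto
  show "continuous_map X Z id" by (rule PO)
  show "continuous_map N Z (\<lambda>n. k (w n))" using continuous_map_compose[OF cw PO(2)] by (simp add: o_def)
  show "k (w n) = h (w n)" if "n \<in> topspace N" "n \<in> {n \<in> topspace N. w n \<in> A}" for n
    using that pushout_glue[OF po hA wN] by simp
  show "z \<in> (\<lambda>n. k (w n)) ` topspace N" if z: "z \<in> topspace Z" "z \<notin> topspace X" for z
  proof -
    obtain m where "m \<in> topspace M" "z = k m" using z pushout_topspace[OF po hA] by auto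
    moreover from this(1) obtain n where "n \<in> topspace N" "m = w n" unfolding im[symmetric] by blast
    ultimately show ?thesis by blast
  qed
  show "k (w n) \<notin> topspace X" if "n \<in> topspace N" "n \<notin> {n \<in> topspace N. w n \<in> A}" for n
    using that pushout_inj(1)[OF po hA wN] by simp
  show "n = m" if "m \<in> topspace N" "m \<notin> {n \<in> topspace N. w n \<in> A}" "n \<in> topspace N"
    "k (w n) = k (w m)" for m n
  proof -
    have "w n = w m" using that pushout_inj(2)[OF po hA wN[of m] _ wN[of n]] by auto
    then show "n = m" using homeomorphic_imp_injective_map[OF w] that by (auto dest: inj_onD)
  qed
  fix C assume C: "C \<subseteq> topspace Z" "closedin X (topspace X \<inter> C)" "closedin N {n \<in> topspace N. k (w n) \<in> C}"
  have "w ` {n \<in> topspace N. k (w n) \<in> C} = {m \<in> topspace M. k m \<in> C}" unfolding im[symmetric] by auto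
  then have "closedin M {m \<in> topspace M. k m \<in> C}"
    using C(3) homeomorphic_map_closedness_eq[OF w] by metis
  then show "closedin Z C" unfolding pushout_closedin[OF po hA] using C by blast
qed

text \<open>Normality is carried along because it passes to adjunctions by Tietze extension and
  supplies the shrinking step in \<open>k_omega_prod_topology\<close>.\<close>

definition k_omega_normal_space :: "'a topology \<Rightarrow> bool" where
  "k_omega_normal_space X \<longleftrightarrow> normal_space X \<and> Hausdorff_space X \<and> (\<exists>K. k_omega X K)"

lemma lch_Lindelof_imp_k_omega_normal: "lch_Lindelof_space X \<Longrightarrow> k_omega_normal_space X"
  unfolding k_omega_normal_space_def
  using lch_Lindelof_space_imp_normal locally_compact_Lindelof_imp_k_omega
  by (metis lch_Lindelof_space_def)

lemma pushout_k_omega_normal: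
  assumes "is_pushout X M A h Z id k" "continuous_map (subtopology M A) X h" "closedin M A"
    and X: "k_omega_normal_space X" and M: "k_omega_normal_space M"
  shows "k_omega_normal_space Z"
proof -
  note hA = attaching_image[OF assms(2)]
  obtain K L where "k_omega X K" "k_omega M L" using X M unfolding k_omega_normal_space_def by blast
  moreover have "normal_space Z" "Hausdorff_space Z"
    using pushout_normal_t1[OF assms(1) hA assms(2,3)] X M unfolding k_omega_normal_space_def by blast+
  ultimately show ?thesis
    using pushout_k_omega[OF assms(1) hA] X M unfolding k_omega_normal_space_def by blast
qed

text \<open>Injectivity of the structure maps off \<open>A\<close> and \<open>A'\<close>, together with stratum preservation, confines
  the part of a compact box not coming from \<open>X\<close> to the image of a compact box of \<open>M \<times> TM\<close>.\<close>

lemma is_pushout_fibre_product: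
  fixes X :: "'b topology" and M :: "'m topology" and X' :: "'c topology" and M' :: "'n topology"
    and TX :: "'x topology" and TM :: "'e topology"
    and f :: "'b \<Rightarrow> 'c" and g :: "'m \<Rightarrow> 'n" and q :: "'x \<Rightarrow> 'c" and p :: "'e \<Rightarrow> 'n"
    and Z :: "'b topology" and TZ :: "'x topology"
  defines "PX \<equiv> subtopology (prod_topology X TX) {(b, y). f b = q y}"
    and "PM \<equiv> subtopology (prod_topology M TM) {(m, e). g m = p e}"
    and "PZ \<equiv> subtopology (prod_topology Z TZ) {(b, y). f b = q y}"
  assumes base: "is_pushout X M A a Z id c" and aA: "a ` (topspace M \<inter> A) \<subseteq> topspace X"
    and base': "is_pushout X' M' A' a' Z' id c'" and aA': "a' ` (topspace M' \<inter> A') \<subseteq> topspace X'"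
    and tot: "is_pushout TX TM AT h TZ id k" and hA: "h ` (topspace TM \<inter> AT) \<subseteq> topspace TX"
    and AT: "AT = {e \<in> topspace TM. p e \<in> A'}"
    and p: "continuous_map TM M' p" and q: "continuous_map TZ Z' q"
    and qX: "\<And>y. y \<in> topspace TX \<Longrightarrow> q y \<in> topspace X'"
    and qk: "\<And>e. e \<in> topspace TM \<Longrightarrow> q (k e) = c' (p e)"
    and f: "continuous_map Z Z' f" and g: "continuous_map M M' g"
    and fX: "\<And>x. x \<in> topspace X \<Longrightarrow> f x \<in> topspace X'"
    and strat: "\<And>z. z \<in> topspace Z \<Longrightarrow> z \<notin> topspace X \<Longrightarrow> f z \<notin> topspace X'"
    and gA: "\<And>m. m \<in> topspace M \<Longrightarrow> g m \<in> A' \<longleftrightarrow> m \<in> A"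
    and fc: "\<And>m. m \<in> topspace M \<Longrightarrow> f (c m) = c' (g m)"
    and sub: "X = subtopology Z (topspace X)" "TX = subtopology TZ (topspace TX)"
    and clo: "closedin Z (topspace X)" "closedin TZ (topspace TX)"
    and H: "Hausdorff_space M'" "Hausdorff_space Z'"
    and ko: "k_omega_normal_space X" "k_omega_normal_space M" "k_omega_normal_space Z"
      "k_omega_normal_space TX" "k_omega_normal_space TM" "k_omega_normal_space TZ"
  shows "is_pushout PX PM {z \<in> topspace PM. fst z \<in> A} (\<lambda>z. (a (fst z), h (snd z))) PZ id
    (\<lambda>z. (c (fst z), k (snd z)))"
proof -
  let ?k = "\<lambda>z. (c (fst z), k (snd z))" and ?ZE = "prod_topology Z TZ"
  note cc = pushout_continuous_chr[OF base aA] and ck = pushout_continuous_chr[OF tot hA]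
  note topZ = pushout_topspace[OF base aA] and topE = pushout_topspace[OF tot hA]
  note injc = pushout_inj[OF base aA] and injk = pushout_inj[OF tot hA] and injc' = pushout_inj[OF base' aA']
  have glue_c: "c m = a m" if "m \<in> topspace M" "m \<in> A" for m using pushout_glue[OF base aA] that .
  have glue_k: "k e = h e" if "e \<in> topspace TM" "e \<in> AT" for e using pushout_glue[OF tot hA] that .
  have tPX: "z \<in> topspace PX \<longleftrightarrow> fst z \<in> topspace X \<and> snd z \<in> topspace TX \<and> f (fst z) = q (snd z)" for z
    by (cases z) (auto simp: PX_def)
  have tPM: "z \<in> topspace PM \<longleftrightarrow> fst z \<in> topspace M \<and> snd z \<in> topspace TM \<and> g (fst z) = p (snd z)" for z
    by (cases z) (auto simp: PM_def)
  have tPZ: "z \<in> topspace PZ \<longleftrightarrow> fst z \<in> topspace Z \<and> snd z \<in> topspace TZ \<and> f (fst z) = q (snd z)" for z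
    by (cases z) (auto simp: PZ_def)
  have gM: "g m \<in> topspace M'" if "m \<in> topspace M" for m using g that by (rule continuous_map_in_topspace)
  have cM: "c m \<in> topspace Z" if "m \<in> topspace M" for m using cc that by (rule continuous_map_in_topspace)
  have kE: "k e \<in> topspace TZ" if "e \<in> topspace TM" for e using ck that by (rule continuous_map_in_topspace)
  have pE: "p e \<in> topspace M'" if "e \<in> topspace TM" for e using p that by (rule continuous_map_in_topspace)
  \<comment> \<open>On the fibre product \<open>p (snd z) = g (fst z)\<close>, so being glued in the
    total space and being glued in the base coincide.\<close>
  have AM: "snd z \<in> AT \<longleftrightarrow> fst z \<in> A" if "z \<in> topspace PM" for z
    using that gA[of "fst z"] unfolding AT by (auto simp: tPM)
  \<comment> \<open>Converse to \<open>qX\<close>. It holds because \<open>AT\<close> is the full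
    preimage of \<open>A'\<close>: a point \<open>k e\<close> off \<open>TX\<close> has
    \<open>p e\<close> off \<open>A'\<close> and so projects outside \<open>X'\<close>.\<close>
  have qX': "y \<in> topspace TX" if yZ: "y \<in> topspace TZ" "q y \<in> topspace X'" for y
  proof (rule ccontr)
    assume y: "y \<notin> topspace TX"
    then obtain e where e: "e \<in> topspace TM" "y = k e" using yZ(1) y topE by auto
    then have "e \<notin> AT" using y glue_k[of e] hA by auto
    then have "c' (p e) \<notin> topspace X'" using injc'(1)[OF pE[OF e(1)]] e(1) by (simp add: AT)
    then show False using qk[OF e(1)] e(2) yZ(2) by simp
  qed
  have k_PZ: "?k z \<in> topspace PZ" if "z \<in> topspace PM" for z
    using that cM kE fc qk by (simp add: tPM tPZ)
  have h_PX: "(a (fst z), h (snd z)) \<in> topspace PX \<and> ?k z = (a (fst z), h (snd z))"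
    if z: "z \<in> topspace PM" "fst z \<in> A" for z
  proof -
    have "?k z = (a (fst z), h (snd z))"
      using glue_c[of "fst z"] glue_k[of "snd z"] z AM[OF z(1)] by (simp add: tPM)
    moreover have "a (fst z) \<in> topspace X" "h (snd z) \<in> topspace TX"
      using aA hA z AM[OF z(1)] by (auto simp: tPM)
    moreover have "f (c (fst z)) = q (k (snd z))" using k_PZ[OF z(1)] by (simp add: tPZ)
    ultimately show ?thesis by (simp add: tPX)
  qed
  have ckk: "continuous_map (prod_topology M TM) ?ZE ?k"
    using continuous_map_compose[OF continuous_map_fst cc, of TM] continuous_map_compose[OF continuous_map_snd ck, of M]
    by (simp add: continuous_map_paired o_def)
  have iX: "continuous_map X Z id" and iE: "continuous_map TX TZ id"
    using pushout_continuous_inclusion[OF base aA] pushout_continuous_inclusion[OF tot hA] by blast+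
  \<comment> \<open>Stratum preservation at work. The first coordinate of \<open>z\<close> is new by
    \<open>qX'\<close>, so \<open>f\<close> sends it outside \<open>X'\<close>, so the second
    coordinate is new as well. Both have preimages \<open>m\<close> and \<open>e\<close>, and
    injectivity of \<open>c'\<close> off \<open>A'\<close> forces \<open>p e = g m\<close>, which
    puts \<open>(m, e)\<close> into the fibre product.\<close>
  have sur: "z \<in> ?k ` topspace PM" if z: "z \<in> topspace PZ" "z \<notin> topspace PX" for z
  proof -
    have zX: "fst z \<notin> topspace X"
    proof
      assume x: "fst z \<in> topspace X"
      then have "q (snd z) \<in> topspace X'" using fX[OF x] z(1) by (simp add: tPZ)
      then have "snd z \<in> topspace TX" using qX' z(1) by (simp add: tPZ)
      then show False using x z by (simp add: tPX tPZ)
    qed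
    obtain m where m: "m \<in> topspace M" "fst z = c m" using z(1) zX topZ by (auto simp: tPZ)
    have mA: "m \<notin> A" using m zX glue_c[OF m(1)] aA by auto
    have "f (fst z) \<notin> topspace X'" using strat[OF _ zX] z(1) by (simp add: tPZ)
    then have "snd z \<notin> topspace TX" using qX z(1) by (auto simp: tPZ)
    then obtain e where e: "e \<in> topspace TM" "snd z = k e" using z(1) topE by (auto simp: tPZ)
    have "c' (p e) = c' (g m)" using fc[OF m(1)] qk[OF e(1)] m(2) e(2) z(1) by (simp add: tPZ)
    then have "p e = g m" using injc'(2)[OF gM[OF m(1)] _ pE[OF e(1)]] gA[OF m(1)] mA by simp
    then have "(m, e) \<in> topspace PM" using m(1) e(1) by (simp add: tPM)
    moreover have "z = ?k (m, e)" using m(2) e(2) by (simp add: prod_eq_iff)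
    ultimately show ?thesis by blast
  qed
  show ?thesis
  proof (rule is_pushoutI)
    show "(\<lambda>z. (a (fst z), h (snd z))) ` (topspace PM \<inter> {z \<in> topspace PM. fst z \<in> A}) \<subseteq> topspace PX"
      using h_PX by blast
    show "continuous_map PX PZ id"
    proof -
      have "continuous_map (prod_topology X TX) ?ZE (\<lambda>z. (id (fst z), id (snd z)))"
        unfolding continuous_map_paired
        using continuous_map_compose[OF continuous_map_fst iX, of TX]
          continuous_map_compose[OF continuous_map_snd iE, of X]
        by (simp add: o_def)
      then have "continuous_map (prod_topology X TX) ?ZE id" by (simp add: id_def)
      then show ?thesis unfolding PX_def PZ_def
        by (auto simp: continuous_map_in_subtopology continuous_map_from_subtopology)
    qed
    show "continuous_map PM PZ ?k"
      unfolding PZ_def continuous_map_in_subtopology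
    proof
      show "continuous_map PM ?ZE ?k" unfolding PM_def using ckk by (rule continuous_map_from_subtopology)
      show "?k \<in> topspace PM \<rightarrow> {(b, y). f b = q y}" using k_PZ by (auto simp: tPZ)
    qed
    show "?k z = (a (fst z), h (snd z))" if "z \<in> topspace PM" "z \<in> {z \<in> topspace PM. fst z \<in> A}" for z
      using h_PX[of z] that by simp
    show "z \<in> ?k ` topspace PM" if "z \<in> topspace PZ" "z \<notin> topspace PX" for z
      using sur that .
    show "?k z \<notin> topspace PX" if "z \<in> topspace PM" "z \<notin> {z \<in> topspace PM. fst z \<in> A}" for z
      using that injc(1)[of "fst z"] by (simp add: tPX tPM)
    show "z' = z" if "z \<in> topspace PM" "z \<notin> {z \<in> topspace PM. fst z \<in> A}"
      "z' \<in> topspace PM" "?k z' = ?k z" for z z'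
      using that injc(2)[of "fst z" "fst z'"] injk(2)[of "snd z" "snd z'"] AM[of z]
      by (simp add: tPM prod_eq_iff)
    fix C assume C: "C \<subseteq> topspace PZ" "closedin PX (topspace PX \<inter> C)"
      "closedin PM {z \<in> topspace PM. ?k z \<in> C}"
    define DX where "DX = topspace PX \<inter> C"
    define DM where "DM = {z \<in> topspace PM. ?k z \<in> C}"
    \<comment> \<open>Closedness is moved from the fibre products to the full products, where the
      exhaustion by boxes lives. \<open>PX\<close> is closed in \<open>?ZE\<close>: \<open>X\<close>
      and \<open>TX\<close> are closed in \<open>Z\<close> and \<open>TZ\<close>, and the equation
      \<open>f b = q y\<close> is closed because \<open>Z'\<close> is Hausdorff.\<close>
    have cZE: "closedin ?ZE DX"
    proof -
      let ?S = "{z \<in> topspace ?ZE. f (fst z) = q (snd z)}"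
      have "closedin ?ZE (topspace X \<times> topspace TX)"
        using clo by (simp add: closedin_prod_Times_iff)
      moreover have "closedin ?ZE ?S"
        using continuous_map_compose[OF continuous_map_fst f, of TZ]
          continuous_map_compose[OF continuous_map_snd q, of Z]
        by (intro closedin_continuous_maps_eq[OF H(2)]) (simp_all add: o_def)
      ultimately have "closedin ?ZE ((topspace X \<times> topspace TX) \<inter> ?S)" by (rule closedin_Int)
      moreover have "PX = subtopology ?ZE ((topspace X \<times> topspace TX) \<inter> ?S)"
      proof -
        have "prod_topology X TX = subtopology ?ZE (topspace X \<times> topspace TX)"
          using sub by (metis subtopology_Times)
        then have "PX = subtopology ?ZE ((topspace X \<times> topspace TX) \<inter> {(b, y). f b = q y})"
          unfolding PX_def by (simp add: subtopology_subtopology)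
        moreover have "topspace ?ZE \<inter> ((topspace X \<times> topspace TX) \<inter> {(b, y). f b = q y})
            = (topspace X \<times> topspace TX) \<inter> ?S"
          by auto
        ultimately show ?thesis by (metis subtopology_restrict)
      qed
      moreover have "closedin PX DX" using C(2) unfolding DX_def .
      ultimately show ?thesis by (simp only: closedin_trans_full)
    qed
    have cME: "closedin (prod_topology M TM) DM"
    proof -
      have "closedin (prod_topology M TM) {z \<in> topspace (prod_topology M TM). g (fst z) = p (snd z)}"
        using continuous_map_compose[OF continuous_map_fst g, of TM]
          continuous_map_compose[OF continuous_map_snd p, of M]
        by (intro closedin_continuous_maps_eq[OF H(1)]) (simp_all add: o_def)
      then have "closedin (prod_topology M TM) D"
        if "closedin (subtopology (prod_topology M TM) {z \<in> topspace (prod_topology M TM). g (fst z) = p (snd z)}) D"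
        for D using that by (rule closedin_trans_full[rotated])
      moreover have "PM = subtopology (prod_topology M TM)
          {z \<in> topspace (prod_topology M TM). g (fst z) = p (snd z)}"
      proof -
        have "topspace (prod_topology M TM) \<inter> {(m, e). g m = p e}
            = {z \<in> topspace (prod_topology M TM). g (fst z) = p (snd z)}" by auto
        then show ?thesis unfolding PM_def by (metis subtopology_restrict)
      qed
      moreover have "closedin PM DM" using C(3) unfolding DM_def .
      ultimately show ?thesis by simp
    qed
    have C_eq: "C = DX \<union> ?k ` DM"
    proof (intro equalityI subsetI)
      fix z assume z: "z \<in> C"
      then have zP: "z \<in> topspace PZ" using C(1) by blast
      show "z \<in> DX \<union> ?k ` DM"
      proof (cases "z \<in> topspace PX")
        case False
        then obtain u where u: "u \<in> topspace PM" "z = ?k u" using sur zP by blast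
        then have "u \<in> DM" unfolding DM_def using z by blast
        then show ?thesis using u(2) by blast
      qed (use z in \<open>simp add: DX_def\<close>)
    next
      fix z assume "z \<in> DX \<union> ?k ` DM"
      then show "z \<in> C" unfolding DX_def DM_def by blast
    qed
    obtain K L where K: "k_omega X K" and L: "k_omega M L" using ko(1,2) unfolding k_omega_normal_space_def by blast
    obtain K' L' where K': "k_omega TX K'" and L': "k_omega TM L'" using ko(4,5) unfolding k_omega_normal_space_def by blast
    have nH: "normal_space Z" "Hausdorff_space Z" "normal_space TZ" "Hausdorff_space TZ"
      "Hausdorff_space X" "Hausdorff_space M" "Hausdorff_space TX" "Hausdorff_space TM"
      using ko unfolding k_omega_normal_space_def by blast+
    let ?Q = "\<lambda>n. K n \<union> c ` L n" and ?Q' = "\<lambda>n. K' n \<union> k ` L' n"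
    have Q: "k_omega Z ?Q" by (rule pushout_k_omega[OF base aA K nH(5) L nH(6) nH(2)])
    have Q': "k_omega TZ ?Q'" by (rule pushout_k_omega[OF tot hA K' nH(7) L' nH(8) nH(4)])
    have QQ: "k_omega ?ZE (\<lambda>n. ?Q n \<times> ?Q' n)"
      by (rule k_omega_prod_topology[OF Q nH(1,2) Q' nH(3,4)])
    have HZE: "Hausdorff_space ?ZE" using nH(2,4) by (simp add: Hausdorff_space_prod_topology)
    \<comment> \<open>On one box the first part of the decomposition is closed outright; the second
      is the image of a compact set, so no closedness of \<open>?k\<close> itself is
      required.\<close>
    have "closedin ?ZE (C \<inter> ?Q n \<times> ?Q' n)" for n
    proof -
      have cQ: "closedin ?ZE (?Q n \<times> ?Q' n)"
        by (rule compactin_imp_closedin[OF HZE k_omegaD(1)[OF QQ]])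
      have "C \<inter> ?Q n \<times> ?Q' n = DX \<inter> ?Q n \<times> ?Q' n \<union> ?k ` (DM \<inter> L n \<times> L' n)"
      proof (intro equalityI subsetI)
        fix z assume z: "z \<in> C \<inter> ?Q n \<times> ?Q' n"
        show "z \<in> DX \<inter> ?Q n \<times> ?Q' n \<union> ?k ` (DM \<inter> L n \<times> L' n)"
        proof (cases "z \<in> DX")
          case False
          then obtain u where u: "u \<in> DM" "z = ?k u" using z C_eq by blast
          have uP: "u \<in> topspace PM" using u(1) by (simp add: DM_def)
          have uA: "fst u \<notin> A"
          proof
            assume "fst u \<in> A"
            then have "z \<in> topspace PX" using h_PX[OF uP] u(2) by simp
            then show False using False z by (simp add: DX_def)
          qed
          have M: "fst u \<in> topspace M" "snd u \<in> topspace TM" using uP by (simp_all add: tPM)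
          have uE: "snd u \<notin> AT" using AM[OF uP] uA by simp
          have "c (fst u) \<in> ?Q n" "k (snd u) \<in> ?Q' n" using z u(2) by auto
          moreover have "c (fst u) \<notin> K n" using injc(1)[OF M(1) uA] k_omegaD(2)[OF K] by blast
          moreover have "k (snd u) \<notin> K' n" using injk(1)[OF M(2) uE] k_omegaD(2)[OF K'] by blast
          ultimately obtain l l' where l: "l \<in> L n" "c (fst u) = c l" "l' \<in> L' n" "k (snd u) = k l'" by blast
          have "l = fst u"
            using injc(2)[OF M(1) uA, of l] l(1,2) k_omegaD(2)[OF L, of n] by auto
          moreover have "l' = snd u"
            using injk(2)[OF M(2) uE, of l'] l(3,4) k_omegaD(2)[OF L', of n] by auto
          ultimately have "u \<in> L n \<times> L' n" using l(1,3) by (simp add: mem_Times_iff)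
          then show ?thesis using u by blast
        qed (use z in blast)
      next
        fix z assume "z \<in> DX \<inter> ?Q n \<times> ?Q' n \<union> ?k ` (DM \<inter> L n \<times> L' n)"
        then show "z \<in> C \<inter> ?Q n \<times> ?Q' n" unfolding C_eq by (elim UnE imageE) auto
      qed
      moreover have "closedin ?ZE (DX \<inter> ?Q n \<times> ?Q' n)" using cZE cQ by (rule closedin_Int)
      moreover have "closedin ?ZE (?k ` (DM \<inter> L n \<times> L' n))"
      proof -
        have "compactin (prod_topology M TM) (DM \<inter> L n \<times> L' n)"
          using cME by (rule closed_Int_compactin) (simp add: compactin_Times k_omegaD(1)[OF L] k_omegaD(1)[OF L'])
        then show ?thesis using compactin_imp_closedin[OF HZE image_compactin[OF _ ckk]] by blast
      qed
      ultimately show ?thesis by (simp only: closedin_Un)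
    qed
    moreover have "C \<subseteq> topspace ?ZE" using C(1) unfolding PZ_def by auto
    ultimately have "closedin ?ZE C" by (rule k_omegaD(5)[OF QQ, rotated])
    moreover have "C \<subseteq> {(b, y). f b = q y}" using C(1) unfolding PZ_def by auto
    ultimately show "closedin PZ C" unfolding PZ_def by (rule closedin_subset_topspace)
  qed
qed

section \<open>Push-outs of families\<close>

text \<open>The chart condition for an inverse of \<open>f\<close> on one fibre, written with
  \<open>f\<close> itself: the morphism runs against \<open>f\<close>. It can be checked on the two
  pieces of an adjunction without describing the inverse map.\<close>

definition fibre_coarrow ::
  "('o, 'r, 'v) strcat \<Rightarrow> ('x, 'b, 'o, 'v) family \<Rightarrow> 'b \<Rightarrow> ('y, 'c, 'o, 'v) family \<Rightarrow> 'c
     \<Rightarrow> ('x \<Rightarrow> 'y) \<Rightarrow> bool" where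
  "fibre_coarrow \<FF> X b Y c f \<longleftrightarrow>
     (\<exists>\<phi>\<in>Ar \<FF>. Dom \<FF> \<phi> = fib_ob Y c \<and> Cod \<FF> \<phi> = fib_ob X b \<and>
        (\<forall>x\<in>fibre X b. chart X b x = FMap \<FF> \<phi> (chart Y c (f x))))"

lemma fibre_coarrow_change:
  assumes "fibre_coarrow \<FF> X b Y c f" "fib_ob X' b' = fib_ob X b" "fib_ob Y' c' = fib_ob Y c"
    and "\<And>x'. x' \<in> fibre X' b' \<Longrightarrow> \<exists>x\<in>fibre X b. chart X' b' x' = chart X b x \<and>
           chart Y' c' (f' x') = chart Y c (f x)"
  shows "fibre_coarrow \<FF> X' b' Y' c' f'"
proof -
  obtain \<phi> where \<phi>: "\<phi> \<in> Ar \<FF>" "Dom \<FF> \<phi> = fib_ob Y c" "Cod \<FF> \<phi> = fib_ob X b"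
    "\<And>x. x \<in> fibre X b \<Longrightarrow> chart X b x = FMap \<FF> \<phi> (chart Y c (f x))"
    using assms(1) unfolding fibre_coarrow_def by auto
  have "chart X' b' x' = FMap \<FF> \<phi> (chart Y' c' (f' x'))" if "x' \<in> fibre X' b'" for x'
    using assms(4)[OF that] \<phi>(4) by auto
  then show ?thesis
    unfolding fibre_coarrow_def using \<phi>(1-3) assms(2,3) by (intro bexI[of _ \<phi>]) auto
qed

lemma fibre_coarrow_compose:
  assumes C: "structure_category \<FF>" and Z: "is_family \<FF> Z"
    and f: "fibre_coarrow \<FF> X b Y c f" and g: "fibre_coarrow \<FF> Y c Z d g"
    and fib: "\<And>x. x \<in> fibre X b \<Longrightarrow> f x \<in> fibre Y c" "\<And>y. y \<in> fibre Y c \<Longrightarrow> g y \<in> fibre Z d"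
  shows "fibre_coarrow \<FF> X b Z d (\<lambda>x. g (f x))"
proof -
  obtain \<phi> where \<phi>: "\<phi> \<in> Ar \<FF>" "Dom \<FF> \<phi> = fib_ob Y c" "Cod \<FF> \<phi> = fib_ob X b"
    "\<And>x. x \<in> fibre X b \<Longrightarrow> chart X b x = FMap \<FF> \<phi> (chart Y c (f x))"
    using f unfolding fibre_coarrow_def by auto
  obtain \<psi> where \<psi>: "\<psi> \<in> Ar \<FF>" "Dom \<FF> \<psi> = fib_ob Z d" "Cod \<FF> \<psi> = fib_ob Y c"
    "\<And>y. y \<in> fibre Y c \<Longrightarrow> chart Y c y = FMap \<FF> \<psi> (chart Z d (g y))"
    using g unfolding fibre_coarrow_def by auto
  have small: "small_category \<FF>" and funct: "functor_to_spaces \<FF>"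
    using C by (auto simp: structure_category_def)
  have 1: "Cmp \<FF> \<phi> \<psi> \<in> Ar \<FF> \<and> Dom \<FF> (Cmp \<FF> \<phi> \<psi>) = fib_ob Z d \<and> Cod \<FF> (Cmp \<FF> \<phi> \<psi>) = fib_ob X b"
    using small \<phi>(1-3) \<psi>(1-3) unfolding small_category_def by metis
  have 2: "FMap \<FF> (Cmp \<FF> \<phi> \<psi>) v = FMap \<FF> \<phi> (FMap \<FF> \<psi> v)"
    if "v \<in> topspace (FOb \<FF> (fib_ob Z d))" for v
    using funct \<phi>(1-3) \<psi>(1-3) that unfolding functor_to_spaces_def by metis
  have "chart X b x = FMap \<FF> (Cmp \<FF> \<phi> \<psi>) (chart Z d (g (f x)))" if x: "x \<in> fibre X b" for x
  proof -
    have "g (f x) \<in> fibre Z d" using fib x by blast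
    then have "chart Z d (g (f x)) \<in> topspace (FOb \<FF> (fib_ob Z d))"
      using chart_in_fibre_space[OF Z, of "g (f x)"] by (auto simp: fibre_def)
    then show ?thesis using \<psi>(4)[OF fib(1)[OF x]] \<phi>(4)[OF x] 2 by simp
  qed
  then show ?thesis unfolding fibre_coarrow_def using 1 by (intro bexI[of _ "Cmp \<FF> \<phi> \<psi>"]) auto
qed

lemma F_iso_fibre_coarrow:
  assumes "F_iso \<FF> X Y f fb" and b: "b \<in> topspace (base_sp X)"
  shows "fibre_coarrow \<FF> X b Y (fb b) f"
proof -
  obtain g gb where f: "F_map \<FF> X Y f fb" and g: "F_map \<FF> Y X g gb"
    and m: "homeomorphic_maps (total_sp X) (total_sp Y) f g" "homeomorphic_maps (base_sp X) (base_sp Y) fb gb"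
    by (rule F_isoE[OF assms(1)])
  have gb: "gb (fb b) = b" using m(2) b by (simp add: homeomorphic_maps_def)
  obtain \<phi> where \<phi>: "\<phi> \<in> Ar \<FF>" "Dom \<FF> \<phi> = fib_ob Y (fb b)" "Cod \<FF> \<phi> = fib_ob X b"
    "\<And>y. y \<in> fibre Y (fb b) \<Longrightarrow> chart X b (g y) = FMap \<FF> \<phi> (chart Y (fb b) y)"
    using F_mapD(4)[OF g F_mapD(6)[OF f b]] unfolding gb fibre_arrow_def by auto
  have "chart X b x = FMap \<FF> \<phi> (chart Y (fb b) (f x))" if x: "x \<in> fibre X b" for x
  proof -
    have "f x \<in> fibre Y (fb b)" "g (f x) = x"
      using x F_mapD(3,5)[OF f] m(1) by (auto simp: fibre_def homeomorphic_maps_def)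
    then show ?thesis using \<phi>(4)[of "f x"] by simp
  qed
  then show ?thesis unfolding fibre_coarrow_def using \<phi>(1-3) by (intro bexI[of _ \<phi>]) auto
qed

text \<open>Since \<open>fb\<close> is injective, the inverse \<open>g\<close> sends the fibre over
  \<open>fb b\<close> into the fibre over \<open>b\<close>; evaluating the coarrow at
  \<open>g y\<close> then gives the morphism that \<open>g\<close> needs.\<close>

lemma F_isoI_coarrow:
  assumes X: "\<And>x. x \<in> topspace (total_sp X) \<Longrightarrow> prj X x \<in> topspace (base_sp X)"
    and f: "F_map \<FF> X Y f fb"
    and hf: "homeomorphic_map (total_sp X) (total_sp Y) f" and hb: "homeomorphic_map (base_sp X) (base_sp Y) fb"
    and Y: "\<And>y. y \<in> topspace (total_sp Y) \<Longrightarrow> prj Y y \<in> topspace (base_sp Y)"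
    and arr: "\<And>b. b \<in> topspace (base_sp X) \<Longrightarrow> fibre_coarrow \<FF> X b Y (fb b) f"
  shows "F_iso \<FF> X Y f fb"
proof -
  obtain g where g: "homeomorphic_maps (total_sp X) (total_sp Y) f g"
    using hf unfolding homeomorphic_map_maps by blast
  obtain gb where gb: "homeomorphic_maps (base_sp X) (base_sp Y) fb gb"
    using hb unfolding homeomorphic_map_maps by blast
  have "fibre_arrow \<FF> Y (fb b) X b g" if b: "b \<in> topspace (base_sp X)" for b
  proof -
    obtain \<phi> where \<phi>: "\<phi> \<in> Ar \<FF>" "Dom \<FF> \<phi> = fib_ob Y (fb b)" "Cod \<FF> \<phi> = fib_ob X b"
      "\<And>x. x \<in> fibre X b \<Longrightarrow> chart X b x = FMap \<FF> \<phi> (chart Y (fb b) (f x))"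
      using arr[OF b] unfolding fibre_coarrow_def by auto
    have "chart X b (g y) = FMap \<FF> \<phi> (chart Y (fb b) y)" if "y \<in> fibre Y (fb b)" for y
    proof -
      have y: "y \<in> topspace (total_sp Y)" "prj Y y = fb b" using that by (auto simp: fibre_def)
      have gy: "f (g y) = y" "g y \<in> topspace (total_sp X)"
        using g y(1) by (auto simp: homeomorphic_maps_def intro: continuous_map_in_topspace)
      have "fb (prj X (g y)) = fb b" using F_mapD(3)[OF f gy(2)] gy(1) y(2) by simp
      then have "prj X (g y) = b"
        using homeomorphic_imp_injective_map[OF hb] X[OF gy(2)] b by (auto dest: inj_onD)
      then have "g y \<in> fibre X b" using gy(2) by (simp add: fibre_def)
      then show ?thesis using \<phi>(4) gy(1) by metis
    qed
    then show ?thesis unfolding fibre_arrow_def using \<phi>(1-3) by (intro bexI[of _ \<phi>]) auto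
  qed
  then show ?thesis by (intro F_isoI[OF X f g gb Y])
qed

text \<open>The inverse base map agrees with \<open>id\<close> only on the base space, so it is
  exchanged for \<open>id\<close> by congruence.\<close>

lemma F_iso_sym_id:
  assumes f: "F_iso \<FF> X Y f id" and Y: "is_family \<FF> Y"
  obtains w where "F_iso \<FF> Y X w id"
proof -
  obtain g gb where F: "F_map \<FF> X Y f id" "F_map \<FF> Y X g gb"
    and m: "homeomorphic_maps (total_sp X) (total_sp Y) f g" "homeomorphic_maps (base_sp X) (base_sp Y) id gb"
    by (rule F_isoE[OF f])
  have gb: "gb c = c" "c \<in> topspace (base_sp X)" if "c \<in> topspace (base_sp Y)" for c
    using m(2) that by (auto simp: homeomorphic_maps_def dest: continuous_map_in_topspace)
  have "F_map \<FF> Y X g id" by (rule F_map_cong[OF F(2) Y]) (simp_all add: gb)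
  then have "F_iso \<FF> Y X g id"
    unfolding F_iso_def using F(1) m by (intro conjI exI[of _ f] exI[of _ id]) (auto simp: homeomorphic_maps_def)
  then show ?thesis by (rule that)
qed

section \<open>Adjunction families, and push-outs of families in terms of push-outs of
  spaces\<close>

lemma adjunction_family_simps [simp]:
  "total_sp (adjunction_family X M A h hb) = adjunction_space (total_sp X) (total_sp M)
     {e \<in> topspace (total_sp M). prj M e \<in> A} h"
  "base_sp (adjunction_family X M A h hb) = adjunction_space (base_sp X) (base_sp M) A hb"
  "prj (adjunction_family X M A h hb) = map_sum (prj X) (prj M)"
  "fib_ob (adjunction_family X M A h hb) (Inl b) = fib_ob X b"
  "fib_ob (adjunction_family X M A h hb) (Inr m) = fib_ob M m"
  "chart (adjunction_family X M A h hb) (Inl b) z = chart X b (projl z)"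
  "chart (adjunction_family X M A h hb) (Inr m) z = chart M m (projr z)"
  by (simp_all add: adjunction_family_def)

lemma attaching_F_map:
  assumes h: "F_map \<FF> (restrict_family M A) X h hb"
  shows "h ` (topspace (total_sp M) \<inter> {e \<in> topspace (total_sp M). prj M e \<in> A}) \<subseteq> topspace (total_sp X)"
    "hb ` (topspace (base_sp M) \<inter> A) \<subseteq> topspace (base_sp X)"
    "topspace (total_sp (adjunction_family X M A h hb)) =
       Inl ` topspace (total_sp X) \<union> Inr ` {e \<in> topspace (total_sp M). prj M e \<notin> A}"
    "topspace (base_sp (adjunction_family X M A h hb)) =
       Inl ` topspace (base_sp X) \<union> Inr ` (topspace (base_sp M) - A)"
proof -
  show 1: "h ` (topspace (total_sp M) \<inter> {e \<in> topspace (total_sp M). prj M e \<in> A}) \<subseteq> topspace (total_sp X)"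
    and 2: "hb ` (topspace (base_sp M) \<inter> A) \<subseteq> topspace (base_sp X)"
    using F_mapD(5,6)[OF h] by auto
  show "topspace (total_sp (adjunction_family X M A h hb)) =
       Inl ` topspace (total_sp X) \<union> Inr ` {e \<in> topspace (total_sp M). prj M e \<notin> A}"
    by (simp add: topspace_adjunction_space[OF 1]) auto
  show "topspace (base_sp (adjunction_family X M A h hb)) =
       Inl ` topspace (base_sp X) \<union> Inr ` (topspace (base_sp M) - A)"
    by (simp add: topspace_adjunction_space[OF 2])
qed

text \<open>Splits an isomorphism of families into two push-outs of spaces and fibrewise conditions.
  Over \<open>A\<close> no coarrow of \<open>k\<close> is asked for, because those fibres are
  represented in the adjunction by fibres of \<open>X\<close>.\<close>

lemma is_pushout_familyI:
  assumes X: "is_family \<FF> X" and M: "is_family \<FF> M" and P: "is_family \<FF> P"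
    and h: "F_map \<FF> (restrict_family M A) X h hb"
    and tot: "is_pushout (total_sp X) (total_sp M) {e \<in> topspace (total_sp M). prj M e \<in> A} h (total_sp P) id k"
    and base: "is_pushout (base_sp X) (base_sp M) A hb (base_sp P) id kb"
    and j: "F_map \<FF> X P id id" and k: "F_map \<FF> M P k kb"
    and cj: "\<And>b. b \<in> topspace (base_sp X) \<Longrightarrow> fibre_coarrow \<FF> X b P b id"
    and ck: "\<And>m. m \<in> topspace (base_sp M) \<Longrightarrow> m \<notin> A \<Longrightarrow> fibre_coarrow \<FF> M m P (kb m) k"
  shows "is_pushout_family \<FF> X M A h hb P id id k kb"
proof -
  let ?A = "adjunction_family X M A h hb"
  note top = attaching_F_map(3,4)[OF h]
  have ht: "homeomorphic_map (total_sp ?A) (total_sp P) (case_sum id k)"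
    and hbs: "homeomorphic_map (base_sp ?A) (base_sp P) (case_sum id kb)"
    using tot base by (simp_all add: is_pushout_def)
  have fib: "(\<exists>x\<in>fibre X b. z = Inl x)" if "z \<in> fibre ?A (Inl b)" for z b
    using that unfolding fibre_def top by auto
  have fib': "(\<exists>e\<in>fibre M m. z = Inr e)" if "z \<in> fibre ?A (Inr m)" for z m
    using that unfolding fibre_def top by auto
  have F: "F_map \<FF> ?A P (case_sum id k) (case_sum id kb)"
    unfolding F_map_iff
  proof (intro conjI ballI)
    show "continuous_map (total_sp ?A) (total_sp P) (case_sum id k)"
      using ht by (rule homeomorphic_imp_continuous_map)
    show "continuous_map (base_sp ?A) (base_sp P) (case_sum id kb)"
      using hbs by (rule homeomorphic_imp_continuous_map)
    show "prj P (case_sum id k z) = case_sum id kb (prj ?A z)" if "z \<in> topspace (total_sp ?A)" for z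
      using that F_mapD(3)[OF j] F_mapD(3)[OF k] unfolding top by auto
    show "fibre_arrow \<FF> ?A c P (case_sum id kb c) (case_sum id k)" if "c \<in> topspace (base_sp ?A)" for c
    proof (cases c)
      case (Inl b)
      then have b: "b \<in> topspace (base_sp X)" using that unfolding top by auto
      show ?thesis unfolding Inl
        by (rule fibre_arrow_change[OF F_mapD(4)[OF j b]]) (use fib in force)+
    next
      case (Inr m)
      then have m: "m \<in> topspace (base_sp M)" using that unfolding top by auto
      show ?thesis unfolding Inr
        by (rule fibre_arrow_change[OF F_mapD(4)[OF k m]]) (use fib' in force)+
    qed
  qed
  have "F_iso \<FF> ?A P (case_sum id k) (case_sum id kb)"
  proof (rule F_isoI_coarrow[OF _ F ht hbs prj_in_base[OF P]])
    show "prj ?A z \<in> topspace (base_sp ?A)" if "z \<in> topspace (total_sp ?A)" for z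
      using that prj_in_base[OF X] prj_in_base[OF M] unfolding top by auto
    show "fibre_coarrow \<FF> ?A c P (case_sum id kb c) (case_sum id k)" if "c \<in> topspace (base_sp ?A)" for c
    proof (cases c)
      case (Inl b)
      then have b: "b \<in> topspace (base_sp X)" using that unfolding top by auto
      show ?thesis unfolding Inl
        by (rule fibre_coarrow_change[OF cj[OF b]]) (use fib in force)+
    next
      case (Inr m)
      then have m: "m \<in> topspace (base_sp M)" "m \<notin> A" using that unfolding top by auto
      show ?thesis unfolding Inr
        by (rule fibre_coarrow_change[OF ck[OF m]]) (use fib' in force)+
    qed
  qed
  then show ?thesis
    unfolding is_pushout_family_def using tot base by (auto simp: is_pushout_def)
qed

text \<open>Converse of \<open>is_pushout_familyI\<close>: the conditions are restrictions of the
  comparison isomorphism to the two pieces, except that \<open>k\<close> over \<open>A\<close> needs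
  a separate argument.\<close>

lemma is_pushout_familyD:
  assumes C: "structure_category \<FF>" and X: "is_family \<FF> X" and M: "is_family \<FF> M"
    and h: "F_map \<FF> (restrict_family M A) X h hb"
    and po: "is_pushout_family \<FF> X M A h hb P id id k kb"
  shows "is_pushout (total_sp X) (total_sp M) {e \<in> topspace (total_sp M). prj M e \<in> A} h (total_sp P) id k"
    "is_pushout (base_sp X) (base_sp M) A hb (base_sp P) id kb"
    "F_map \<FF> X P id id" "F_map \<FF> M P k kb"
    "\<And>b. b \<in> topspace (base_sp X) \<Longrightarrow> fibre_coarrow \<FF> X b P b id"
    "\<And>m. m \<in> topspace (base_sp M) \<Longrightarrow> m \<notin> A \<Longrightarrow> fibre_coarrow \<FF> M m P (kb m) k"
proof -
  let ?A = "adjunction_family X M A h hb" and ?AT = "{e \<in> topspace (total_sp M). prj M e \<in> A}"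
  note top = attaching_F_map(3,4)[OF h]
  have iso: "F_iso \<FF> ?A P (case_sum id k) (case_sum id kb)"
    and gt: "\<And>e. e \<in> topspace (total_sp M) \<Longrightarrow> prj M e \<in> A \<Longrightarrow> h e = k e"
    and gb: "\<And>m. m \<in> topspace (base_sp M) \<Longrightarrow> m \<in> A \<Longrightarrow> hb m = kb m"
    using po unfolding is_pushout_family_def by auto
  have F: "F_map \<FF> ?A P (case_sum id k) (case_sum id kb)" using iso by (simp add: F_iso_def)
  have "homeomorphic_map (total_sp ?A) (total_sp P) (case_sum id k)"
    "homeomorphic_map (base_sp ?A) (base_sp P) (case_sum id kb)"
    using F_isoE[OF iso] homeomorphic_map_maps by metis+
  then show tot: "is_pushout (total_sp X) (total_sp M) ?AT h (total_sp P) id k"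
    and base: "is_pushout (base_sp X) (base_sp M) A hb (base_sp P) id kb"
    using gt gb by (auto simp: is_pushout_def)
  have InlT: "Inl x \<in> fibre ?A (Inl b)" if "x \<in> fibre X b" for x b
    using that unfolding fibre_def top by auto
  have InrT: "Inr e \<in> fibre ?A (Inr m)" if "e \<in> fibre M m" "m \<notin> A" for e m
    using that unfolding fibre_def top by auto
  have InlB: "Inl b \<in> topspace (base_sp ?A)" if "b \<in> topspace (base_sp X)" for b
    using that unfolding top by auto
  have InrB: "Inr m \<in> topspace (base_sp ?A)" if "m \<in> topspace (base_sp M)" "m \<notin> A" for m
    using that unfolding top by auto
  have jarr: "fibre_arrow \<FF> X b P b id" if "b \<in> topspace (base_sp X)" for b
    by (rule fibre_arrow_change[OF F_mapD(4)[OF F InlB[OF that]]]) (use InlT in force)+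
  have prjX: "prj P x = prj X x" if "x \<in> topspace (total_sp X)" for x
    using F_mapD(3)[OF F, of "Inl x"] that unfolding top by auto
  show "F_map \<FF> X P id id"
    unfolding F_map_iff
    using pushout_continuous_inclusion[OF tot attaching_F_map(1)[OF h]]
      pushout_continuous_inclusion[OF base attaching_F_map(2)[OF h]] jarr prjX
    by simp
  show "F_map \<FF> M P k kb"
    unfolding F_map_iff
  proof (intro conjI ballI)
    show "continuous_map (total_sp M) (total_sp P) k"
      by (rule pushout_continuous_chr[OF tot attaching_F_map(1)[OF h]])
    show "continuous_map (base_sp M) (base_sp P) kb"
      by (rule pushout_continuous_chr[OF base attaching_F_map(2)[OF h]])
    show "prj P (k e) = kb (prj M e)" if e: "e \<in> topspace (total_sp M)" for e
    proof (cases "prj M e \<in> A")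
      case True
      then have "h e \<in> topspace (total_sp X)" "prj X (h e) = hb (prj M e)"
        using F_mapD(3,5)[OF h, of e] e by auto
      then show ?thesis using gt[OF e True] gb[OF prj_in_base[OF M e] True] prjX by metis
    next
      case False
      then show ?thesis using F_mapD(3)[OF F, of "Inr e"] e unfolding top by auto
    qed
    show "fibre_arrow \<FF> M m P (kb m) k" if m: "m \<in> topspace (base_sp M)" for m
    proof (cases "m \<in> A")
      case True
      \<comment> \<open>The fibre over \<open>m\<close> does not occur in the adjunction here; its
        morphism is that of \<open>h\<close> followed by that of the inclusion of
        \<open>X\<close>.\<close>
      let ?R = "restrict_family M A"
      have mR: "m \<in> topspace (base_sp ?R)" using m True by simp
      have hm: "hb m \<in> topspace (base_sp X)" using F_mapD(6)[OF h mR] .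
      have "fibre_arrow \<FF> ?R m P (hb m) (\<lambda>x. id (h x))"
        by (rule fibre_arrow_compose[OF C is_family_restrict_family[OF M] F_mapD(4)[OF h mR] jarr[OF hm]])
          (use F_mapD(3,5)[OF h] in \<open>auto simp: fibre_def\<close>)
      then show ?thesis
      proof (rule fibre_arrow_change)
        show "\<exists>x\<in>fibre ?R m. chart M m e = chart ?R m x \<and> chart P (kb m) (k e) = chart P (hb m) (id (h x))"
          if "e \<in> fibre M m" for e
          using that True gt gb[OF m True] by (intro bexI[of _ e]) (auto simp: fibre_def)
      qed (simp_all add: gb[OF m True])
    next
      case False
      show ?thesis
        by (rule fibre_arrow_change[OF F_mapD(4)[OF F InrB[OF m False]]])
          (use InrT False in force)+
    qed
  qed
  show "fibre_coarrow \<FF> X b P b id" if "b \<in> topspace (base_sp X)" for b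
    by (rule fibre_coarrow_change[OF F_iso_fibre_coarrow[OF iso InlB[OF that]]]) (use InlT in force)+
  show "fibre_coarrow \<FF> M m P (kb m) k" if "m \<in> topspace (base_sp M)" "m \<notin> A" for m
    by (rule fibre_coarrow_change[OF F_iso_fibre_coarrow[OF iso InrB[OF that]]])
      (use InrT that in force)+
qed

text \<open>The inductive step of the theorem, free of stratifications. \<open>FM\<close> is a copy
  of the pull-back of \<open>FM'\<close> along \<open>g\<close>; the maps \<open>h\<close> and
  \<open>k\<close> act by \<open>a\<close>, \<open>c\<close> on the base coordinate and by
  \<open>h'\<close>, \<open>k'\<close> on the fibre coordinate after passing through
  \<open>w\<close>.\<close>

lemma pullback_pushout_family:
  fixes X :: "'b topology" and M :: "'m topology"
    and FX :: "('x, 'c, 'o, 'v) family" and FM' :: "('e, 'n, 'o, 'v) family"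
    and FM :: "('w, 'm, 'o, 'v) family"
  assumes C: "structure_category \<FF>"
    and fam: "is_family \<FF> FX" "is_family \<FF> FM'" "is_family \<FF> FZ" "is_family \<FF> FM"
    and po': "is_pushout_family \<FF> FX FM' A' h' a' FZ id id k' c'"
    and h': "F_map \<FF> (restrict_family FM' A') FX h' a'"
    and FM: "base_sp FM = M" and w: "F_iso \<FF> FM (pullback M g FM') w id"
    and base: "is_pushout X M A a Z id c" and a: "continuous_map (subtopology M A) X a"
    and f: "continuous_map Z (base_sp FZ) f" and g: "continuous_map M (base_sp FM') g"
    and fX: "\<And>x. x \<in> topspace X \<Longrightarrow> f x \<in> topspace (base_sp FX)"
    and strat: "\<And>z. z \<in> topspace Z \<Longrightarrow> z \<notin> topspace X \<Longrightarrow> f z \<notin> topspace (base_sp FX)"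
    and gA: "\<And>m. m \<in> topspace M \<Longrightarrow> m \<in> A \<Longrightarrow> g m \<in> A'"
    and fa: "\<And>m. m \<in> topspace M \<Longrightarrow> m \<in> A \<Longrightarrow> f (a m) = a' (g m)"
    and fc: "\<And>m. m \<in> topspace M \<Longrightarrow> f (c m) = c' (g m)"
    and prjX: "prj FX = prj FZ"
    and sub: "X = subtopology Z (topspace X)" "base_sp FX = subtopology (base_sp FZ) (topspace (base_sp FX))"
      "total_sp FX = subtopology (total_sp FZ) (topspace (total_sp FX))"
    and clo: "closedin Z (topspace X)" "closedin (total_sp FZ) (topspace (total_sp FX))"
    and H: "Hausdorff_space (base_sp FM')" "Hausdorff_space (base_sp FZ)"
    and ko: "k_omega_normal_space X" "k_omega_normal_space M" "k_omega_normal_space Z"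
      "k_omega_normal_space (total_sp FX)" "k_omega_normal_space (total_sp FM')"
      "k_omega_normal_space (total_sp FZ)"
  obtains h k where "F_map \<FF> (restrict_family FM A) (pullback X f FX) h a"
    "is_pushout_family \<FF> (pullback X f FX) FM A h a (pullback Z f FZ) id id k c"
proof -
  let ?PX = "pullback X f FX" and ?PM = "pullback M g FM'" and ?PZ = "pullback Z f FZ"
  let ?h = "\<lambda>e. (a (fst (w e)), h' (snd (w e)))" and ?k = "\<lambda>e. (c (fst (w e)), k' (snd (w e)))"
  note D' = is_pushout_familyD[OF C fam(1,2) h' po']
  note aA = attaching_image[OF a]
  have aA': "a' ` (topspace (base_sp FM') \<inter> A') \<subseteq> topspace (base_sp FX)" by (rule attaching_F_map(2)[OF h'])
  have fcont: "continuous_map X (base_sp FX) f"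
  proof -
    have "continuous_map (subtopology Z (topspace X)) (base_sp FZ) f"
      using f by (rule continuous_map_from_subtopology)
    then have "continuous_map X (base_sp FZ) f" using sub(1) by simp
    then have "continuous_map X (subtopology (base_sp FZ) (topspace (base_sp FX))) f"
      using fX by (simp add: continuous_map_in_subtopology Pi_iff image_subset_iff)
    then show ?thesis using sub(2) by simp
  qed
  have gM: "g m \<in> topspace (base_sp FM')" if "m \<in> topspace M" for m
    using g that by (rule continuous_map_in_topspace)
  \<comment> \<open>Stratum preservation again: if \<open>m\<close> is off \<open>A\<close>, then
    \<open>c m\<close> is outside \<open>X\<close>, so \<open>c' (g m)\<close> is outside the old
    base, whereas \<open>g m \<in> A'\<close> would put it there.\<close>
  have gA_iff: "g m \<in> A' \<longleftrightarrow> m \<in> A" if m: "m \<in> topspace M" for m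
  proof
    assume gm: "g m \<in> A'"
    show "m \<in> A"
    proof (rule ccontr)
      assume mA: "m \<notin> A"
      have "c m \<in> topspace Z" using pushout_topspace[OF base aA] m by auto
      then have "f (c m) \<notin> topspace (base_sp FX)" using strat pushout_inj(1)[OF base aA m mA] by blast
      moreover have "c' (g m) = a' (g m)" using pushout_glue[OF D'(2) aA' gM[OF m] gm] .
      ultimately show False using fc[OF m] aA' gM[OF m] gm by auto
    qed
  qed (use gA m in blast)
  have famPX: "is_family \<FF> ?PX" using fam(1) fcont by (rule is_family_pullback)
  have famPZ: "is_family \<FF> ?PZ" using fam(3) f by (rule is_family_pullback)
  obtain wi wb where wF: "F_map \<FF> FM ?PM w id" and wm: "homeomorphic_maps (total_sp FM) (total_sp ?PM) w wi"
    by (rule F_isoE[OF w])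
  have wh: "homeomorphic_map (total_sp FM) (total_sp ?PM) w" using wm homeomorphic_map_maps by blast
  have w1: "fst (w e) = prj FM e" "w e \<in> topspace (total_sp ?PM)" if "e \<in> topspace (total_sp FM)" for e
    using F_mapD(3,5)[OF wF] that by simp_all
  have hF: "F_map \<FF> (restrict_family FM A) ?PX ?h a"
  proof -
    have eq: "restrict_family ?PM A = pullback (subtopology M A) g (restrict_family FM' A')"
      by (rule restrict_family_pullback) (use gA in blast)
    have 1: "F_map \<FF> (restrict_family FM A) (restrict_family ?PM A) w id"
      by (rule F_map_restrict_family[OF wF _ fam(4)]) simp
    have 2: "F_map \<FF> (pullback (subtopology M A) g (restrict_family FM' A')) ?PX (\<lambda>(t, y). (a t, h' y)) a"
    proof (rule F_map_pullback[OF h' a])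
      show "continuous_map (subtopology M A) (base_sp (restrict_family FM' A')) g"
        using g gA by (auto simp: continuous_map_in_subtopology continuous_map_from_subtopology)
      show "f (a t) = a' (g t)" if "t \<in> topspace (subtopology M A)" for t using fa that by simp
    qed
    show ?thesis
      using F_map_compose[OF C is_family_restrict_family[OF fam(4)] 1 2[folded eq]]
      by (simp add: case_prod_beta)
  qed
  have jF: "F_map \<FF> ?PX ?PZ id id"
  proof -
    have "F_map \<FF> ?PX ?PZ (\<lambda>(t, y). (id t, id y)) id"
      by (rule F_map_pullback[OF D'(3) pushout_continuous_inclusion[OF base aA] fcont]) simp
    moreover have "(\<lambda>(t, y). (id t, id y)) = (id :: 'b \<times> 'x \<Rightarrow> 'b \<times> 'x)" by auto
    ultimately show ?thesis by simp
  qed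
  have KF: "F_map \<FF> ?PM ?PZ (\<lambda>(t, y). (c t, k' y)) c"
    by (rule F_map_pullback[OF D'(4) pushout_continuous_chr[OF base aA] g fc])
  have kF: "F_map \<FF> FM ?PZ ?k c"
    using F_map_compose[OF C fam(4) wF KF] by (simp add: case_prod_beta)
  have tot: "is_pushout (total_sp ?PX) (total_sp FM) {e \<in> topspace (total_sp FM). prj FM e \<in> A} ?h
      (total_sp ?PZ) id ?k"
  proof -
    let ?S = "{z \<in> topspace (total_sp ?PM). fst z \<in> A}"
    have p: "continuous_map (total_sp FM') (base_sp FM') (prj FM')"
      and q: "continuous_map (total_sp FZ) (base_sp FZ) (prj FZ)"
      using fam(2,3) by (simp_all add: is_family_def)
    have po: "is_pushout (total_sp ?PX) (total_sp ?PM) ?S (\<lambda>z. (a (fst z), h' (snd z))) (total_sp ?PZ) id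
        (\<lambda>z. (c (fst z), k' (snd z)))"
      unfolding pullback_simps prjX
    proof (rule is_pushout_fibre_product[OF base aA D'(2) aA' D'(1) attaching_F_map(1)[OF h'] refl p q])
      show "prj FZ y \<in> topspace (base_sp FX)" if "y \<in> topspace (total_sp FX)" for y
        using prj_in_base[OF fam(1) that] by (simp add: prjX)
      show "prj FZ (k' e) = c' (prj FM' e)" if "e \<in> topspace (total_sp FM')" for e
        by (rule F_mapD(3)[OF D'(4) that])
    qed (fact f g fX strat gA_iff fc sub clo H ko)+
    have hS: "(\<lambda>z. (a (fst z), h' (snd z))) ` (topspace (total_sp ?PM) \<inter> ?S) \<subseteq> topspace (total_sp ?PX)"
    proof (rule image_subsetI)
      fix z assume "z \<in> topspace (total_sp ?PM) \<inter> ?S"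
      then have z: "z \<in> topspace (total_sp ?PM)" "fst z \<in> A" by auto
      obtain e where "e \<in> topspace (total_sp FM)" "z = w e"
        using homeomorphic_imp_surjective_map[OF wh] z(1) by blast
      then show "(a (fst z), h' (snd z)) \<in> topspace (total_sp ?PX)"
        using F_mapD(5)[OF hF, of e] z(2) w1(1) by simp
    qed
    have "{n \<in> topspace (total_sp FM). w n \<in> ?S} = {e \<in> topspace (total_sp FM). prj FM e \<in> A}"
    proof (intro Collect_cong conj_cong refl)
      fix e assume "e \<in> topspace (total_sp FM)"
      then show "w e \<in> ?S \<longleftrightarrow> prj FM e \<in> A" using w1[of e] by (simp only: mem_Collect_eq simp_thms)
    qed
    then show ?thesis using is_pushout_precompose[OF po hS wh] by simp
  qed
  have "is_pushout_family \<FF> ?PX FM A ?h a ?PZ id id ?k c"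
  proof (rule is_pushout_familyI[OF famPX fam(4) famPZ hF tot _ jF kF])
    show "is_pushout (base_sp ?PX) (base_sp FM) A a (base_sp ?PZ) id c" using base FM by simp
    show "fibre_coarrow \<FF> ?PX b ?PZ b id" if "b \<in> topspace (base_sp ?PX)" for b
    proof (rule fibre_coarrow_change[OF D'(5), of "f b"])
      show "f b \<in> topspace (base_sp FX)" using that fX by simp
      show "\<exists>x\<in>fibre FX (f b). chart ?PX b x' = chart FX (f b) x \<and> chart ?PZ b (id x') = chart FZ (f b) (id x)"
        if "x' \<in> fibre ?PX b" for x'
        using that by (intro bexI[of _ "snd x'"]) (auto simp: fibre_def)
    qed simp_all
    show "fibre_coarrow \<FF> FM m ?PZ (c m) ?k" if "m \<in> topspace (base_sp FM)" "m \<notin> A" for m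
    proof -
      have m: "m \<in> topspace M" "g m \<in> topspace (base_sp FM')" "g m \<notin> A'"
        using that FM gM gA_iff by auto
      have 1: "fibre_coarrow \<FF> FM m ?PM m w"
        using F_iso_fibre_coarrow[OF w that(1)] by simp
      have 2: "fibre_coarrow \<FF> ?PM m ?PZ (c m) (\<lambda>z. (c (fst z), k' (snd z)))"
      proof (rule fibre_coarrow_change[OF D'(6)[OF m(2,3)]])
        show "\<exists>x\<in>fibre FM' (g m). chart ?PM m x' = chart FM' (g m) x \<and>
            chart ?PZ (c m) (c (fst x'), k' (snd x')) = chart FZ (c' (g m)) (k' x)"
          if "x' \<in> fibre ?PM m" for x'
          using that fc[OF m(1)] by (intro bexI[of _ "snd x'"]) (auto simp: fibre_def)
      qed (simp_all add: fc[OF m(1)])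
      show ?thesis
      proof (rule fibre_coarrow_compose[OF C famPZ 1 2])
        show "w x \<in> fibre ?PM m" if "x \<in> fibre FM m" for x
          using that w1 by (simp add: fibre_def)
        show "(c (fst y), k' (snd y)) \<in> fibre ?PZ (c m)" if "y \<in> fibre ?PM m" for y
          using that F_mapD(3,5)[OF KF, of y] by (auto simp: fibre_def)
      qed
    qed
  qed
  with hF show ?thesis by (rule that)
qed

section \<open>Stratified spaces and bundles\<close>

lemma stratified_spaceD:
  assumes "stratified_space B"
  shows "str_fil B i \<subseteq> str_fil B (Suc i)" "(\<Union>i. str_fil B i) = topspace (str_sp B)"
    "topspace (step_sp B i) = str_fil B i"
    "continuous_map (subtopology (att_sp B (Suc i)) (att_sub B (Suc i))) (step_sp B i) (att_map B (Suc i))"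
    "is_pushout (step_sp B i) (att_sp B (Suc i)) (att_sub B (Suc i)) (att_map B (Suc i))
       (step_sp B (Suc i)) id (chr_map B (Suc i))"
    "step_sp B i = subtopology (step_sp B (Suc i)) (str_fil B i)"
proof -
  show 1: "str_fil B i \<subseteq> str_fil B (Suc i)" and 2: "(\<Union>i. str_fil B i) = topspace (str_sp B)"
    and "continuous_map (subtopology (att_sp B (Suc i)) (att_sub B (Suc i))) (step_sp B i) (att_map B (Suc i))"
    and "is_pushout (step_sp B i) (att_sp B (Suc i)) (att_sub B (Suc i)) (att_map B (Suc i))
       (step_sp B (Suc i)) id (chr_map B (Suc i))"
    using assms unfolding stratified_space_def is_filtered_colimit_def by blast+
  show "topspace (step_sp B i) = str_fil B i" using 2 by auto
  show "step_sp B i = subtopology (step_sp B (Suc i)) (str_fil B i)"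
    using 1 by (simp add: subtopology_subtopology inf.absorb2)
qed

lemma attached_space_lch_Lindelof:
  assumes "attached_spaces_locally_finite_countable B"
  shows "lch_Lindelof_space (step_sp B 0)" "lch_Lindelof_space (att_sp B (Suc i))"
    "closedin (att_sp B (Suc i)) (att_sub B (Suc i))"
proof -
  have 1: "locally_finite_countable_CW_pair (att_sp B (Suc i)) (att_sub B (Suc i))"
    using assms by (simp add: attached_spaces_locally_finite_countable_def)
  show "lch_Lindelof_space (step_sp B 0)"
    using assms by (intro locally_finite_countable_CW_lch_Lindelof)
      (simp add: attached_spaces_locally_finite_countable_def)
  show "lch_Lindelof_space (att_sp B (Suc i))" "closedin (att_sp B (Suc i)) (att_sub B (Suc i))"
    using locally_finite_countable_CW_pairD[OF 1] locally_finite_countable_CW_lch_Lindelof by blast+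
qed

lemma step_space_k_omega_normal:
  assumes B: "stratified_space B" and lf: "attached_spaces_locally_finite_countable B"
  shows "k_omega_normal_space (step_sp B i)"
proof (induction i)
  case 0
  show ?case using attached_space_lch_Lindelof(1)[OF lf] by (rule lch_Lindelof_imp_k_omega_normal)
next
  case (Suc i)
  show ?case
    by (rule pushout_k_omega_normal[OF stratified_spaceD(5,4)[OF B] attached_space_lch_Lindelof(3)[OF lf] Suc
        lch_Lindelof_imp_k_omega_normal[OF attached_space_lch_Lindelof(2)[OF lf]]])
qed

lemma total_space_preimage_closed:
  assumes "is_family \<FF> M" "closedin (base_sp M) A"
  shows "closedin (total_sp M) {e \<in> topspace (total_sp M). prj M e \<in> A}"
  using assms by (intro closedin_continuous_map_preimage[of _ "base_sp M"]) (auto simp: is_family_def)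

lemma stratified_fibre_bundle_stepE:
  assumes "stratified_fibre_bundle \<FF> B X"
  obtains M :: "('m \<times> 'v, 'm, 'o, 'v) family" and h k
  where "F_bundle \<FF> M" "base_sp M = att_sp B (Suc i)"
    "F_map \<FF> (restrict_family M (att_sub B (Suc i))) (restrict_family X (str_fil B i)) h (att_map B (Suc i))"
    "is_pushout_family \<FF> (restrict_family X (str_fil B i)) M (att_sub B (Suc i)) h (att_map B (Suc i))
       (restrict_family X (str_fil B (Suc i))) id id k (chr_map B (Suc i))"
  using assms unfolding stratified_fibre_bundle_def by meson

text \<open>Induction along the filtration: each attached bundle has a locally compact, Lindelof,
  Hausdorff total space, glued along the closed preimage of the attaching subset.\<close>

lemma total_space_k_omega_normal:
  fixes B :: "('b, 'm) stratified" and X :: "('x, 'b, 'o, 'v) family"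
  assumes C: "structure_category \<FF>" and X: "stratified_fibre_bundle \<FF> B X"
    and lf: "attached_spaces_locally_finite_countable B"
  shows "k_omega_normal_space (total_sp (restrict_family X (str_fil B i)))"
proof (induction i)
  case 0
  have "F_bundle \<FF> (restrict_family X (str_fil B 0))" "base_sp X = str_sp B"
    using X by (auto simp: stratified_fibre_bundle_def)
  then show ?case
    using attached_space_lch_Lindelof(1)[OF lf]
    by (intro lch_Lindelof_imp_k_omega_normal F_bundle_total_lch_Lindelof[OF C]) auto
next
  case (Suc i)
  have fam: "is_family \<FF> (restrict_family X S)" for S
    using X by (intro is_family_restrict_family) (simp add: stratified_fibre_bundle_def)
  obtain M :: "('m \<times> 'v, 'm, 'o, 'v) family" and h k
    where M: "F_bundle \<FF> M" "base_sp M = att_sp B (Suc i)"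
    and h: "F_map \<FF> (restrict_family M (att_sub B (Suc i))) (restrict_family X (str_fil B i)) h (att_map B (Suc i))"
    and po: "is_pushout_family \<FF> (restrict_family X (str_fil B i)) M (att_sub B (Suc i)) h (att_map B (Suc i))
       (restrict_family X (str_fil B (Suc i))) id id k (chr_map B (Suc i))"
    by (rule stratified_fibre_bundle_stepE[OF X, where i = i])
  have famM: "is_family \<FF> M" using M(1) by (simp add: F_bundle_def)
  show ?case
  proof (rule pushout_k_omega_normal[OF is_pushout_familyD(1)[OF C fam famM h po]])
    show "continuous_map (subtopology (total_sp M) {e \<in> topspace (total_sp M). prj M e \<in> att_sub B (Suc i)})
        (total_sp (restrict_family X (str_fil B i))) h"
      using F_mapD(1)[OF h] by simp
    show "closedin (total_sp M) {e \<in> topspace (total_sp M). prj M e \<in> att_sub B (Suc i)}"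
      by (rule total_space_preimage_closed[OF famM]) (simp add: M(2) attached_space_lch_Lindelof(3)[OF lf])
    show "k_omega_normal_space (total_sp M)"
      by (intro lch_Lindelof_imp_k_omega_normal F_bundle_total_lch_Lindelof[OF C M(1)])
        (simp add: M(2) attached_space_lch_Lindelof(2)[OF lf])
  qed (rule Suc)
qed

text \<open>Beyond a bound \<open>N\<close> for the indices of non-empty strata the filtration is
  constant, so its union is already \<open>str_fil B N\<close>.\<close>

lemma finite_strata_stabilize:
  assumes B: "stratified_space B" and fin: "finite_strata B"
  obtains N where "str_fil B N = topspace (str_sp B)"
proof -
  obtain N where N: "\<And>i. str_fil B (Suc i) - str_fil B i \<noteq> {} \<Longrightarrow> i < N"
    using fin unfolding finite_strata_def finite_nat_set_iff_bounded by auto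
  have mono: "str_fil B i \<subseteq> str_fil B j" if "i \<le> j" for i j
    using that stratified_spaceD(1)[OF B] by (rule lift_Suc_mono_le[rotated])
  have "str_fil B (N + i) \<subseteq> str_fil B N" for i
  proof (induction i)
    case (Suc i)
    have "str_fil B (Suc (N + i)) - str_fil B (N + i) = {}" using N[of "N + i"] by fastforce
    then show ?case using Suc by auto
  qed simp
  then have "str_fil B i \<subseteq> str_fil B N" for i
    using mono[of i "N + i"] by (meson le_add2 subset_trans)
  then have "str_fil B N = (\<Union>i. str_fil B i)" by blast
  then show ?thesis using stratified_spaceD(2)[OF B] by (intro that[of N]) simp
qed

theorem mainTheorem1:
  fixes \<FF> :: "('o, 'r, 'v) strcat"
    and B :: "('b, 'm) stratified"
    and B' :: "('c, 'n) stratified"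
    and f :: "'b \<Rightarrow> 'c" and g :: "nat \<Rightarrow> 'm \<Rightarrow> 'n"
    and X' :: "('x, 'c, 'o, 'v) family"
  assumes "structure_category \<FF>"
    and "finite_stratified_space B" and "attached_spaces_locally_finite_countable B"
    and "finite_stratified_space B'" and "attached_spaces_locally_finite_countable B'"
    and "stratified_map B B' f g" and "stratum_preserving B B' f"
    and "stratified_fibre_bundle \<FF> B' X'"
  shows "stratified_fibre_bundle \<FF> B (pullback (str_sp B) f X')"
proof -
  note C = assms(1) and lf = assms(3) and lf' = assms(5) and X' = assms(8)
  let ?P = "pullback (str_sp B) f X'"
  have B: "stratified_space B" "finite_strata B" and B': "stratified_space B'"
    using assms(2,4) by (simp_all add: finite_stratified_space_def)
  note BD = stratified_spaceD[OF B(1)] and BD' = stratified_spaceD[OF B']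
  have fcont: "continuous_map (str_sp B) (str_sp B') f"
    and fil: "\<And>i b. b \<in> str_fil B i \<Longrightarrow> f b \<in> str_fil B' i"
    using assms(6) by (auto simp: stratified_map_def)
  have gcont: "continuous_map (att_sp B (Suc i)) (att_sp B' (Suc i)) (g (Suc i))"
    and gA: "\<And>m. m \<in> att_sub B (Suc i) \<Longrightarrow> g (Suc i) m \<in> att_sub B' (Suc i)"
    and fa: "\<And>m. m \<in> att_sub B (Suc i) \<Longrightarrow> f (att_map B (Suc i) m) = att_map B' (Suc i) (g (Suc i) m)"
    and fc: "\<And>m. m \<in> topspace (att_sp B (Suc i)) \<Longrightarrow> f (chr_map B (Suc i) m) = chr_map B' (Suc i) (g (Suc i) m)" for i
    using assms(6) by (auto simp: stratified_map_def image_subset_iff)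
  have strat: "\<And>b i. b \<in> str_fil B (Suc i) \<Longrightarrow> b \<notin> str_fil B i \<Longrightarrow> f b \<notin> str_fil B' i"
    using assms(7) unfolding stratum_preserving_def by blast
  have famX': "is_family \<FF> X'" and baseX': "base_sp X' = str_sp B'"
    and bun0: "F_bundle \<FF> (restrict_family X' (str_fil B' 0))"
    using X' by (auto simp: stratified_fibre_bundle_def)
  have famP: "is_family \<FF> ?P" using famX' fcont baseX' by (intro is_family_pullback) auto
  have restr: "restrict_family ?P (str_fil B i) = pullback (step_sp B i) f (restrict_family X' (str_fil B' i))" for i
    by (rule restrict_family_pullback) (rule fil)
  have fstep: "continuous_map (step_sp B i) (step_sp B' i) f" for i
    using fcont fil by (auto simp: continuous_map_in_subtopology continuous_map_from_subtopology)
  have "F_bundle \<FF> (restrict_family ?P (str_fil B 0))"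
    unfolding restr by (rule F_bundle_pullback[OF C bun0]) (simp add: baseX' fstep)
  moreover have "\<exists>(M :: ('m \<times> 'v, 'm, 'o, 'v) family) h k.
        F_bundle \<FF> M \<and> base_sp M = att_sp B (Suc i) \<and>
        F_map \<FF> (restrict_family M (att_sub B (Suc i))) (restrict_family ?P (str_fil B i))
          h (att_map B (Suc i)) \<and>
        is_pushout_family \<FF> (restrict_family ?P (str_fil B i)) M (att_sub B (Suc i))
          h (att_map B (Suc i))
          (restrict_family ?P (str_fil B (Suc i))) id id k (chr_map B (Suc i))" for i
  proof -
    let ?X = "restrict_family X' (str_fil B' i)" and ?Z = "restrict_family X' (str_fil B' (Suc i))"
    obtain M' :: "('n \<times> 'v, 'n, 'o, 'v) family" and h' k'
      where M': "F_bundle \<FF> M'" "base_sp M' = att_sp B' (Suc i)"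
      and h': "F_map \<FF> (restrict_family M' (att_sub B' (Suc i))) ?X h' (att_map B' (Suc i))"
      and po': "is_pushout_family \<FF> ?X M' (att_sub B' (Suc i)) h' (att_map B' (Suc i)) ?Z id id k'
        (chr_map B' (Suc i))"
      by (rule stratified_fibre_bundle_stepE[OF X', where i = i])
    have famM': "is_family \<FF> M'" using M'(1) by (simp add: F_bundle_def)
    have fam: "is_family \<FF> ?X" "is_family \<FF> ?Z" using famX' by (simp_all add: is_family_restrict_family)
    let ?PM = "pullback (att_sp B (Suc i)) (g (Suc i)) M'"
    have gM': "continuous_map (att_sp B (Suc i)) (base_sp M') (g (Suc i))" using gcont M'(2) by simp
    have famPM: "is_family \<FF> ?PM" using famM' gM' by (rule is_family_pullback)
    \<comment> \<open>The pull-back itself has points in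
      \<open>'m \<times> ('n \<times> 'v)\<close>, while the definition asks for points in
      \<open>'m \<times> 'v\<close>; \<open>M\<close> is an isomorphic copy there.\<close>
    obtain M :: "('m \<times> 'v, 'm, 'o, 'v) family" and v
      where M: "is_family \<FF> M" "base_sp M = base_sp ?PM" and v: "F_iso \<FF> ?PM M v id"
      by (rule family_iso_on_product_type[OF C famPM])
    obtain w where w: "F_iso \<FF> M ?PM w id" by (rule F_iso_sym_id[OF v M(1)])
    have bunM: "F_bundle \<FF> M"
      by (rule F_bundle_iso[OF C M(1) F_bundle_pullback[OF C M'(1) gM'] M(2) w])
    have baseM: "base_sp M = att_sp B (Suc i)" using M(2) by simp
    have prjZ: "prj X' x \<in> str_fil B' (Suc i)" if "prj X' x \<in> str_fil B' i" for x
      using that BD'(1) by blast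
    have tot_X: "topspace (total_sp ?X) = {x \<in> topspace (total_sp X'). prj X' x \<in> str_fil B' i}" by auto
    have closed_base: "closedin (step_sp B (Suc i)) (str_fil B i)"
      using pushout_closedin_base[OF BD(5) attaching_image[OF BD(4)] attached_space_lch_Lindelof(3)[OF lf]]
      unfolding BD(3) .
    have closed_tot: "closedin (total_sp ?Z) (topspace (total_sp ?X))"
      by (rule pushout_closedin_base[OF is_pushout_familyD(1)[OF C fam(1) famM' h' po'] attaching_F_map(1)[OF h']])
        (rule total_space_preimage_closed[OF famM'], simp add: M'(2) attached_space_lch_Lindelof(3)[OF lf'])
    obtain h k where hk: "F_map \<FF> (restrict_family M (att_sub B (Suc i))) (pullback (step_sp B i) f ?X)
        h (att_map B (Suc i))"
      "is_pushout_family \<FF> (pullback (step_sp B i) f ?X) M (att_sub B (Suc i)) h (att_map B (Suc i))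
        (pullback (step_sp B (Suc i)) f ?Z) id id k (chr_map B (Suc i))"
    proof (rule pullback_pushout_family[OF C fam(1) famM' fam(2) M(1) po' h' baseM w BD(5) BD(4) _ gM'])
      show "continuous_map (step_sp B (Suc i)) (base_sp ?Z) f" using fstep baseX' by simp
      show "f x \<in> topspace (base_sp ?X)" if "x \<in> topspace (step_sp B i)" for x
        using that fil continuous_map_in_topspace[OF fstep[of i] that] baseX' by simp
      show "f z \<notin> topspace (base_sp ?X)"
        if "z \<in> topspace (step_sp B (Suc i))" "z \<notin> topspace (step_sp B i)" for z
        using that strat unfolding BD(3) by simp
      show "step_sp B i = subtopology (step_sp B (Suc i)) (topspace (step_sp B i))"
        unfolding BD(3) by (rule BD(6))
      show "base_sp ?X = subtopology (base_sp ?Z) (topspace (base_sp ?X))"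
        using BD'(6)[of i] BD'(3)[of i] baseX' by simp
      show "total_sp ?X = subtopology (total_sp ?Z) (topspace (total_sp ?X))"
        unfolding tot_X using prjZ by (auto simp: subtopology_subtopology intro!: arg_cong[of _ _ "subtopology _"])
      show "closedin (step_sp B (Suc i)) (topspace (step_sp B i))"
        unfolding BD(3) by (rule closed_base)
      show "closedin (total_sp ?Z) (topspace (total_sp ?X))" by (rule closed_tot)
      show "Hausdorff_space (base_sp M')"
        using attached_space_lch_Lindelof(2)[OF lf'] M'(2) by (simp add: lch_Lindelof_space_def)
      show "Hausdorff_space (base_sp ?Z)"
        using step_space_k_omega_normal[OF B' lf'] baseX' by (simp add: k_omega_normal_space_def)
      show "k_omega_normal_space (att_sp B (Suc i))"
        by (rule lch_Lindelof_imp_k_omega_normal[OF attached_space_lch_Lindelof(2)[OF lf]])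
      show "k_omega_normal_space (total_sp M')"
        by (intro lch_Lindelof_imp_k_omega_normal F_bundle_total_lch_Lindelof[OF C M'(1)])
          (simp add: M'(2) attached_space_lch_Lindelof(2)[OF lf'])
    qed (use gA fa fc step_space_k_omega_normal[OF B(1) lf] total_space_k_omega_normal[OF C X' lf'] in
        \<open>simp_all\<close>)
    show ?thesis
      unfolding restr using bunM baseM hk by blast
  qed
  moreover have "is_filtered_colimit (total_sp ?P) (\<lambda>i. {x \<in> topspace (total_sp ?P). prj ?P x \<in> str_fil B i})"
    unfolding is_filtered_colimit_def
  proof (intro conjI allI impI)
    \<comment> \<open>A set whose traces on all steps are open is open because one of these traces,
      on step \<open>N\<close>, is the set itself.\<close>
    obtain N where N: "str_fil B N = topspace (str_sp B)" using finite_strata_stabilize[OF B] .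
    have whole: "{x \<in> topspace (total_sp ?P). prj ?P x \<in> str_fil B N} = topspace (total_sp ?P)"
      unfolding N using prj_in_base[OF famP] by auto
    show "{x \<in> topspace (total_sp ?P). prj ?P x \<in> str_fil B n}
        \<subseteq> {x \<in> topspace (total_sp ?P). prj ?P x \<in> str_fil B (Suc n)}" for n
      using BD(1) by blast
    show "(\<Union>n. {x \<in> topspace (total_sp ?P). prj ?P x \<in> str_fil B n}) = topspace (total_sp ?P)"
      using whole by blast
    fix U assume U: "U \<subseteq> topspace (total_sp ?P)"
      and op: "\<forall>n. openin (subtopology (total_sp ?P) {x \<in> topspace (total_sp ?P). prj ?P x \<in> str_fil B n})
        (U \<inter> {x \<in> topspace (total_sp ?P). prj ?P x \<in> str_fil B n})"
    have "openin (subtopology (total_sp ?P) (topspace (total_sp ?P))) (U \<inter> topspace (total_sp ?P))"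
      using spec[OF op, of N] unfolding whole .
    then show "openin (total_sp ?P) U"
      unfolding subtopology_topspace using U by (simp only: Int_absorb2)
  qed
  ultimately show ?thesis
    unfolding stratified_fibre_bundle_def using B(1) famP by simp
qed

end
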